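(* Let $n\ge1$ and $s\in(0,1)$. Let $$\mathcal{H}(x,t):=\int_{\mathbb{R}^n}e^{-t(|\xi|^2+|\xi|^{2s})+2\pi i x\cdot\xi}\,d\xi\quad(t>0,\ x\in\mathbb{R}^n),\qquad \mathcal{K}(x):=\int_0^{+\infty}e^{-t}\,\mathcal{H}(x,t)\,dt.$$ Then: (a) $\mathcal{K}$ is positive, radially symmetric, smooth in $\mathbb{R}^n\setminus\{0\}$ and nonincreasing with respect to $r=|x|$. (b) There exist positive constants $C_3$ and $C_4$ such that, if $|x|\ge1$, $$\frac{C_3}{|x|^{n+2s}}\le\mathcal{K}(x)\le\frac{1}{C_3|x|^{n+2s}}$$ and, if $0<|x|\le1$, $$\frac{C_4}{|x|^{n-2}}\le\mathcal{K}(x)\le\frac1{C_4}\begin{cases}|x|^{2-n}&\text{if }n\ge3,\\1+|\ln|x||&\text{if }n=2,\\1&\text{if }n=1.\end{cases}$$ (c) There exists a positive constant $C_5$ such that, if $|x|\ge1$, $$|\nabla\mathcal{K}(x)|\le\frac{C_5}{|x|^{n+2s+1}}\quad\text{and}\quad|D^2\mathcal{K}(x)|\le\frac{C_5}{|x|^{n+2s+2}}.$$ (d) If $n\ge3$, then $\mathcal{K}\in L^q(\mathbb{R}^n)$ for all $q\in[1,\frac n{n-2})$. If $n=1,2$, then $\mathcal{K}\in L^q(\mathbb{R}^n)$ for all $q\in[1,+\infty)$. (e) If $q\in[1,+\infty)$ and $f\in L^q(\mathbb{R}^n)$, then the function $u:=\mathcal{K}\ast f$ is a solution of $$-\Delta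 u+(-\Delta)^su+u=f\quad\text{in }\mathbb{R}^n.$$
   Context: The Fourier transform convention is $\mathcal{F}u(\xi)=\hat u(\xi)=\int_{\mathbb{R}^n}u(x)e^{-2\pi i x\cdot\xi}\,dx$, and the operator $-\Delta+(-\Delta)^s$ in (e) is understood as the Fourier multiplier with $\mathcal{F}\big(-\Delta\varphi+(-\Delta)^s\varphi\big)(\xi)=(|\xi|^2+|\xi|^{2s})\,\mathcal{F}\varphi(\xi)$ (so the Laplacians are normalized to have symbols $|\xi|^2$ and $|\xi|^{2s}$ with respect to this $\mathcal{F}$). In (e), "solution" means in the distributional sense: for every $\varphi\in C_c^\infty(\mathbb{R}^n)$, $$\int_{\mathbb{R}^n}u\,\big(-\Delta\varphi+(-\Delta)^s\varphi+\varphi\big)\,dx=\int_{\mathbb{R}^n}f\varphi\,dx.$$ *)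

theory Defs
  imports "HOL-Analysis.Analysis"
begin

text \<open>
  \<open>lebesgue\<close> rather than \<open>lborel\<close> is used throughout, so that a function in \<open>L\<^sup>q\<close> need only be
  Lebesgue measurable.
\<close>

subsection \<open>Calculus\<close>

text \<open>\<open>C\<^sup>k\<close> regularity; meant for open sets only, since the derivatives are two-sided.\<close>

primrec Ck_on :: "nat \<Rightarrow> ('a::euclidean_space \<Rightarrow> real) \<Rightarrow> 'a set \<Rightarrow> bool" where
  "Ck_on 0 f S \<longleftrightarrow> continuous_on S f"
| "Ck_on (Suc k) f S \<longleftrightarrow>
     (\<forall>x\<in>S. f differentiable (at x)) \<and>
     (\<forall>v. Ck_on k (\<lambda>x. frechet_derivative f (at x) v) S)"

definition smooth_on :: "('a::euclidean_space \<Rightarrow> real) \<Rightarrow> 'a set \<Rightarrow> bool" where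
  "smooth_on f S \<longleftrightarrow> (\<forall>k. Ck_on k f S)"

definition test_function :: "('a::euclidean_space \<Rightarrow> real) \<Rightarrow> bool" where
  "test_function \<phi> \<longleftrightarrow> smooth_on \<phi> UNIV \<and> compact (closure {x. \<phi> x \<noteq> 0})"

definition gradient :: "('a::euclidean_space \<Rightarrow> real) \<Rightarrow> 'a \<Rightarrow> 'a" where
  "gradient f x = (THE D. GDERIV f x :> D)"

text \<open>The Hessian as a linear map; its size is measured by the operator norm \<open>onorm\<close>.\<close>

definition hessian :: "('a::euclidean_space \<Rightarrow> real) \<Rightarrow> 'a \<Rightarrow> 'a \<Rightarrow> 'a" where
  "hessian f x = frechet_derivative (gradient f) (at x)"

subsection \<open>Integration\<close>

definition in_Lq :: "real \<Rightarrow> ('a::euclidean_space \<Rightarrow> real) \<Rightarrow> bool" where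
  "in_Lq q f \<longleftrightarrow>
     f \<in> borel_measurable lebesgue \<and> integrable lebesgue (\<lambda>x. \<bar>f x\<bar> powr q)"

definition conv :: "('a::euclidean_space \<Rightarrow> real) \<Rightarrow> ('a \<Rightarrow> real) \<Rightarrow> 'a \<Rightarrow> real" where
  "conv g f x = (LINT y|lebesgue. g (x - y) * f y)"

definition fourier :: "('a::euclidean_space \<Rightarrow> real) \<Rightarrow> 'a \<Rightarrow> complex" where
  "fourier u \<xi> =
     (LINT x|lebesgue. complex_of_real (u x) * exp (- 2 * of_real pi * \<i> * of_real (x \<bullet> \<xi>)))"

subsection \<open>The mixed local-nonlocal operator\<close>

definition symbol :: "real \<Rightarrow> 'a::euclidean_space \<Rightarrow> real" where
  "symbol s \<xi> = (norm \<xi>)\<^sup>2 + norm \<xi> powr (2 * s)"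

text \<open>
  \<open>is_mixed_laplacian s \<phi> g\<close> says that \<open>g\<close> is \<open>-\<Delta>\<phi> + (-\<Delta>)\<^sup>s \<phi>\<close>. The latter is the Fourier multiplier
  with the above symbol; a continuous integrable \<open>g\<close> is uniquely determined by its Fourier transform.
\<close>

definition is_mixed_laplacian ::
    "real \<Rightarrow> ('a::euclidean_space \<Rightarrow> real) \<Rightarrow> ('a \<Rightarrow> real) \<Rightarrow> bool" where
  "is_mixed_laplacian s \<phi> g \<longleftrightarrow>
     continuous_on UNIV g \<and> integrable lebesgue g \<and>
     (\<forall>\<xi>. fourier g \<xi> = of_real (symbol s \<xi>) * fourier \<phi> \<xi>)"

text \<open>
  Distributional solutions of \<open>-\<Delta>u + (-\<Delta>)\<^sup>s u + u = f\<close>. As \<open>g\<close> is unique, the existential quantifier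
  only names \<open>-\<Delta>\<phi> + (-\<Delta>)\<^sup>s \<phi>\<close>. Integrability is required explicitly because the integral of a
  non-integrable function is 0 by convention.
\<close>

definition distributional_solution ::
    "real \<Rightarrow> ('a::euclidean_space \<Rightarrow> real) \<Rightarrow> ('a \<Rightarrow> real) \<Rightarrow> bool" where
  "distributional_solution s u f \<longleftrightarrow>
     (\<forall>\<phi>. test_function \<phi> \<longrightarrow>
       (\<exists>g. is_mixed_laplacian s \<phi> g \<and>
            integrable lebesgue (\<lambda>x. u x * (g x + \<phi> x)) \<and>
            integrable lebesgue (\<lambda>x. f x * \<phi> x) \<and>
            (LINT x|lebesgue. u x * (g x + \<phi> x)) = (LINT x|lebesgue. f x * \<phi> x)))"

subsection \<open>The kernels\<close>

definition heat_kernel :: "real \<Rightarrow> 'a::euclidean_space \<Rightarrow> real \<Rightarrow> complex" where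
  "heat_kernel s x t =
     (LINT \<xi>|lebesgue.
        exp (of_real (- t * symbol s \<xi>) + 2 * of_real pi * \<i> * of_real (x \<bullet> \<xi>)))"

text \<open>
  The integral defining the kernel is complex-valued as written. \<open>mixed_kernel\<close> is its real part.
\<close>

definition kernel_integrand :: "real \<Rightarrow> 'a::euclidean_space \<Rightarrow> real \<Rightarrow> complex" where
  "kernel_integrand s x t = of_real (exp (- t)) * heat_kernel s x t"

definition complex_kernel :: "real \<Rightarrow> 'a::euclidean_space \<Rightarrow> complex" where
  "complex_kernel s x = (LINT t:{0<..}|lebesgue. kernel_integrand s x t)"

definition mixed_kernel :: "real \<Rightarrow> 'a::euclidean_space \<Rightarrow> real" where
  "mixed_kernel s x = Re (complex_kernel s x)"

text \<open>
  The points at which the kernel is finite: in dimension at least 2 the integral diverges to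
  \<open>+\<infinity>\<close> at the origin (where \<open>mixed_kernel\<close> has the default value 0), in dimension 1 it
  converges there.
\<close>

definition kernel_dom :: "'a::euclidean_space set" where
  "kernel_dom = {x. x \<noteq> 0 \<or> DIM('a) = 1}"

end

theory Submission
  imports Defs "HOL-Complex_Analysis.Complex_Analysis" "HOL-Probability.Probability"
begin

text \<open>
  In the variable \<open>\<lambda> = |\<xi>|\<^sup>2\<close> the Fourier transform \<open>1 / (1 + \<lambda> + \<lambda> powr s)\<close> of the kernel is a Stieltjes
  function: Cauchy's formula on the plane slit along the negative axis gives it as a positive
  superposition of the functions \<open>1 / (\<lambda> + r)\<close>. Hence it is the Laplace transform of a decreasing density
  \<open>p\<close> comparable to \<open>min 1 (t powr (- 1 - s))\<close>, and the kernel is the superposition of the Gaussian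
  kernels of variance proportional to \<open>t\<close> with weight \<open>p t\<close>. Positivity, monotonicity, smoothness,
  the two-sided bounds, the bounds on derivatives and the integrability can all be read off from it.

  The interchange of integrals that identifies this superposition with the kernel needs a bound on the
  heat kernel uniform in time. The function \<open>1 / (1 + c \<lambda> powr s)\<close> is a Stieltjes function too, so its
  powers, and in the limit \<open>exp (- t \<lambda> powr s)\<close>, are mixtures of Gaussians of mass at most 1; thus the
  heat kernel obeys the bound \<open>C / |x|\<^sup>n\<close> of the Gaussians.

  For the equation, \<open>(-\<Delta>)\<^sup>s \<phi>\<close> is written as an integral of second differences against
  a subordinated Gaussian density, whose Fourier transform is computed by scaling.
  Comparing Fourier transforms, the convolution of the kernel with \<open>-\<Delta>\<phi> + (-\<Delta>)\<^sup>s \<phi> + \<phi>\<close> is \<open>\<phi>\<close>, and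
  the weak formulation follows by Fubini's theorem.
\<close>

subsection \<open>Stieltjes functions\<close>

text \<open>The obstacle is the order of integration. In absolute value the integral defining the
  heat kernel only gives a bound like t powr (- n / 2) for small t, which is not integrable at 0
  once n \<ge> 2, so the double integral behind the kernel does not converge absolutely. After
  damping by a Gaussian it does, but removing the damping needs a majorant in t that does not depend
  on it; this is what the bound by |x|^(-n) supplies. One family 1 / (1 + a \<lambda> + b \<lambda>
  powr s) serves both purposes: a = b = 1 gives the kernel, while a = 0, b = t / m gives the factors
  whose m-th powers tend to exp (- t \<lambda> powr s). The shape of the density p comes from its
  Stieltjes weight. The weight behaves like exp ((1 + s) u) as u tends to minus infinity, and by
  scaling this yields the decay t powr (- 1 - s). Its total mass is at most 1, because \<lambda> /
  (1 + \<lambda> + \<lambda> powr s) is, and this yields p \<le> 1. As functions of |x|^2 the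
  Gaussians differentiate to themselves with an extra factor 1 / t, so derivatives of the kernel are
  again integrals of the same type with a shifted exponent.\<close>

lemma sin_pi_mult_pos:
  assumes "0 < s" "s < 1"
  shows "0 < sin (pi * s)"
  using assms by (intro sin_gt_zero) (auto simp: mult_less_cancel_left2 not_le pi_gt_zero)

text \<open>Inside the strip \<open>\<bar>Im w\<bar> < pi\<close> this is 1 + a z + b z powr s at z
  = exp w, with the principal branch. As a function of \<open>w\<close> it is entire, so the two
  sides of the branch cut become the two edges of the strip.\<close>

definition stieltjes_denom :: "real \<Rightarrow> real \<Rightarrow> real \<Rightarrow> complex \<Rightarrow> complex" where
  "stieltjes_denom a b s w = 1 + of_real a * exp w + of_real b * exp (of_real s * w)"

text \<open>
  With \<open>r = exp u\<close>, this is \<open>r / \<pi>\<close> times the imaginary part of \<open>1 / (1 - a r + b r\<^sup>s exp (- i \<pi> s))\<close>,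
  the boundary value of \<open>1 / (1 + a z + b z powr s)\<close> at \<open>z = - r\<close> from below. The factor \<open>r\<close> is due to
  integrating over \<open>u\<close> instead of \<open>r\<close>.
\<close>

definition stieltjes_weight :: "real \<Rightarrow> real \<Rightarrow> real \<Rightarrow> real \<Rightarrow> real" where
  "stieltjes_weight a b s u = b * exp ((1 + s) * u) * sin (pi * s) /
     (pi * ((1 - a * exp u + b * exp (s * u) * cos (pi * s))\<^sup>2 + (b * exp (s * u) * sin (pi * s))\<^sup>2))"

lemma measurable_stieltjes_weight[measurable]: "stieltjes_weight a b s \<in> borel_measurable borel"
  unfolding stieltjes_weight_def[abs_def] by measurable

context
  fixes a b s :: real
  assumes a: "0 \<le> a" and b: "0 < b" and s: "0 < s" "s < 1"
begin

text \<open>For 0 < Im w \<le> pi the term with \<open>a\<close> has nonnegative imaginary part and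
  the term with \<open>b\<close> a positive one, since s * Im w stays strictly below pi. Conjugation
  gives the lower half of the strip, and on the real line the sum is positive.\<close>

lemma stieltjes_denom_nonzero:
  assumes "\<bar>Im w\<bar> \<le> pi"
  shows "stieltjes_denom a b s w \<noteq> 0"
proof -
  have *: "stieltjes_denom a b s w \<noteq> 0" if "0 < Im w" "Im w \<le> pi" for w
  proof -
    have 1: "Im (stieltjes_denom a b s w) = a * exp (Re w) * sin (Im w) + b * exp (s * Re w) * sin (s * Im w)"
      by (simp add: stieltjes_denom_def Im_exp)
    have "s * Im w < pi" using that s
      by (smt (verit) mult_le_cancel_right1 mult_less_cancel_right2 pi_gt_zero)
    then have "0 < sin (s * Im w)" using that s by (intro sin_gt_zero) auto
    moreover have "0 \<le> sin (Im w)" using that by (intro sin_ge_zero) auto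
    ultimately have "0 < Im (stieltjes_denom a b s w)"
      unfolding 1 using a b by (intro add_nonneg_pos) auto
    then show ?thesis by auto
  qed
  consider "Im w = 0" | "0 < Im w" | "0 < Im (cnj w)" by force
  then show ?thesis
  proof cases
    case 1
    have "Re (stieltjes_denom a b s w) = 1 + a * exp (Re w) + b * exp (s * Re w)"
      using 1 by (simp add: stieltjes_denom_def Re_exp)
    also have "\<dots> > 0" using a b by (auto intro!: add_pos_pos add_pos_nonneg)
    finally show ?thesis by auto
  next
    case 2 then show ?thesis using * assms by auto
  next
    case 3
    have "stieltjes_denom a b s (cnj w) = cnj (stieltjes_denom a b s w)"
      by (simp add: stieltjes_denom_def exp_cnj)
    moreover have "stieltjes_denom a b s (cnj w) \<noteq> 0" using * 3 assms by auto
    ultimately show ?thesis by auto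
  qed
qed

text \<open>In the coordinate \<open>w\<close> with \<open>z = exp w\<close> a contour around the cut becomes a rectangle.\<close>

lemma stieltjes_contour:
  assumes lam: "0 < lam" and R: "\<bar>ln lam\<bar> < R"
  shows "((\<lambda>w. exp w / ((exp w - of_real lam) * stieltjes_denom a b s w)) has_contour_integral
     2 * pi * \<i> / (1 + a * lam + b * lam powr s)) (rectpath (Complex (- R) (- pi)) (Complex R pi))"
proof -
  let ?S = "cbox (Complex (- R) (- pi)) (Complex R pi)"
  let ?\<gamma> = "rectpath (Complex (- R) (- pi)) (Complex R pi)"
  define z where "z = complex_of_real (ln lam)"
  \<comment> \<open>\<open>E\<close> is the difference quotient of exp at \<open>z\<close>,
    completed by its derivative there. It is entire, and replacing exp w - lam by (w - z) * E w
    brings the integrand into the form of Cauchy's formula.\<close>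
  define E where "E w = (if w = z then of_real lam else (exp w - of_real lam) / (w - z))" for w
  define f where "f w = exp w / (E w * stieltjes_denom a b s w)" for w
  have ez: "exp z = of_real lam" unfolding z_def using lam by (metis exp_ln exp_of_real)
  have zbox: "z \<in> box (Complex (- R) (- pi)) (Complex R pi)"
    using R by (auto simp: z_def in_box_complex_iff)
  have "E holomorphic_on UNIV"
  proof (rule no_isolated_singularity'[where K="{z}"])
    show "E holomorphic_on UNIV - {z}"
    proof -
      have "(\<lambda>w. (exp w - of_real lam) / (w - z)) holomorphic_on UNIV - {z}"
        by (intro holomorphic_intros) auto
      then show ?thesis by (rule holomorphic_transform) (auto simp: E_def)
    qed
    have "(exp has_field_derivative exp z) (at z)" by (rule DERIV_exp)
    then have "((\<lambda>w. (exp w - exp z) / (w - z)) \<longlongrightarrow> exp z) (at z)"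
      by (simp add: has_field_derivative_iff)
    then have "(E \<longlongrightarrow> exp z) (at z)"
      by (rule Lim_transform_eventually) (auto simp: eventually_at_filter E_def ez)
    then have "(E \<longlongrightarrow> E z) (at z)" by (simp add: E_def ez)
    then show "\<And>w. w \<in> {z} \<Longrightarrow> (E \<longlongrightarrow> E w) (at w)" by auto
  qed auto
  then have Ediff: "E field_differentiable at w" for w
    by (simp add: holomorphic_on_imp_differentiable_at)
  \<comment> \<open>exp takes the value \<open>lam\<close> only at points that differ from
    \<open>z\<close> by multiples of 2 pi i. As \<open>z\<close> is real, the closed strip contains
    no other such point.\<close>
  have Enz: "E w \<noteq> 0" if "\<bar>Im w\<bar> \<le> pi" for w
  proof (cases "w = z")
    case False
    have "exp w \<noteq> exp z"
    proof
      assume "exp w = exp z"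
      then obtain n :: int where n: "w = z + (of_int (2 * n) * of_real pi) * \<i>"
        using exp_eq by auto
      then have "Im w = 2 * of_int n * pi" by (simp add: z_def)
      with that have "\<bar>2 * of_int n\<bar> * pi \<le> 1 * pi" by (simp add: abs_mult)
      then have "\<bar>2 * real_of_int n\<bar> \<le> 1" by (rule mult_right_le_imp_le) auto
      then have "n = 0" by linarith
      with n False show False by simp
    qed
    then show ?thesis using False by (simp add: E_def ez)
  qed (use lam in \<open>simp add: E_def\<close>)
  have fdiff: "f field_differentiable at w" if "\<bar>Im w\<bar> \<le> pi" for w
  proof -
    have "stieltjes_denom a b s field_differentiable at w"
      unfolding stieltjes_denom_def[abs_def]
      by (intro holomorphic_on_imp_differentiable_at[of _ UNIV] holomorphic_intros) auto
    then show ?thesis unfolding f_def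
      using that Ediff Enz stieltjes_denom_nonzero
      by (intro field_differentiable_divide field_differentiable_mult field_differentiable_within_exp) auto
  qed
  have "((\<lambda>w. f w / (w - z)) has_contour_integral (2*pi * \<i> * winding_number ?\<gamma> z * f z)) ?\<gamma>"
  proof (rule Cauchy_integral_formula_weak[where S="?S" and k="{}"])
    show "continuous_on ?S f"
      using fdiff by (intro continuous_at_imp_continuous_on ballI field_differentiable_imp_continuous_at)
         (auto simp: in_cbox_complex_iff)
    show "\<And>x. x \<in> interior ?S - {} \<Longrightarrow> f field_differentiable at x"
      using fdiff by (auto simp: in_box_complex_iff)
    show "path_image ?\<gamma> \<subseteq> ?S - {z}"
      using zbox R by (subst path_image_rectpath_cbox_minus_box) auto
  qed (use zbox in auto)
  moreover have "winding_number ?\<gamma> z = 1" by (rule winding_number_rectpath[OF zbox])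
  moreover have "f z = 1 / (1 + a * lam + b * lam powr s)"
  proof -
    have "exp (s * z) = of_real (lam powr s)"
      unfolding z_def using lam by (simp add: powr_def exp_of_real[symmetric])
    then show ?thesis using lam by (simp add: f_def E_def stieltjes_denom_def ez)
  qed
  ultimately have 1: "((\<lambda>w. f w / (w - z)) has_contour_integral 2 * pi * \<i> / (1 + a * lam + b * lam powr s)) ?\<gamma>"
    by simp
  show ?thesis
  proof (rule has_contour_integral_eq[OF 1])
    fix w assume "w \<in> path_image ?\<gamma>"
    then have "w \<noteq> z" using zbox R by (subst (asm) path_image_rectpath_cbox_minus_box) auto
    then show "f w / (w - z) = exp w / ((exp w - of_real lam) * stieltjes_denom a b s w)"
      by (simp add: f_def E_def)
  qed
qed

lemma has_contour_integral_linepath_translation: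
  "(f has_contour_integral I) (linepath (x + c) (y + c)) \<longleftrightarrow>
   ((\<lambda>w. f (w + c)) has_contour_integral I) (linepath x y)"
proof -
  have "linepath (x + c) (y + c) t = linepath x y t + c" for t
    by (simp add: linepath_def algebra_simps)
  then show ?thesis by (simp add: has_contour_integral_linepath)
qed


text \<open>On both edges of the strip exp w equals - exp x, while the denominators are the
  conjugate numbers A - i B and A + i B. The difference of the boundary values is therefore 2 i B /
  (A^2 + B^2) times a real factor.\<close>

lemma stieltjes_jump:
  fixes lam :: real
  defines "f \<equiv> \<lambda>w. exp w / ((exp w - of_real lam) * stieltjes_denom a b s w)"
  shows "f (of_real x + Complex 0 (- pi)) - f (of_real x + Complex 0 pi)
    = 2 * pi * \<i> * of_real (stieltjes_weight a b s x / (lam + exp x))"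
proof -
  define A B where "A = 1 - a * exp x + b * exp (s * x) * cos (pi * s)"
    and "B = b * exp (s * x) * sin (pi * s)"
  have B: "B > 0" unfolding B_def using b s
    by (intro mult_pos_pos sin_gt_zero) (auto simp: mult_less_cancel_left2 not_le pi_gt_zero)
  have D: "A\<^sup>2 + B\<^sup>2 > 0" using B by (simp add: add_nonneg_pos)
  have e1: "exp (of_real x + Complex 0 (- pi)) = - of_real (exp x)"
      "exp (of_real x + Complex 0 pi) = - of_real (exp x)"
    by (simp_all add: complex_eq_iff Re_exp Im_exp)
  have d1: "stieltjes_denom a b s (of_real x + Complex 0 (- pi)) = Complex A (- B)"
      "stieltjes_denom a b s (of_real x + Complex 0 pi) = Complex A B"
    unfolding stieltjes_denom_def e1
    by (simp_all add: complex_eq_iff Re_exp Im_exp A_def B_def mult.commute)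
  have ed: "- complex_of_real (exp x) - of_real lam = - of_real (exp x + lam)" by simp
  have gen: "- p / (- d * C) = p / d / C" for p d C :: complex by simp
  have q: "f (of_real x + Complex 0 (- pi)) = of_real (exp x / (exp x + lam)) / Complex A (- B)"
      "f (of_real x + Complex 0 pi) = of_real (exp x / (exp x + lam)) / Complex A B"
    by (simp_all only: f_def e1 d1 ed gen of_real_divide)
  have "1 / Complex A (- B) - 1 / Complex A B = 2 * \<i> * of_real (B / (A\<^sup>2 + B\<^sup>2))"
    using D by (simp add: complex_eq_iff Re_divide Im_divide power2_eq_square)
  then have "f (of_real x + Complex 0 (- pi)) - f (of_real x + Complex 0 pi) =
     of_real (exp x / (exp x + lam)) * (2 * \<i> * of_real (B / (A\<^sup>2 + B\<^sup>2)))"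
    unfolding q by (simp only: right_diff_distrib[symmetric] divide_inverse mult_1_left)
  also have "\<dots> = 2 * pi * \<i> * of_real (stieltjes_weight a b s x / (lam + exp x))"
  proof -
    have "exp x / (exp x + lam) * (2 * (B / (A\<^sup>2 + B\<^sup>2))) = 2 * pi * (stieltjes_weight a b s x / (lam + exp x))"
    proof -
      define N where "N = A\<^sup>2 + B\<^sup>2"
      have "b * exp ((1 + s) * x) * sin (pi * s) = exp x * B" by (simp add: B_def exp_add distrib_right)
      then have "stieltjes_weight a b s x = exp x * B / (pi * N)"
        unfolding stieltjes_weight_def A_def[symmetric] B_def[symmetric] N_def by simp
      moreover have "e / d * (2 * (B / N)) = 2 * pi * (e * B / (pi * N) / d)" for e d :: real by (simp add: mult_ac)
      ultimately show ?thesis unfolding N_def[symmetric] by (simp add: add.commute)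
    qed
    then have e: "complex_of_real (exp x / (exp x + lam) * (2 * (B / (A\<^sup>2 + B\<^sup>2)))) =
       complex_of_real (2 * pi * (stieltjes_weight a b s x / (lam + exp x)))" by (rule arg_cong)
    have "of_real p * (2 * \<i> * of_real q) = of_real (p * (2 * q)) * \<i>"
      "2 * pi * \<i> * of_real p = of_real (2 * pi * p) * \<i>" for p q :: real
      by (simp_all add: complex_eq_iff)
    then show ?thesis by (simp only: e)
  qed
  finally show ?thesis .
qed

lemma of_real_plus_Complex: "complex_of_real x + Complex 0 y = Complex x y"
  "Complex 0 y - complex_of_real x = Complex (- x) y"
  by (simp_all add: complex_eq_iff)

text \<open>The horizontal edges combine to the integral of the jump. Each vertical edge has length
  2 pi, which cancels against the 2 pi i of Cauchy's formula, so \<open>Br\<close> and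
  \<open>Bl\<close> bound the error without further factors.\<close>

lemma stieltjes_interval:
  assumes lam: "0 < lam" and R: "\<bar>ln lam\<bar> < R"
    and Br: "\<And>w. Re w = R \<Longrightarrow> norm (exp w / ((exp w - of_real lam) * stieltjes_denom a b s w)) \<le> Br"
    and Bl: "\<And>w. Re w = - R \<Longrightarrow> norm (exp w / ((exp w - of_real lam) * stieltjes_denom a b s w)) \<le> Bl"
  obtains S where "((\<lambda>u. stieltjes_weight a b s u / (lam + exp u)) has_integral S) {- R..R}"
    "\<bar>S - 1 / (1 + a * lam + b * lam powr s)\<bar> \<le> Br + Bl"
proof -
  define f where "f w = exp w / ((exp w - of_real lam) * stieltjes_denom a b s w)" for w
  define L where "L = 1 / (1 + a * lam + b * lam powr s)"
  let ?a1 = "Complex (- R) (- pi)" and ?a2 = "Complex R (- pi)"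
    and ?a3 = "Complex R pi" and ?a4 = "Complex (- R) pi"
  have R0: "R > 0" using R by auto
  have tot: "(f has_contour_integral 2 * pi * \<i> * of_real L)
     (linepath ?a1 ?a2 +++ linepath ?a2 ?a3 +++ linepath ?a3 ?a4 +++ linepath ?a4 ?a1)"
    using stieltjes_contour[OF lam R] by (simp add: f_def[abs_def] L_def rectpath_def Let_def)
  note int = has_contour_integral_integrable[OF tot]
  then have i1: "f contour_integrable_on linepath ?a1 ?a2" and i2: "f contour_integrable_on linepath ?a2 ?a3"
    and i3: "f contour_integrable_on linepath ?a3 ?a4" and i4: "f contour_integrable_on linepath ?a4 ?a1"
    by (auto simp: contour_integrable_join)
  obtain I1 I2 I3 I4 where I: "(f has_contour_integral I1) (linepath ?a1 ?a2)" "(f has_contour_integral I2) (linepath ?a2 ?a3)"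
      "(f has_contour_integral I3) (linepath ?a3 ?a4)" "(f has_contour_integral I4) (linepath ?a4 ?a1)"
    using i1 i2 i3 i4 by (auto simp: contour_integrable_on_def)
  have "(f has_contour_integral I1 + (I2 + (I3 + I4)))
     (linepath ?a1 ?a2 +++ linepath ?a2 ?a3 +++ linepath ?a3 ?a4 +++ linepath ?a4 ?a1)"
    using I by (intro has_contour_integral_join) auto
  then have sum: "I1 + (I2 + (I3 + I4)) = 2 * pi * \<i> * of_real L"
    using tot by (metis contour_integral_unique)
  have "(f has_contour_integral I1) (linepath (of_real (- R) + Complex 0 (- pi)) (of_real R + Complex 0 (- pi)))"
    using I(1) by (simp add: of_real_plus_Complex)
  then have 1: "((\<lambda>x. f (of_real x + Complex 0 (- pi))) has_integral I1) {- R..R}"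
    using R0 unfolding has_contour_integral_linepath_translation
    by (subst (asm) has_contour_integral_linepath_Reals_iff) auto
  have "(f has_contour_integral - I3) (linepath ?a4 ?a3)"
    using I(3) has_contour_integral_reverse_linepath by blast
  then have "(f has_contour_integral - I3) (linepath (of_real (- R) + Complex 0 pi) (of_real R + Complex 0 pi))"
    by (simp add: of_real_plus_Complex)
  then have 3: "((\<lambda>x. f (of_real x + Complex 0 pi)) has_integral - I3) {- R..R}"
    using R0 unfolding has_contour_integral_linepath_translation
    by (subst (asm) has_contour_integral_linepath_Reals_iff) auto
  have "((\<lambda>x. 2 * pi * \<i> * of_real (stieltjes_weight a b s x / (lam + exp x))) has_integral I1 + I3) {- R..R}"
    using has_integral_diff[OF 1 3] stieltjes_jump[where lam=lam] by (simp add: f_def)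
  from has_integral_mult_right[OF this, of "1 / (2 * pi * \<i>)"]
  have S: "((\<lambda>x. complex_of_real (stieltjes_weight a b s x / (lam + exp x))) has_integral ((I1 + I3) / (2 * pi * \<i>))) {- R..R}"
    by (simp add: field_simps)
  define S where "S = Re ((I1 + I3) / (2 * pi * \<i>))"
  have "((\<lambda>x. stieltjes_weight a b s x / (lam + exp x)) has_integral S) {- R..R}"
    using has_integral_Re[OF S] by (simp add: S_def)
  moreover have "\<bar>S - L\<bar> \<le> Br + Bl"
  proof -
    have B0: "0 \<le> Br" "0 \<le> Bl"
      using order_trans[OF norm_ge_zero Br[of "of_real R"]] order_trans[OF norm_ge_zero Bl[of "of_real (- R)"]] by simp_all
    have "norm I2 \<le> Br * norm (?a3 - ?a2)"
      by (rule has_contour_integral_bound_linepath[OF I(2)])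
         (use B0 in \<open>auto simp: closed_segment_same_Re f_def intro!: Br\<close>)
    moreover have "norm I4 \<le> Bl * norm (?a1 - ?a4)"
      by (rule has_contour_integral_bound_linepath[OF I(4)])
         (use B0 in \<open>auto simp: closed_segment_same_Re f_def intro!: Bl\<close>)
    moreover have "norm (?a3 - ?a2) = 2 * pi" "norm (?a1 - ?a4) = 2 * pi"
      by (simp_all add: cmod_def power2_eq_square real_sqrt_mult)
    ultimately have n: "norm (I2 + I4) \<le> (Br + Bl) * (2 * pi)"
      using norm_triangle_ineq[of I2 I4] by (simp add: algebra_simps)
    have "I1 + I3 = 2 * pi * \<i> * of_real L - (I2 + I4)"
      using sum by (simp add: algebra_simps eq_diff_eq)
    then have "(I1 + I3) / (2 * pi * \<i>) - of_real L = - (I2 + I4) / (2 * pi * \<i>)"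
      by (simp add: field_simps)
    then have "norm ((I1 + I3) / (2 * pi * \<i>) - of_real L) = norm (I2 + I4) / (2 * pi)"
      by (simp only: norm_divide norm_minus_cancel) (simp add: norm_mult)
    also have "\<dots> \<le> Br + Bl" using n by (simp add: divide_le_eq)
    finally have "norm ((I1 + I3) / (2 * pi * \<i>) - of_real L) \<le> Br + Bl" .
    then show ?thesis unfolding S_def
      using abs_Re_le_cmod[of "(I1 + I3) / (2 * pi * \<i>) - of_real L"] by simp
  qed
  ultimately show ?thesis using that by (simp add: L_def)
qed

text \<open>To the right exp w / (exp w - lam) stays bounded while the denominator grows; to the
  left the denominator tends to 1 and exp w to 0.\<close>

lemma stieltjes_side_bounds:
  assumes lam: "0 < lam"
  obtains Br Bl where "(Br \<longlongrightarrow> 0) at_top" "(Bl \<longlongrightarrow> 0) at_top"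
   "\<forall>\<^sub>F R in at_top. \<forall>w. Re w = R \<longrightarrow> norm (exp w / ((exp w - of_real lam) * stieltjes_denom a b s w)) \<le> Br R"
   "\<forall>\<^sub>F R in at_top. \<forall>w. Re w = - R \<longrightarrow> norm (exp w / ((exp w - of_real lam) * stieltjes_denom a b s w)) \<le> Bl R"
proof -
  \<comment> \<open>\<open>m\<close> bounds the modulus of the denominator from below by the
    triangle inequality. The dominant term is exp w if \<open>a\<close> is positive and exp (s * w)
    if \<open>a\<close> vanishes.\<close>
  define m where "m R = (if a = 0 then b * exp (s * R) - 1 else a * exp R - b * exp (s * R) - 1)" for R
  define Br where "Br R = exp R / ((exp R - lam) * m R)" for R
  define Bl where "Bl R = exp (- R) / ((lam - exp (- R)) * (1 - a * exp (- R) - b * exp (- s * R)))" for R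
  have m: "filterlim m at_top at_top"
  proof (cases "a = 0")
    case True then show ?thesis unfolding m_def using b s by simp real_asymp
  next
    case False
    then have "a > 0" using a by simp
    then show ?thesis unfolding m_def using False b s by simp real_asymp
  qed
  have "((\<lambda>R. exp R / (exp R - lam)) \<longlongrightarrow> 1) at_top" by real_asymp
  from tendsto_mult[OF this tendsto_inverse_0_at_top[OF m]]
  have br: "(Br \<longlongrightarrow> 0) at_top"
    by (simp add: Br_def[abs_def] divide_simps)
  have bl: "(Bl \<longlongrightarrow> 0) at_top" unfolding Bl_def using lam b s by real_asymp
  have d1: "norm (stieltjes_denom a b s w) \<ge> m (Re w)" for w
  proof -
    define p q where "p = complex_of_real a * exp w" and "q = of_real b * exp (of_real s * w)"
    have n: "norm p = a * exp (Re w)" "norm q = b * exp (s * Re w)" using a b by (auto simp: p_def q_def norm_mult)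
    have d: "stieltjes_denom a b s w = 1 + p + q" by (simp add: stieltjes_denom_def p_def q_def)
    have "norm (1 + p + q) \<ge> norm p - norm q - 1"
      using norm_triangle_ineq4[of "1 + p + q" "1 + q"] norm_triangle_ineq[of 1 q] by simp
    moreover have "norm (1 + p + q) \<ge> norm q - norm p - 1"
      using norm_triangle_ineq4[of "1 + p + q" "1 + p"] norm_triangle_ineq[of 1 p] by simp
    ultimately show ?thesis unfolding d m_def using n by auto
  qed
  have d2: "norm (stieltjes_denom a b s w) \<ge> 1 - a * exp (Re w) - b * exp (s * Re w)" for w
  proof -
    define p q where "p = complex_of_real a * exp w" and "q = of_real b * exp (of_real s * w)"
    have n: "norm p = a * exp (Re w)" "norm q = b * exp (s * Re w)" using a b by (auto simp: p_def q_def norm_mult)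
    have d: "stieltjes_denom a b s w = 1 + p + q" by (simp add: stieltjes_denom_def p_def q_def)
    have "norm (1 + p + q) \<ge> 1 - norm p - norm q"
      using norm_triangle_ineq4[of "1 + p + q" "p + q"] norm_triangle_ineq[of p q] by simp
    then show ?thesis unfolding d using n by auto
  qed
  show ?thesis
  proof (rule that[OF br bl])
    have "\<forall>\<^sub>F R in at_top. m R > 0" using m by (auto simp: filterlim_at_top_dense)
    moreover have "\<forall>\<^sub>F R in at_top. R > ln lam" by (rule eventually_gt_at_top)
    ultimately show "\<forall>\<^sub>F R in at_top. \<forall>w. Re w = R \<longrightarrow> norm (exp w / ((exp w - of_real lam) * stieltjes_denom a b s w)) \<le> Br R"
    proof eventually_elim
      case (elim R)
      have "exp R > lam" using elim lam by (metis exp_less_cancel_iff exp_ln)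
      moreover have "norm (exp w - of_real lam) \<ge> exp (Re w) - lam" for w
        using norm_triangle_ineq2[of "exp w" "of_real lam"] lam by simp
      ultimately have 1: "0 < exp R - lam" "\<And>w. Re w = R \<Longrightarrow> exp R - lam \<le> norm (exp w - of_real lam)" by auto
      show ?case
      proof (intro allI impI)
        fix w assume w: "Re w = R"
        have 2: "m R \<le> norm (stieltjes_denom a b s w)" using d1[of w] by (simp add: w)
        show "norm (exp w / ((exp w - of_real lam) * stieltjes_denom a b s w)) \<le> Br R"
          unfolding Br_def norm_divide norm_mult norm_exp_eq_Re w
          by (rule frac_le) (use 1 2 elim w in \<open>auto intro!: mult_mono mult_pos_pos\<close>)
      qed
    qed
    have "((\<lambda>R. 1 - a * exp (- R) - b * exp (- s * R)) \<longlongrightarrow> 1) at_top" using b s by real_asymp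
    then have "\<forall>\<^sub>F R in at_top. 1 - a * exp (- R) - b * exp (- s * R) > 0" by (rule order_tendstoD) simp
    moreover have "\<forall>\<^sub>F R in at_top. R > - ln lam" by (rule eventually_gt_at_top)
    ultimately show "\<forall>\<^sub>F R in at_top. \<forall>w. Re w = - R \<longrightarrow> norm (exp w / ((exp w - of_real lam) * stieltjes_denom a b s w)) \<le> Bl R"
    proof eventually_elim
      case (elim R)
      then have "- R < ln lam" by simp
      then have "exp (- R) < lam" using lam by (metis exp_less_cancel_iff exp_ln)
      moreover have "norm (exp w - of_real lam) \<ge> lam - exp (- R)" if "Re w = - R" for w
        using norm_triangle_ineq2[of "of_real lam" "exp w"] lam that by (simp add: norm_minus_commute)
      ultimately have 1: "0 < lam - exp (- R)" "\<And>w. Re w = - R \<Longrightarrow> lam - exp (- R) \<le> norm (exp w - of_real lam)" by simp_all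
      show ?case
      proof (intro allI impI)
        fix w assume w: "Re w = - R"
        have 2: "(1 - a * exp (- R) - b * exp (- s * R)) \<le> norm (stieltjes_denom a b s w)" using d2[of w] by (simp add: w)
        show "norm (exp w / ((exp w - of_real lam) * stieltjes_denom a b s w)) \<le> Bl R"
          unfolding Bl_def norm_divide norm_mult norm_exp_eq_Re w
          by (rule frac_le) (use 1 2 elim w in \<open>auto intro!: mult_mono mult_pos_pos\<close>)
      qed
    qed
  qed
qed

lemma stieltjes_weight_pos: "0 < stieltjes_weight a b s u"
proof -
  have "0 < sin (pi * s)" by (rule sin_pi_mult_pos[OF s])
  then show ?thesis unfolding stieltjes_weight_def
    using b by (intro divide_pos_pos mult_pos_pos add_nonneg_pos) auto
qed

lemma continuous_stieltjes_weight: "continuous_on A (stieltjes_weight a b s)"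
proof -
  have sn: "0 < sin (pi * s)" by (rule sin_pi_mult_pos[OF s])
  have "pi * ((1 - a * exp u + b * exp (s * u) * cos (pi * s))\<^sup>2 + (b * exp (s * u) * sin (pi * s))\<^sup>2) \<noteq> 0" for u
    using sn b by (simp add: sum_power2_eq_zero_iff)
  then show ?thesis unfolding stieltjes_weight_def[abs_def]
    by (intro continuous_intros) auto
qed

text \<open>The limit R to infinity of the contour identity. Since the integrand is nonnegative,
  monotone convergence over the intervals from -n to n yields the integral over the line without
  knowing beforehand that it is finite.\<close>

lemma stieltjes_representation:
  assumes lam: "0 < lam"
  shows "(\<integral>\<^sup>+u. ennreal (stieltjes_weight a b s u / (lam + exp u)) \<partial>lborel) = ennreal (1 / (1 + a * lam + b * lam powr s))"
proof -
  define L where "L = 1 / (1 + a * lam + b * lam powr s)"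
  define h where "h u = stieltjes_weight a b s u / (lam + exp u)" for u
  have h0: "0 \<le> h u" for u using stieltjes_weight_pos[of u] lam by (simp add: h_def add_pos_pos less_imp_le)
  have "continuous_on UNIV h" unfolding h_def
    using lam by (intro continuous_intros continuous_stieltjes_weight) (auto simp: add_pos_pos less_imp_neq[symmetric])
  then have hm[measurable]: "h \<in> borel_measurable borel" by (rule borel_measurable_continuous_onI)
  obtain Br Bl where B: "(Br \<longlongrightarrow> 0) at_top" "(Bl \<longlongrightarrow> 0) at_top"
   "\<forall>\<^sub>F R in at_top. \<forall>w. Re w = R \<longrightarrow> norm (exp w / ((exp w - of_real lam) * stieltjes_denom a b s w)) \<le> Br R"
   "\<forall>\<^sub>F R in at_top. \<forall>w. Re w = - R \<longrightarrow> norm (exp w / ((exp w - of_real lam) * stieltjes_denom a b s w)) \<le> Bl R"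
    by (rule stieltjes_side_bounds[OF lam])
  define S where "S R = integral {- R..R} h" for R
  have "\<forall>\<^sub>F R in at_top. R > \<bar>ln lam\<bar>" by (rule eventually_gt_at_top)
  with B(3,4) have ev: "\<forall>\<^sub>F R in at_top. norm (S R - L) \<le> Br R + Bl R"
  proof eventually_elim
    case (elim R)
    then obtain S' where "(h has_integral S') {- R..R}" "\<bar>S' - L\<bar> \<le> Br R + Bl R"
      unfolding h_def L_def by (rule_tac stieltjes_interval[OF lam, of R "Br R" "Bl R"]) auto
    then show ?case by (simp add: S_def integral_unique)
  qed
  have "((\<lambda>R. S R - L) \<longlongrightarrow> 0) at_top"
    by (rule Lim_null_comparison[OF ev]) (use tendsto_add[OF B(1,2)] in simp)
  then have "(S \<longlongrightarrow> L) at_top" by (simp add: LIM_zero_iff)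
  then have Sl: "(\<lambda>n. S (real n)) \<longlonglongrightarrow> L" using filterlim_compose filterlim_real_sequentially by blast
  have nn: "(\<integral>\<^sup>+u. ennreal (h u) * indicator {- real n..real n} u \<partial>lborel) = ennreal (S n)" for n
  proof -
    have "(h has_integral S n) {- real n..real n}" unfolding S_def
      by (intro integrable_integral integrable_continuous_real continuous_on_subset[OF \<open>continuous_on UNIV h\<close>]) auto
    moreover have "(\<lambda>u. h u * indicat_real {- real n..real n} u) = (\<lambda>u. if u \<in> {- real n..real n} then h u else 0)"
      by (auto simp: fun_eq_iff indicator_def)
    ultimately have "((\<lambda>u. h u * indicat_real {- real n..real n} u) has_integral S n) UNIV"
      by (simp only: has_integral_restrict_UNIV)
    then have "(\<integral>\<^sup>+u. ennreal (h u * indicat_real {- real n..real n} u) \<partial>lborel) = ennreal (S n)"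
      by (rule nn_integral_has_integral_lborel[rotated 2]) (auto simp: h0)
    then show ?thesis by (simp add: ennreal_mult' h0 ennreal_indicator)
  qed
  have "(\<lambda>n. \<integral>\<^sup>+u. ennreal (h u) * indicator {- real n..real n} u \<partial>lborel) \<longlonglongrightarrow> (\<integral>\<^sup>+u. ennreal (h u) \<partial>lborel)"
  proof (rule nn_integral_LIMSEQ)
    show "incseq (\<lambda>n u. ennreal (h u) * indicator {- real n..real n} u)"
      by (auto simp: incseq_def le_fun_def split: split_indicator)
    fix u :: real
    obtain N where "\<bar>u\<bar> \<le> real N" using real_arch_simple by blast
    then have "\<forall>\<^sub>F n in sequentially. ennreal (h u) * indicator {- real n..real n} u = ennreal (h u)"
      by (auto simp: eventually_sequentially intro!: exI[of _ N] split: split_indicator)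
    then show "(\<lambda>n. ennreal (h u) * indicator {- real n..real n} u) \<longlonglongrightarrow> ennreal (h u)"
      by (rule tendsto_eventually)
  qed measurable
  moreover have "(\<lambda>n. ennreal (S (real n))) \<longlonglongrightarrow> ennreal L" using Sl by (intro tendsto_ennrealI)
  ultimately have "(\<integral>\<^sup>+u. ennreal (h u) \<partial>lborel) = ennreal L"
    unfolding nn by (rule LIMSEQ_unique)
  then show ?thesis by (simp only: h_def L_def)
qed

end

subsection \<open>The subordinating density\<close>

lemma integral_pos_of_pos_on:
  fixes f :: "'a \<Rightarrow> real"
  assumes f: "integrable M f" "\<And>x. 0 \<le> f x" and A: "A \<in> sets M" "emeasure M A \<noteq> 0" "\<And>x. x \<in> A \<Longrightarrow> 0 < f x"
  shows "0 < integral\<^sup>L M f"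
proof (rule ccontr)
  assume "\<not> 0 < integral\<^sup>L M f"
  then have "integral\<^sup>L M f = 0" using integral_nonneg_AE[where M=M and f=f] f by (simp add: antisym_conv1)
  then have "AE x in M. f x = 0" using f by (subst (asm) integral_nonneg_eq_0_iff_AE) auto
  then have "AE x in M. x \<notin> A" by eventually_elim (use A(3) in force)
  then have "emeasure M A = 0" using A(1) by (subst (asm) AE_iff_measurable[where N=A]) (use sets.sets_into_space in auto)
  then show False using A(2) by simp
qed

lemma nn_integral_exp_decay:
  fixes r :: real
  assumes "0 < r"
  shows "(\<integral>\<^sup>+t. ennreal (exp (- (r * t))) * indicator {0<..} t \<partial>lborel) = ennreal (1 / r)"
proof -
  have "(\<integral>\<^sup>+t. ennreal (exp (- (r * t))) * indicator {0<..} t \<partial>lborel) = (\<integral>\<^sup>+t. ennreal (exp (- (r * t))) * indicator {0..} t \<partial>lborel)"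
    by (intro nn_integral_cong_AE AE_I[where N="{0}"]) (auto split: split_indicator)
  also have "\<dots> = ennreal (0 - (- exp (- (r * 0)) / r))"
  proof (rule nn_integral_FTC_atLeast)
    show "((\<lambda>t. - exp (- (r * t)) / r) \<longlongrightarrow> 0) at_top" using assms by real_asymp
    show "\<And>x. 0 \<le> x \<Longrightarrow> ((\<lambda>t. - exp (- (r * t)) / r) has_real_derivative exp (- (r * x))) (at x)"
      using assms by (auto intro!: derivative_eq_intros)
  qed auto
  finally show ?thesis by simp
qed

text \<open>Since 1 / (lam + r) is the Laplace transform of exp (- r t), the density is itself a
  Laplace transform, namely that of the measure in the Stieltjes representation, with r = exp
  u.\<close>

definition subord_density :: "real \<Rightarrow> real \<Rightarrow> real \<Rightarrow> real \<Rightarrow> real" where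
  "subord_density a b s t = (LINT u|lborel. exp (- (exp u * t)) * stieltjes_weight a b s u)"

lemma measurable_subord_density[measurable]: "subord_density a b s \<in> borel_measurable borel"
proof -
  have "(\<lambda>t. LINT u|lborel. exp (- (exp u * t)) * stieltjes_weight a b s u) \<in> borel_measurable lborel"
    by measurable
  then show ?thesis unfolding subord_density_def[abs_def] by simp
qed

context
  fixes a b s :: real
  assumes a: "0 \<le> a" and b: "0 < b" and s: "0 < s" "s < 1"
begin

lemma integrable_stieltjes_weight: "0 < lam \<Longrightarrow> integrable lborel (\<lambda>u. stieltjes_weight a b s u / (lam + exp u))"
  by (rule integrableI_nonneg)
    (auto simp: stieltjes_representation[OF a b s] add_pos_pos intro!: AE_I2 divide_nonneg_nonneg less_imp_le[OF stieltjes_weight_pos[OF a b s]])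

text \<open>With y = exp u the product (1 + y) * exp (- y t) is at most 1 + 1 / t, so a multiple of
  the integrand of the Stieltjes representation at lam = 1 is a majorant.\<close>

lemma integrable_subord_density:
  assumes "0 < t"
  shows "integrable lborel (\<lambda>u. exp (- (exp u * t)) * stieltjes_weight a b s u)"
proof (rule Bochner_Integration.integrable_bound)
  show "integrable lborel (\<lambda>u. (1 + 1 / t) * (stieltjes_weight a b s u / (1 + exp u)))"
    by (intro integrable_mult_right integrable_stieltjes_weight) auto
  show "AE u in lborel. norm (exp (- (exp u * t)) * stieltjes_weight a b s u)
       \<le> norm ((1 + 1 / t) * (stieltjes_weight a b s u / (1 + exp u)))"
  proof (rule AE_I2)
    fix u :: real
    define y where "y = exp u"
    have y: "y > 0" by (simp add: y_def)
    have "(1 + y) * exp (- (y * t)) \<le> (1 + y) * (1 / (1 + y * t))"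
    proof (rule mult_left_mono)
      have "1 + y * t \<le> exp (y * t)" by (rule exp_ge_add_one_self)
      then show "exp (- (y * t)) \<le> 1 / (1 + y * t)"
        using y assms by (simp add: exp_minus field_simps add_pos_pos)
    qed (use y in auto)
    also have "\<dots> \<le> 1 + 1 / t" using y assms by (simp add: field_simps add_pos_pos)
    finally have "exp (- (y * t)) \<le> (1 + 1 / t) / (1 + y)" using y by (simp add: field_simps)
    then have "exp (- (y * t)) * stieltjes_weight a b s u \<le> (1 + 1 / t) / (1 + y) * stieltjes_weight a b s u"
      by (rule mult_right_mono) (use stieltjes_weight_pos[OF a b s, of u] in simp)
    moreover have "0 \<le> stieltjes_weight a b s u" using stieltjes_weight_pos[OF a b s, of u] by simp
    ultimately show "norm (exp (- (exp u * t)) * stieltjes_weight a b s u)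
       \<le> norm ((1 + 1 / t) * (stieltjes_weight a b s u / (1 + exp u)))"
      using y assms by (simp add: abs_mult y_def[symmetric])
  qed
qed measurable

lemma subord_density_pos: "0 < t \<Longrightarrow> 0 < subord_density a b s t"
  unfolding subord_density_def
  using stieltjes_weight_pos[OF a b s]
  by (intro integral_pos_of_pos_on[where A=UNIV] integrable_subord_density) (auto simp: less_imp_le)

lemma subord_density_antimono: "0 < t \<Longrightarrow> t \<le> t' \<Longrightarrow> subord_density a b s t' \<le> subord_density a b s t"
  unfolding subord_density_def
  by (intro integral_mono integrable_subord_density mult_right_mono less_imp_le[OF stieltjes_weight_pos[OF a b s]]) auto

lemma nn_subord_density: "0 < t \<Longrightarrow>
   ennreal (subord_density a b s t) = (\<integral>\<^sup>+u. ennreal (exp (- (exp u * t)) * stieltjes_weight a b s u) \<partial>lborel)"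
  unfolding subord_density_def
  using stieltjes_weight_pos[OF a b s] by (subst nn_integral_eq_integral[OF integrable_subord_density]) (auto simp: less_imp_le)

text \<open>Tonelli: integrating exp (- (lam + exp u) t) over t first leaves the integrand of the
  Stieltjes representation.\<close>

lemma subord_laplace:
  assumes lam: "0 < lam"
  shows "(\<integral>\<^sup>+t. ennreal (exp (- (lam * t)) * subord_density a b s t) * indicator {0<..} t \<partial>lborel) = ennreal (1 / (1 + a * lam + b * lam powr s))"
proof -
  have w0: "0 \<le> stieltjes_weight a b s u" for u using stieltjes_weight_pos[OF a b s, of u] by simp
  have "(\<integral>\<^sup>+t. ennreal (exp (- (lam * t)) * subord_density a b s t) * indicator {0<..} t \<partial>lborel) =
    (\<integral>\<^sup>+t. (\<integral>\<^sup>+u. ennreal (exp (- ((lam + exp u) * t))) * indicator {0<..} t * ennreal (stieltjes_weight a b s u) \<partial>lborel) \<partial>lborel)"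
  proof (intro nn_integral_cong)
    fix t :: real
    show "ennreal (exp (- (lam * t)) * subord_density a b s t) * indicator {0<..} t =
      (\<integral>\<^sup>+u. ennreal (exp (- ((lam + exp u) * t))) * indicator {0<..} t * ennreal (stieltjes_weight a b s u) \<partial>lborel)"
    proof (cases "0 < t")
      case True
      have "ennreal (exp (- (lam * t)) * subord_density a b s t) = ennreal (exp (- (lam * t))) * ennreal (subord_density a b s t)"
        by (simp add: ennreal_mult')
      also have "\<dots> = (\<integral>\<^sup>+u. ennreal (exp (- (lam * t))) * ennreal (exp (- (exp u * t)) * stieltjes_weight a b s u) \<partial>lborel)"
        unfolding nn_subord_density[OF True] by (subst nn_integral_cmult) auto
      also have "\<dots> = (\<integral>\<^sup>+u. ennreal (exp (- ((lam + exp u) * t))) * indicator {0<..} t * ennreal (stieltjes_weight a b s u) \<partial>lborel)"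
        using True w0 by (intro nn_integral_cong) (simp add: ennreal_mult'[symmetric] exp_add[symmetric] algebra_simps)
      finally show ?thesis using True by simp
    qed simp
  qed
  also have "\<dots> = (\<integral>\<^sup>+u. (\<integral>\<^sup>+t. ennreal (exp (- ((lam + exp u) * t))) * indicator {0<..} t * ennreal (stieltjes_weight a b s u) \<partial>lborel) \<partial>lborel)"
    by (rule lborel_pair.Fubini') measurable
  also have "\<dots> = (\<integral>\<^sup>+u. ennreal (stieltjes_weight a b s u / (lam + exp u)) \<partial>lborel)"
  proof (intro nn_integral_cong)
    fix u :: real
    have p: "0 < lam + exp u" using lam by (simp add: add_pos_pos)
    show "(\<integral>\<^sup>+t. ennreal (exp (- ((lam + exp u) * t))) * indicator {0<..} t * ennreal (stieltjes_weight a b s u) \<partial>lborel)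
      = ennreal (stieltjes_weight a b s u / (lam + exp u))"
      using p w0 by (subst nn_integral_multc) (auto simp: nn_integral_exp_decay ennreal_mult'[symmetric])
  qed
  finally show ?thesis using stieltjes_representation[OF a b s lam] by simp
qed

text \<open>The mass is the monotone limit of the Laplace transform as lam decreases to 0 along 1 /
  (n + 1), and each of these values is at most 1.\<close>

lemma subord_mass: "(\<integral>\<^sup>+t. ennreal (subord_density a b s t) * indicator {0<..} t \<partial>lborel) \<le> 1"
proof -
  define f where "f n t = ennreal (exp (- (1 / real (Suc n) * t)) * subord_density a b s t) * indicator {0<..} t" for n t
  have p0: "0 < t \<Longrightarrow> 0 \<le> subord_density a b s t" for t using subord_density_pos[of t] by simp
  have "(\<lambda>n. \<integral>\<^sup>+t. f n t \<partial>lborel) \<longlonglongrightarrow> (\<integral>\<^sup>+t. ennreal (subord_density a b s t) * indicator {0<..} t \<partial>lborel)"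
  proof (rule nn_integral_LIMSEQ)
    show "incseq f"
      unfolding incseq_def le_fun_def f_def using p0
      by (auto intro!: ennreal_leI mult_right_mono divide_right_mono divide_left_mono split: split_indicator)
    fix t :: real
    have "(\<lambda>n. exp (- (1 / real (Suc n) * t)) * subord_density a b s t) \<longlonglongrightarrow> exp (- (0 * t)) * subord_density a b s t"
      by (intro tendsto_intros) (rule LIMSEQ_Suc[OF lim_1_over_n])
    then show "(\<lambda>n. f n t) \<longlonglongrightarrow> ennreal (subord_density a b s t) * indicator {0<..} t"
      unfolding f_def by (cases "0 < t") (auto intro!: tendsto_ennrealI)
  qed (simp add: f_def)
  then show ?thesis
  proof (rule LIMSEQ_le_const2, intro exI[of _ 0] allI impI)
    fix n :: nat
    have "(\<integral>\<^sup>+t. f n t \<partial>lborel) = ennreal (1 / (1 + a * (1 / real (Suc n)) + b * (1 / real (Suc n)) powr s))"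
      unfolding f_def by (rule subord_laplace) simp
    also have "\<dots> \<le> ennreal 1" using a b by (intro ennreal_leI) (auto simp: divide_le_eq add_pos_nonneg)
    finally show "(\<integral>\<^sup>+t. f n t \<partial>lborel) \<le> 1" by simp
  qed
qed

lemma integrable_subord_density_Ioi: "set_integrable lborel {0<..} (subord_density a b s)"
  unfolding set_integrable_def
proof (rule integrableI_nonneg)
  show "AE x in lborel. 0 \<le> indicat_real {0<..} x *\<^sub>R subord_density a b s x"
    using subord_density_pos by (auto simp: less_imp_le split: split_indicator)
  have "(\<integral>\<^sup>+ x. ennreal (indicat_real {0<..} x *\<^sub>R subord_density a b s x) \<partial>lborel) =
     (\<integral>\<^sup>+t. ennreal (subord_density a b s t) * indicator {0<..} t \<partial>lborel)"
    by (intro nn_integral_cong) (auto split: split_indicator)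
  then show "(\<integral>\<^sup>+ x. ennreal (indicat_real {0<..} x *\<^sub>R subord_density a b s x) \<partial>lborel) < \<infinity>"
    using subord_mass by (auto intro: le_less_trans)
qed measurable

end

section \<open>Two-sided bounds on the density for a = b = 1\<close>

context
  fixes s :: real
  assumes s: "0 < s" "s < 1"
begin

text \<open>The denominator A^2 + 2 A B cos (pi s) + B^2 can be completed to a square in either
  variable, so it is at least sin (pi s)^2 times the larger of A^2 and B^2. One of A = 1 - exp u and
  B = exp (s u) is always at least 1/2.\<close>

lemma stieltjes_weight_upper:
  "stieltjes_weight 1 1 s u \<le> 4 / (pi * sin (pi * s)) * exp ((1 + s) * u)"
proof -
  define A B c d where "A = 1 - exp u" and "B = exp (s * u)" and "c = cos (pi * s)" and "d = sin (pi * s)"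
  have d: "0 < d" unfolding d_def by (rule sin_pi_mult_pos[OF s])
  have cd: "c\<^sup>2 + d\<^sup>2 = 1" by (simp add: c_def d_def)
  have c2: "c\<^sup>2 = 1 - d\<^sup>2" using cd by simp
  have e1: "(A + B * c)\<^sup>2 + (B * d)\<^sup>2 = (B + A * c)\<^sup>2 + (A * d)\<^sup>2"
    by (simp add: power2_sum power_mult_distrib c2 algebra_simps)
  have "d\<^sup>2 / 4 \<le> (A + B * c)\<^sup>2 + (B * d)\<^sup>2"
  proof (cases "exp u \<le> 1 / 2")
    case True
    then have "1 / 2 \<le> A" by (simp add: A_def)
    then have "(1 / 2)\<^sup>2 \<le> A\<^sup>2" by (rule power_mono) simp
    then have "(1 / 2)\<^sup>2 * d\<^sup>2 \<le> A\<^sup>2 * d\<^sup>2" by (rule mult_right_mono) simp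
    then have "d\<^sup>2 / 4 \<le> (A * d)\<^sup>2" by (simp add: power_mult_distrib power_divide)
    then show ?thesis unfolding e1 using zero_le_power2[of "B + A * c"] by linarith
  next
    case False
    have "1 / 2 \<le> B"
    proof (cases "0 \<le> u")
      case True then have "1 \<le> B" using s by (simp add: B_def) then show ?thesis by simp
    next
      case neg: False
      then have "u \<le> s * u" using s by (simp add: mult_le_cancel_right2)
      then have "exp u \<le> B" by (simp add: B_def)
      then show ?thesis using False by simp
    qed
    then have "(1 / 2)\<^sup>2 \<le> B\<^sup>2" by (rule power_mono) simp
    then have "(1 / 2)\<^sup>2 * d\<^sup>2 \<le> B\<^sup>2 * d\<^sup>2" by (rule mult_right_mono) simp
    then have "d\<^sup>2 / 4 \<le> (B * d)\<^sup>2" by (simp add: power_mult_distrib power_divide)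
    then show ?thesis using zero_le_power2[of "A + B * c"] by linarith
  qed
  then have "exp ((1 + s) * u) * d / (pi * ((A + B * c)\<^sup>2 + (B * d)\<^sup>2)) \<le> exp ((1 + s) * u) * d / (pi * (d\<^sup>2 / 4))"
    using d by (intro divide_left_mono mult_left_mono mult_pos_pos) (auto simp: B_def intro!: add_nonneg_pos)
  also have "\<dots> = 4 / (pi * d) * exp ((1 + s) * u)" using d by (simp add: power2_eq_square)
  finally show ?thesis by (simp add: stieltjes_weight_def A_def B_def c_def d_def)
qed

text \<open>Bounding the cosine by 1 in modulus makes the denominator at most (|A| + B)^2, and |1 -
  exp u| is at most 1 + exp u.\<close>

lemma stieltjes_weight_lower:
  "sin (pi * s) / pi * (exp ((1 + s) * u) / (1 + exp u + exp (s * u))\<^sup>2) \<le> stieltjes_weight 1 1 s u"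
proof -
  define A B c d where "A = 1 - exp u" and "B = exp (s * u)" and "c = cos (pi * s)" and "d = sin (pi * s)"
  have d: "0 < d" unfolding d_def by (rule sin_pi_mult_pos[OF s])
  have cd: "c\<^sup>2 + d\<^sup>2 = 1" by (simp add: c_def d_def)
  have B: "B > 0" by (simp add: B_def)
  have "(A + B * c)\<^sup>2 + (B * d)\<^sup>2 = A\<^sup>2 + 2 * (A * B * c) + B\<^sup>2 * (c\<^sup>2 + d\<^sup>2)"
    by (simp add: power2_sum power_mult_distrib algebra_simps)
  also have "\<dots> \<le> A\<^sup>2 + 2 * (\<bar>A\<bar> * B) + B\<^sup>2"
  proof -
    have "A * B * c \<le> \<bar>A * B * c\<bar>" by simp
    also have "\<dots> = \<bar>A\<bar> * B * \<bar>c\<bar>" using B by (simp add: abs_mult)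
    also have "\<dots> \<le> \<bar>A\<bar> * B * 1" using B by (intro mult_left_mono) (auto simp: c_def)
    finally show ?thesis by (simp add: cd)
  qed
  also have "\<dots> = (\<bar>A\<bar> + B)\<^sup>2" by (simp add: power2_sum)
  also have "\<dots> \<le> (1 + exp u + B)\<^sup>2" using B by (intro power_mono) (auto simp: A_def abs_if)
  finally have le: "(A + B * c)\<^sup>2 + (B * d)\<^sup>2 \<le> (1 + exp u + B)\<^sup>2" .
  have pos: "0 < (A + B * c)\<^sup>2 + (B * d)\<^sup>2" using B d by (simp add: add_nonneg_pos)
  have "exp ((1 + s) * u) * d / (pi * (1 + exp u + B)\<^sup>2) \<le> exp ((1 + s) * u) * d / (pi * ((A + B * c)\<^sup>2 + (B * d)\<^sup>2))"
    using d le pos B by (intro divide_left_mono mult_left_mono mult_pos_pos) (auto intro!: add_pos_pos)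
  then show ?thesis by (simp add: stieltjes_weight_def A_def B_def c_def d_def mult_ac)
qed

text \<open>In the variable y = exp u the integral is Gamma (1 + s). Its finiteness is read off from
  the Stieltjes representation at lam = 1: by the lower bound on the weight, the integrand lies
  below a multiple of the weight divided by 1 + exp u.\<close>

lemma integrable_exp_neg_exp: "integrable lborel (\<lambda>u. exp (- exp u) * exp ((1 + s) * u))"
proof (rule Bochner_Integration.integrable_bound)
  define d where "d = sin (pi * s)"
  have d: "0 < d" unfolding d_def by (rule sin_pi_mult_pos[OF s])
  show "integrable lborel (\<lambda>u. (108 * pi / d) * (stieltjes_weight 1 1 s u / (1 + exp u)))"
    by (intro integrable_mult_right integrable_stieltjes_weight) (use s in auto)
  show "AE u in lborel. norm (exp (- exp u) * exp ((1 + s) * u))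
       \<le> norm ((108 * pi / d) * (stieltjes_weight 1 1 s u / (1 + exp u)))"
  proof (rule AE_I2)
    fix u :: real
    define y q E where "y = exp u" and "q = exp (s * u)" and "E = exp ((1 + s) * u)"
    have y: "y > 0" "q > 0" "E > 0" by (auto simp: y_def q_def E_def)
    have "q \<le> 1 + y"
    proof (cases "0 \<le> u")
      case True then have "q \<le> y" using s by (simp add: y_def q_def mult_le_cancel_right1 mult_left_le_one_le) then show ?thesis by simp
    next
      case False then have "q \<le> 1" using s by (simp add: q_def mult_le_0_iff) then show ?thesis using y by simp
    qed
    then have "(1 + y + q)\<^sup>2 \<le> (2 * (1 + y))\<^sup>2" using y by (intro power_mono) auto
    from mult_right_mono[OF this, of "1 + y"]
    have 1: "(1 + y + q)\<^sup>2 * (1 + y) \<le> 4 * (1 + y) ^ 3"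
      using y by (simp add: power2_eq_square power3_eq_cube algebra_simps)
    \<comment> \<open>The constant 108 is 4 * 27: the cubic growth 4 (1 + y)^3 is controlled by (1 +
      y)^3 \<le> 27 exp y.\<close>
    have "1 + y / 3 \<le> exp (y / 3)" by (rule exp_ge_add_one_self)
    then have "1 + y \<le> 3 * exp (y / 3)" using y by linarith
    then have "(1 + y) ^ 3 \<le> (3 * exp (y / 3)) ^ 3" using y by (intro power_mono) auto
    also have "\<dots> = 27 * exp y" by (simp add: power_mult_distrib exp_of_nat_mult[symmetric])
    finally have 2: "(1 + y + q)\<^sup>2 * (1 + y) \<le> 108 * exp y" using 1 by simp
    have pos: "0 < (1 + y + q)\<^sup>2 * (1 + y)" using y by (intro mult_pos_pos) (auto intro!: add_pos_pos)
    have "exp (- y) \<le> 108 / ((1 + y + q)\<^sup>2 * (1 + y))"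
      using 2 pos by (simp add: exp_minus field_simps)
    then have "exp (- y) * E \<le> 108 / ((1 + y + q)\<^sup>2 * (1 + y)) * E" by (rule mult_right_mono) (use y in simp)
    also have "\<dots> = (108 * pi / d) / (1 + y) * (d / pi * (E / (1 + y + q)\<^sup>2))" using d by (simp add: mult.commute)
    also have "\<dots> \<le> (108 * pi / d) / (1 + y) * stieltjes_weight 1 1 s u"
      using stieltjes_weight_lower[of u] d y by (intro mult_left_mono) (auto simp: y_def q_def E_def d_def)
    finally show "norm (exp (- exp u) * exp ((1 + s) * u))
       \<le> norm ((108 * pi / d) * (stieltjes_weight 1 1 s u / (1 + exp u)))"
      using y d stieltjes_weight_pos[of 1 1 s u] s by (simp add: y_def E_def abs_mult)
  qed
qed measurable

text \<open>The total mass of the weight is the limit of lam times its Stieltjes transform as lam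
  tends to infinity, and lam / (1 + lam + lam powr s) is at most 1. The density integrates the
  weight against a factor that is at most 1.\<close>

lemma subord_density_le_1:
  assumes "0 < t"
  shows "subord_density 1 1 s t \<le> 1"
proof -
  have w0: "0 \<le> stieltjes_weight 1 1 s u" for u using stieltjes_weight_pos[of 1 1 s u] s by simp
  define f where "f n u = ennreal (real (Suc n) * (stieltjes_weight 1 1 s u / (real (Suc n) + exp u)))" for n u
  have "(\<lambda>n. \<integral>\<^sup>+u. f n u \<partial>lborel) \<longlonglongrightarrow> (\<integral>\<^sup>+u. ennreal (stieltjes_weight 1 1 s u) \<partial>lborel)"
  proof (rule nn_integral_LIMSEQ)
    show "incseq f"
    proof (intro incseq_SucI le_funI)
      fix n u
      have "x / (x + y) \<le> (1 + x) / (1 + x + y)" if "x > 0" "y > 0" for x y :: real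
        using that by (simp add: field_simps)
      from this[of "real (Suc n)" "exp u"]
      have "real (Suc n) / (real (Suc n) + exp u) \<le> real (Suc (Suc n)) / (real (Suc (Suc n)) + exp u)"
        by simp
      from mult_right_mono[OF this w0[of u]]
      show "f n u \<le> f (Suc n) u" unfolding f_def by (intro ennreal_leI) simp
    qed
    fix u :: real
    have "(\<lambda>n. real (Suc n) / (real (Suc n) + exp u) * stieltjes_weight 1 1 s u) \<longlonglongrightarrow> 1 * stieltjes_weight 1 1 s u"
      by (intro tendsto_mult tendsto_const) real_asymp
    then show "(\<lambda>n. f n u) \<longlonglongrightarrow> ennreal (stieltjes_weight 1 1 s u)"
      unfolding f_def by (intro tendsto_ennrealI) simp
  qed (simp add: f_def)
  then have "(\<integral>\<^sup>+u. ennreal (stieltjes_weight 1 1 s u) \<partial>lborel) \<le> 1"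
  proof (rule LIMSEQ_le_const2, intro exI[of _ 0] allI impI)
    fix n :: nat
    have "(\<integral>\<^sup>+u. f n u \<partial>lborel) = ennreal (real (Suc n)) * (\<integral>\<^sup>+u. ennreal (stieltjes_weight 1 1 s u / (real (Suc n) + exp u)) \<partial>lborel)"
      unfolding f_def by (subst nn_integral_cmult[symmetric]) (auto simp del: of_nat_Suc simp: ennreal_mult'[symmetric])
    also have "\<dots> = ennreal (real (Suc n)) * ennreal (1 / (1 + 1 * real (Suc n) + 1 * real (Suc n) powr s))"
      using s by (subst stieltjes_representation) auto
    also have "\<dots> = ennreal (real (Suc n) / (1 + real (Suc n) + real (Suc n) powr s))"
      by (simp del: of_nat_Suc add: ennreal_mult'[symmetric])
    also have "\<dots> \<le> ennreal 1" by (intro ennreal_leI) (auto simp: divide_le_eq add_pos_nonneg)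
    finally show "(\<integral>\<^sup>+u. f n u \<partial>lborel) \<le> 1" by simp
  qed
  moreover have "ennreal (subord_density 1 1 s t) \<le> (\<integral>\<^sup>+u. ennreal (stieltjes_weight 1 1 s u) \<partial>lborel)"
    using assms s w0 by (subst nn_subord_density) (auto intro!: nn_integral_mono ennreal_leI mult_left_le_one_le)
  ultimately have "ennreal (subord_density 1 1 s t) \<le> ennreal 1" by (metis order_trans ennreal_1)
  then show ?thesis by (subst (asm) ennreal_le_iff) auto
qed

text \<open>Once the weight is bounded by a multiple of exp ((1 + s) u), the shift of u by ln t
  extracts exactly t powr (- 1 - s). The constant is 4 / (pi * sin (pi * s)) times Gamma (1 +
  s).\<close>

lemma subord_density_upper:
  obtains C where "0 < C" "\<And>t. 0 < t \<Longrightarrow> subord_density 1 1 s t \<le> C * t powr (- 1 - s)"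
proof
  define C where "C = 4 / (pi * sin (pi * s)) * (LINT u|lborel. exp (- exp u) * exp ((1 + s) * u))"
  have d: "0 < sin (pi * s)" by (rule sin_pi_mult_pos[OF s])
  show "0 < C" unfolding C_def using d
    by (intro mult_pos_pos integral_pos_of_pos_on[where A=UNIV] integrable_exp_neg_exp) auto
  fix t :: real assume t: "0 < t"
  define g where "g u = exp (- exp u) * exp ((1 + s) * u)" for u
  have g: "exp (- (exp u * t)) * exp ((1 + s) * u) = t powr (- 1 - s) * g (ln t + 1 * u)" for u
  proof -
    have "t powr (- 1 - s) * exp ((1 + s) * (ln t + u)) = exp ((1 + s) * u)"
      using t by (simp add: powr_def exp_add[symmetric] algebra_simps)
    moreover have "exp (ln t + u) = exp u * t" using t by (simp add: exp_add)
    ultimately show ?thesis by (simp add: g_def)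
  qed
  have gi: "integrable lborel (\<lambda>u. g (ln t + 1 * u))"
    by (rule lborel_integrable_real_affine) (auto simp: g_def[abs_def] integrable_exp_neg_exp)
  have ge: "(LINT u|lborel. g u) = (LINT u|lborel. g (ln t + 1 * u))"
    using lborel_integral_real_affine[of 1 g "ln t"] by simp
  have "subord_density 1 1 s t \<le> (LINT u|lborel. 4 / (pi * sin (pi * s)) * (t powr (- 1 - s) * g (ln t + 1 * u)))"
    unfolding subord_density_def
  proof (rule integral_mono)
    show "integrable lborel (\<lambda>u. exp (- (exp u * t)) * stieltjes_weight 1 1 s u)"
      using integrable_subord_density[of 1 1 s] s t by auto
    show "integrable lborel (\<lambda>u. 4 / (pi * sin (pi * s)) * (t powr (- 1 - s) * g (ln t + 1 * u)))"
      by (intro integrable_mult_right gi)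
    fix u
    have "exp (- (exp u * t)) * stieltjes_weight 1 1 s u \<le> exp (- (exp u * t)) * (4 / (pi * sin (pi * s)) * exp ((1 + s) * u))"
      by (intro mult_left_mono stieltjes_weight_upper) auto
    then show "exp (- (exp u * t)) * stieltjes_weight 1 1 s u \<le> 4 / (pi * sin (pi * s)) * (t powr (- 1 - s) * g (ln t + 1 * u))"
      unfolding g[symmetric] by (simp add: mult_ac)
  qed
  also have "\<dots> = C * t powr (- 1 - s)"
    unfolding integral_mult_right_zero C_def ge[symmetric] by (simp add: g_def[abs_def])
  finally show "subord_density 1 1 s t \<le> C * t powr (- 1 - s)" .
qed

text \<open>For t \<ge> 1 the same shift works with the lower bound on the weight, whose denominator
  only grows when u is replaced by ln t + u. For t < 1 monotonicity gives at least the value at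
  1.\<close>

lemma subord_density_lower:
  obtains c where "0 < c" "\<And>t. 0 < t \<Longrightarrow> c * min 1 (t powr (- 1 - s)) \<le> subord_density 1 1 s t"
proof
  define g where "g u = exp (- exp u) * (exp ((1 + s) * u) / (1 + exp u + exp (s * u))\<^sup>2)" for u
  define c where "c = sin (pi * s) / pi * (LINT u|lborel. g u)"
  have d: "0 < sin (pi * s)" by (rule sin_pi_mult_pos[OF s])
  have den: "1 \<le> (1 + exp u + exp (s * u))\<^sup>2" for u :: real by (simp add: add_increasing2 one_le_power)
  have gint: "integrable lborel g"
  proof (rule Bochner_Integration.integrable_bound[OF integrable_exp_neg_exp])
    show "AE u in lborel. norm (g u) \<le> norm (exp (- exp u) * exp ((1 + s) * u))"
    proof (rule AE_I2)
      fix u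
      have "exp ((1 + s) * u) / (1 + exp u + exp (s * u))\<^sup>2 \<le> exp ((1 + s) * u) / 1"
        using den[of u] by (intro divide_left_mono mult_pos_pos zero_less_power add_pos_pos) auto
      from mult_left_mono[OF this, of "exp (- exp u)"]
      show "norm (g u) \<le> norm (exp (- exp u) * exp ((1 + s) * u))"
        by (simp add: g_def abs_mult)
    qed
  qed (simp add: g_def[abs_def])
  have gpos: "0 < g u" for u unfolding g_def
    by (intro mult_pos_pos divide_pos_pos zero_less_power add_pos_pos) auto
  show "0 < c" unfolding c_def using d gpos
    by (intro mult_pos_pos divide_pos_pos integral_pos_of_pos_on[where A=UNIV] gint) (auto simp: less_imp_le)
  have ge1: "c * t powr (- 1 - s) \<le> subord_density 1 1 s t" if t: "1 \<le> t" for t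
  proof -
    have gi: "integrable lborel (\<lambda>u. g (ln t + 1 * u))"
      by (rule lborel_integrable_real_affine) (auto simp: gint)
    have ge: "(LINT u|lborel. g u) = (LINT u|lborel. g (ln t + 1 * u))"
      using lborel_integral_real_affine[of 1 g "ln t"] by simp
    have "c * t powr (- 1 - s) = (LINT u|lborel. sin (pi * s) / pi * (t powr (- 1 - s) * g (ln t + 1 * u)))"
      unfolding integral_mult_right_zero c_def ge[symmetric] by simp
    also have "\<dots> \<le> subord_density 1 1 s t"
      unfolding subord_density_def
    proof (rule integral_mono)
      show "integrable lborel (\<lambda>u. exp (- (exp u * t)) * stieltjes_weight 1 1 s u)"
        using integrable_subord_density[of 1 1 s] s t by auto
      show "integrable lborel (\<lambda>u. sin (pi * s) / pi * (t powr (- 1 - s) * g (ln t + 1 * u)))"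
        by (intro integrable_mult_right gi)
      fix u
      define y where "y = ln t + u"
      have le: "u \<le> y" using t by (simp add: y_def)
      have et: "exp u * t = exp y" using t by (simp add: y_def exp_add)
      have e2: "t powr (- 1 - s) * exp ((1 + s) * y) = exp ((1 + s) * u)"
        using t by (simp add: y_def powr_def exp_add[symmetric] algebra_simps)
      have "t powr (- 1 - s) * g y = exp (- exp y) * (exp ((1 + s) * u) / (1 + exp y + exp (s * y))\<^sup>2)"
        unfolding g_def e2[symmetric] by simp
      also have "\<dots> \<le> exp (- exp y) * (exp ((1 + s) * u) / (1 + exp u + exp (s * u))\<^sup>2)"
        using le s
        by (intro mult_left_mono divide_left_mono power_mono add_mono mult_pos_pos zero_less_power add_pos_pos) (auto simp: add_increasing)
      finally have "sin (pi * s) / pi * (t powr (- 1 - s) * g y) \<le> exp (- exp y) * (sin (pi * s) / pi * (exp ((1 + s) * u) / (1 + exp u + exp (s * u))\<^sup>2))"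
        using d by (simp only: mult.left_commute[of "exp (- exp y)"]) (intro mult_left_mono, auto)
      also have "\<dots> \<le> exp (- exp y) * stieltjes_weight 1 1 s u"
        by (intro mult_left_mono stieltjes_weight_lower) auto
      finally show "sin (pi * s) / pi * (t powr (- 1 - s) * g (ln t + 1 * u)) \<le> exp (- (exp u * t)) * stieltjes_weight 1 1 s u"
        by (simp add: y_def[symmetric] et)
    qed
    finally show ?thesis .
  qed
  fix t :: real assume t: "0 < t"
  show "c * min 1 (t powr (- 1 - s)) \<le> subord_density 1 1 s t"
  proof (cases "1 \<le> t")
    case True
    then have "c * min 1 (t powr (- 1 - s)) \<le> c * t powr (- 1 - s)" using \<open>0 < c\<close> by (intro mult_left_mono) auto
    then show ?thesis using ge1[OF True] by simp
  next
    case False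
    have "c * min 1 (t powr (- 1 - s)) \<le> c * 1" using \<open>0 < c\<close> by (intro mult_left_mono) auto
    also have "\<dots> \<le> subord_density 1 1 s 1" using ge1[of 1] by simp
    also have "\<dots> \<le> subord_density 1 1 s t" using t False s by (intro subord_density_antimono) auto
    finally show ?thesis .
  qed
qed

end

subsection \<open>Gaussian kernels\<close>

definition echar :: "'a::euclidean_space \<Rightarrow> 'a \<Rightarrow> complex" where
  "echar x \<xi> = exp (2 * of_real pi * \<i> * of_real (x \<bullet> \<xi>))"

lemma norm_echar[simp]: "norm (echar x \<xi>) = 1"
  by (simp add: echar_def)

lemma echar_commute: "echar x \<xi> = echar \<xi> x"
  by (simp add: echar_def inner_commute)

lemma measurable_echar[measurable (raw)]:
  "f \<in> borel_measurable M \<Longrightarrow> g \<in> borel_measurable M \<Longrightarrow> (\<lambda>z. echar (f z) (g z)) \<in> borel_measurable M"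
  unfolding echar_def by measurable

text \<open>The function with Fourier transform exp (- t |\<xi>|^2) in the convention with 2 pi in
  the exponent; it is the usual heat kernel at time t / (4 pi^2).\<close>

definition gauss_kernel :: "real \<Rightarrow> 'a::euclidean_space \<Rightarrow> real" where
  "gauss_kernel t x = (pi / t) powr (DIM('a) / 2) * exp (- (pi\<^sup>2 * (norm x)\<^sup>2 / t))"

lemma measurable_gauss_kernel[measurable (raw)]:
  fixes g :: "'b \<Rightarrow> 'a::euclidean_space"
  assumes [measurable]: "f \<in> borel_measurable M" "g \<in> borel_measurable M"
  shows "(\<lambda>z. gauss_kernel (f z) (g z)) \<in> borel_measurable M"
  unfolding gauss_kernel_def by measurable

lemma gauss_kernel_nonneg[simp]: "0 \<le> gauss_kernel t x"
  by (simp add: gauss_kernel_def)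

lemma gauss_kernel_pos: "0 < t \<Longrightarrow> 0 < gauss_kernel t x"
  by (simp add: gauss_kernel_def)

lemma gauss_kernel_minus[simp]: "gauss_kernel t (- x) = gauss_kernel t x"
  by (simp add: gauss_kernel_def)

lemma integrable_gaussian_real:
  assumes t: "0 < t"
  shows "integrable lborel (\<lambda>x::real. exp (- (t * x\<^sup>2)))"
proof -
  define c where "c = sqrt (2 * t)"
  have c: "c \<noteq> 0" "c\<^sup>2 = 2 * t" using t by (auto simp: c_def)
  have "integrable lborel (\<lambda>x. sqrt (2 * pi) * std_normal_density x)" by simp
  then have "integrable lborel (\<lambda>x. sqrt (2 * pi) * std_normal_density (0 + c * x))"
    by (rule lborel_integrable_real_affine[OF _ c(1)])
  then show ?thesis by (simp add: std_normal_density_def power_mult_distrib c(2))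
qed

text \<open>A rescaling by sqrt (2 * t) of the characteristic function of the standard normal
  distribution.\<close>

lemma fourier_gaussian_real:
  assumes t: "0 < t"
  shows "(LINT x|lborel. of_real (exp (- (t * x\<^sup>2))) * exp (2 * of_real pi * \<i> * of_real (y * x)))
     = complex_of_real (sqrt (pi / t) * exp (- (pi\<^sup>2 * y\<^sup>2 / t)))"
proof -
  define c where "c = sqrt (2 * t)"
  define v where "v = 2 * pi * y / c"
  have c: "c > 0" "c\<^sup>2 = 2 * t" using t by (auto simp: c_def)
  have "complex_of_real (exp (- (v\<^sup>2) / 2)) = char std_normal_distribution v"
    by (simp add: char_std_normal_distribution)
  also have "\<dots> = (LINT x|lborel. std_normal_density x *\<^sub>R iexp (v * x))"
    unfolding char_def by (subst integral_density) auto
  also have "\<dots> = \<bar>c\<bar> *\<^sub>R (LINT x|lborel. std_normal_density (0 + c * x) *\<^sub>R iexp (v * (0 + c * x)))"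
    by (rule lborel_integral_real_affine) (use c in simp)
  also have "(\<lambda>x. std_normal_density (0 + c * x) *\<^sub>R iexp (v * (0 + c * x))) =
     (\<lambda>x. of_real (1 / sqrt (2 * pi)) * (of_real (exp (- (t * x\<^sup>2))) * exp (2 * of_real pi * \<i> * of_real (y * x))))"
    using c(1) by (simp add: fun_eq_iff std_normal_density_def power_mult_distrib c(2) v_def scaleR_conv_of_real mult_ac)
  finally have "complex_of_real (exp (- (v\<^sup>2) / 2)) = of_real (c / sqrt (2 * pi)) *
      (LINT x|lborel. of_real (exp (- (t * x\<^sup>2))) * exp (2 * of_real pi * \<i> * of_real (y * x)))"
    using c(1) by (simp add: scaleR_conv_of_real)
  moreover have "v\<^sup>2 / 2 = pi\<^sup>2 * y\<^sup>2 / t" using t by (simp add: v_def power_divide power_mult_distrib c(2))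
  moreover have "c / sqrt (2 * pi) = 1 / sqrt (pi / t)" "sqrt (pi / t) \<noteq> 0"
    using t by (simp_all add: c_def real_sqrt_mult real_sqrt_divide)
  ultimately show ?thesis by simp
qed

interpretation lborel_product: product_sigma_finite "\<lambda>_::'a::euclidean_space. lborel :: real measure"
  by standard

lemma integral_lborel_prod:
  fixes f :: "'a::euclidean_space \<Rightarrow> real \<Rightarrow> complex"
  assumes "\<And>b. b \<in> Basis \<Longrightarrow> integrable lborel (f b)"
  shows "integrable lborel (\<lambda>x::'a. \<Prod>b\<in>Basis. f b (x \<bullet> b))"
    and "(LINT x::'a|lborel. (\<Prod>b\<in>Basis. f b (x \<bullet> b))) = (\<Prod>b\<in>Basis. LINT x|lborel. f b x)"
proof -
  have fm[measurable]: "f b \<in> borel_measurable borel" if "b \<in> Basis" for b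
    using borel_measurable_integrable[OF assms[OF that]] by simp
  have T[measurable]: "(\<lambda>g. \<Sum>b\<in>Basis. g b *\<^sub>R b) \<in> measurable (\<Pi>\<^sub>M b\<in>(Basis::'a set). lborel) borel"
    by measurable
  have m: "(\<lambda>x::'a. \<Prod>b\<in>Basis. f b (x \<bullet> b)) \<in> borel_measurable borel"
    by (intro borel_measurable_prod measurable_compose[OF _ fm]) auto
  have e: "(\<Prod>b\<in>Basis. f b ((\<Sum>b\<in>Basis. g b *\<^sub>R b) \<bullet> b)) = (\<Prod>b\<in>Basis. f b (g b))" for g :: "'a \<Rightarrow> real"
    by (intro prod.cong refl) simp
  show "integrable lborel (\<lambda>x::'a. \<Prod>b\<in>Basis. f b (x \<bullet> b))"
    unfolding lborel_eq[where 'a='a]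
    by (subst integrable_distr_eq[OF T m]) (simp only: e, intro lborel_product.product_integrable_prod assms finite_Basis)
  show "(LINT x::'a|lborel. (\<Prod>b\<in>Basis. f b (x \<bullet> b))) = (\<Prod>b\<in>Basis. LINT x|lborel. f b x)"
    unfolding lborel_eq[where 'a='a]
    by (subst integral_distr[OF T m]) (simp only: e lborel_product.product_integral_prod[OF finite_Basis assms])
qed

lemma gaussian_echar_prod:
  fixes x \<xi> :: "'a::euclidean_space"
  shows "complex_of_real (exp (- (t * (norm \<xi>)\<^sup>2))) * echar x \<xi> =
    (\<Prod>b\<in>Basis. of_real (exp (- (t * (\<xi> \<bullet> b)\<^sup>2))) * exp (2 * of_real pi * \<i> * of_real ((x \<bullet> b) * (\<xi> \<bullet> b))))"
proof -
  have "(norm \<xi>)\<^sup>2 = (\<Sum>b\<in>Basis. (\<xi> \<bullet> b)\<^sup>2)"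
    by (subst power2_norm_eq_inner, subst euclidean_inner) (simp add: power2_eq_square)
  then have 1: "exp (- (t * (norm \<xi>)\<^sup>2)) = (\<Prod>b\<in>Basis. exp (- (t * (\<xi> \<bullet> b)\<^sup>2)))"
    by (simp add: exp_sum[symmetric] sum_distrib_left sum_negf)
  have 2: "echar x \<xi> = (\<Prod>b\<in>Basis. exp (2 * of_real pi * \<i> * of_real ((x \<bullet> b) * (\<xi> \<bullet> b))))"
    unfolding echar_def euclidean_inner[of x \<xi>]
    by (simp add: exp_sum[symmetric] sum_distrib_left)
  show ?thesis unfolding 1 2 by (simp add: prod.distrib)
qed

lemma
  fixes x :: "'a::euclidean_space"
  assumes t: "0 < t"
  shows integrable_gaussian_echar: "integrable lborel (\<lambda>\<xi>. complex_of_real (exp (- (t * (norm \<xi>)\<^sup>2))) * echar x \<xi>)"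
    and fourier_gaussian: "(LINT \<xi>|lborel. complex_of_real (exp (- (t * (norm \<xi>)\<^sup>2))) * echar x \<xi>) = of_real (gauss_kernel t x)"
proof -
  let ?f = "\<lambda>b z. complex_of_real (exp (- (t * z\<^sup>2))) * exp (2 * of_real pi * \<i> * of_real ((x \<bullet> b) * z))"
  have i: "integrable lborel (?f b)" for b
    by (rule Bochner_Integration.integrable_bound[OF integrable_gaussian_real[OF t]]) (auto simp: norm_mult)
  note p = integral_lborel_prod[of ?f, OF i]
  show "integrable lborel (\<lambda>\<xi>. complex_of_real (exp (- (t * (norm \<xi>)\<^sup>2))) * echar x \<xi>)"
    unfolding gaussian_echar_prod by (rule p(1))
  have "(norm x)\<^sup>2 = (\<Sum>b\<in>Basis. (x \<bullet> b)\<^sup>2)"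
    by (subst power2_norm_eq_inner, subst euclidean_inner) (simp add: power2_eq_square)
  then have 1: "exp (- (pi\<^sup>2 * (norm x)\<^sup>2 / t)) = (\<Prod>b\<in>Basis. exp (- (pi\<^sup>2 * (x \<bullet> b)\<^sup>2 / t)))"
    by (simp add: exp_sum[symmetric] sum_distrib_left sum_negf sum_divide_distrib)
  have 2: "sqrt (pi / t) ^ DIM('a) = (pi / t) powr (DIM('a) / 2)"
    using t by (simp add: powr_half_sqrt[symmetric] powr_realpow[symmetric] powr_powr)
  have "(LINT \<xi>|lborel. complex_of_real (exp (- (t * (norm \<xi>)\<^sup>2))) * echar x \<xi>) =
    (\<Prod>b\<in>Basis. complex_of_real (sqrt (pi / t) * exp (- (pi\<^sup>2 * (x \<bullet> b)\<^sup>2 / t))))"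
    unfolding gaussian_echar_prod p(2) using t by (intro prod.cong refl fourier_gaussian_real)
  also have "\<dots> = of_real (gauss_kernel t x)"
    unfolding gauss_kernel_def 1 2[symmetric] of_real_prod[symmetric] by (simp add: prod.distrib)
  finally show "(LINT \<xi>|lborel. complex_of_real (exp (- (t * (norm \<xi>)\<^sup>2))) * echar x \<xi>) = of_real (gauss_kernel t x)" .
qed

lemma integrable_gaussian:
  assumes t: "0 < t"
  shows "integrable lborel (\<lambda>\<xi>::'a::euclidean_space. exp (- (t * (norm \<xi>)\<^sup>2)))"
  by (rule Bochner_Integration.integrable_bound[OF integrable_gaussian_echar[OF t, of 0]]) (auto simp: norm_mult)

lemma gauss_kernel_conv_gaussian:
  assumes t: "0 < t"
  shows "gauss_kernel t (x::'a::euclidean_space) = (pi / t) powr (DIM('a) / 2) * exp (- (pi\<^sup>2 / t * (norm x)\<^sup>2))"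
  by (simp add: gauss_kernel_def)

text \<open>Up to its prefactor \<open>gauss_kernel t\<close> is the Gaussian with parameter pi^2 /
  t, so the transform formula for Gaussians applies a second time and the prefactors cancel. The
  mass is the value of the transform at 0.\<close>

lemma
  fixes \<xi> :: "'a::euclidean_space"
  assumes t: "0 < t"
  shows integrable_gauss_kernel: "integrable lborel (gauss_kernel t :: 'a \<Rightarrow> real)"
    and fourier_gauss_kernel: "(LINT x|lborel. complex_of_real (gauss_kernel t x) * echar \<xi> x) = of_real (exp (- (t * (norm \<xi>)\<^sup>2)))"
    and integral_gauss_kernel: "(LINT x|lborel. gauss_kernel t (x::'a)) = 1"
proof -
  have t': "0 < pi\<^sup>2 / t" using t by simp
  show 1: "integrable lborel (gauss_kernel t :: 'a \<Rightarrow> real)"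
    unfolding gauss_kernel_conv_gaussian[OF t, abs_def] by (intro integrable_mult_right integrable_gaussian t')
  have e: "(LINT x|lborel. complex_of_real (gauss_kernel t x) * echar \<xi> x) = of_real (exp (- (t * (norm \<xi>)\<^sup>2)))" for \<xi> :: 'a
  proof -
    have "(LINT x|lborel. complex_of_real (gauss_kernel t x) * echar \<xi> x) =
      of_real ((pi / t) powr (DIM('a) / 2)) * (LINT x|lborel. complex_of_real (exp (- (pi\<^sup>2 / t * (norm x)\<^sup>2))) * echar \<xi> x)"
      unfolding gauss_kernel_conv_gaussian[OF t] integral_mult_right_zero[symmetric] by (simp add: mult_ac)
    also have "\<dots> = of_real ((pi / t) powr (DIM('a) / 2) * gauss_kernel (pi\<^sup>2 / t) \<xi>)"
      unfolding fourier_gaussian[OF t'] by simp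
    also have "(pi / t) powr (DIM('a) / 2) * gauss_kernel (pi\<^sup>2 / t) \<xi> = exp (- (t * (norm \<xi>)\<^sup>2))"
    proof -
      have h: "(pi / t) powr p * (t / pi) powr p = 1" for p using t by (simp add: powr_mult[symmetric])
      show ?thesis using t h[of "DIM('a) / 2"] by (simp add: gauss_kernel_def power2_eq_square mult_ac)
    qed
    finally show ?thesis .
  qed
  show "(LINT x|lborel. complex_of_real (gauss_kernel t x) * echar \<xi> x) = of_real (exp (- (t * (norm \<xi>)\<^sup>2)))" by (rule e)
  have "complex_of_real (LINT x|lborel. gauss_kernel t (x::'a)) = 1"
    using e[of 0] by (simp add: echar_def integral_complex_of_real)
  then show "(LINT x|lborel. gauss_kernel t (x::'a)) = 1" by (simp only: of_real_eq_1_iff)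
qed

text \<open>The inequality y / p \<le> exp (y / p) raised to the power \<open>p\<close>. The true
  maximum, at y = p, is smaller by the factor exp (- p).\<close>

lemma powr_times_exp_minus_le:
  fixes y :: real
  assumes "0 < p" "0 \<le> y"
  shows "y powr p * exp (- y) \<le> p powr p"
proof -
  have "y / p \<le> exp (y / p)" using exp_ge_add_one_self[of "y / p"] by linarith
  then have "(y / p) powr p \<le> exp (y / p) powr p" using assms by (intro powr_mono2) auto
  also have "\<dots> = exp y" using assms by (simp add: powr_def)
  finally have "y powr p \<le> exp y * p powr p" using assms by (simp add: powr_divide divide_le_eq)
  then show ?thesis by (simp add: exp_minus field_simps)
qed

text \<open>With y = pi^2 |x|^2 / t the kernel is a multiple of |x|^(-n) times y powr (n / 2) * exp
  (- y), which is bounded. The bound is uniform in t, at the price of excluding the origin.\<close>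

lemma gauss_kernel_le:
  fixes x :: "'a::euclidean_space"
  assumes t: "0 < t" and x: "x \<noteq> 0"
  shows "gauss_kernel t x \<le> (DIM('a) / 2 / pi) powr (DIM('a) / 2) * norm x powr (- real DIM('a))"
proof -
  define p where "p = real DIM('a) / 2"
  have p: "p > 0" by (simp add: p_def)
  define y where "y = pi\<^sup>2 * (norm x)\<^sup>2 / t"
  have y: "y > 0" using t x by (simp add: y_def)
  have "pi / t = y * (1 / pi) * (1 / (norm x)\<^sup>2)" using t x by (simp add: y_def power2_eq_square)
  then have "(pi / t) powr p = y powr p * (1 / pi) powr p * (1 / (norm x)\<^sup>2) powr p"
    using y by (simp only: powr_mult)
  also have "(1 / (norm x)\<^sup>2) powr p = norm x powr (- (2 * p))"
  proof -
    have "1 / (norm x)\<^sup>2 = norm x powr (- 2)" using x by (simp add: powr_minus divide_inverse)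
    then show ?thesis by (simp add: powr_powr)
  qed
  finally have "gauss_kernel t x = (y powr p * exp (- y)) * ((1 / pi) powr p * norm x powr (- (2 * p)))"
    by (simp add: gauss_kernel_def y_def p_def)
  also have "\<dots> \<le> p powr p * ((1 / pi) powr p * norm x powr (- (2 * p)))"
    using y p by (intro mult_right_mono powr_times_exp_minus_le) auto
  also have "\<dots> = (p / pi) powr p * norm x powr (- (2 * p))"
    using p by (simp add: powr_divide)
  finally show ?thesis by (simp add: p_def)
qed

subsection \<open>Subordination of the kernel\<close>

lemma integrable_pair_mult:
  fixes f :: "'a::euclidean_space \<Rightarrow> real" and g :: "'b::euclidean_space \<Rightarrow> real"
  assumes f: "integrable lborel f" and g: "integrable lborel g"
  shows "integrable (lborel \<Otimes>\<^sub>M lborel) (\<lambda>(x, y). f x * g y)"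
proof (rule lborel_pair.Fubini_integrable)
  have [measurable]: "f \<in> borel_measurable borel" "g \<in> borel_measurable borel"
    using f g by auto
  show "(\<lambda>(x, y). f x * g y) \<in> borel_measurable (lborel \<Otimes>\<^sub>M lborel)" by measurable
  show "integrable lborel (\<lambda>x. LINT y|lborel. norm (case (x, y) of (x, y) \<Rightarrow> f x * g y))"
    using f by (simp add: abs_mult)
  show "AE x in lborel. integrable lborel (\<lambda>y. case (x, y) of (x, y) \<Rightarrow> f x * g y)"
    using g by simp
qed

text \<open>If a multiplier \<open>m\<close> is a mixture of multipliers \<open>W t\<close> with
  density \<open>P\<close>, then its inverse Fourier transform is the mixture of theirs. The
  Gaussian factor makes the double integral absolutely convergent; the bounded \<open>Q\<close>
  carries the character and any further multiplier. The identity for \<open>m\<close> is asked off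
  the origin, since the Laplace representation holds for positive lam.\<close>

lemma mixture_fubini:
  fixes P :: "real \<Rightarrow> real" and Q :: "'a::euclidean_space \<Rightarrow> complex"
  assumes P: "integrable lborel P" and P0: "\<And>t. t \<le> 0 \<Longrightarrow> P t = 0"
    and Q[measurable]: "Q \<in> borel_measurable borel" and Q1: "\<And>\<xi>. norm (Q \<xi>) \<le> 1"
    and \<alpha>: "0 < \<alpha>"
    and W[measurable]: "case_prod W \<in> borel_measurable (borel \<Otimes>\<^sub>M borel)"
    and W1: "\<And>t \<xi>. 0 < t \<Longrightarrow> \<bar>W t \<xi>\<bar> \<le> 1"
    and m[measurable]: "m \<in> borel_measurable borel"
    and m_eq: "\<And>\<xi>. \<xi> \<noteq> 0 \<Longrightarrow> m \<xi> = (LINT t|lborel. P t * W t \<xi>)"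
  shows "(LINT \<xi>|lborel. of_real (exp (- (\<alpha> * (norm \<xi>)\<^sup>2)) * m \<xi>) * Q \<xi>) =
    (LINT t|lborel. of_real (P t) * (LINT \<xi>|lborel. of_real (exp (- (\<alpha> * (norm \<xi>)\<^sup>2)) * W t \<xi>) * Q \<xi>))"
proof -
  have Pm[measurable]: "P \<in> borel_measurable borel" using P by auto
  let ?F = "\<lambda>t \<xi>. of_real (P t) * (of_real (exp (- (\<alpha> * (norm \<xi>)\<^sup>2)) * W t \<xi>) * Q \<xi>) :: complex"
  have int: "integrable (lborel \<Otimes>\<^sub>M lborel) (case_prod ?F)"
  proof (rule Bochner_Integration.integrable_bound[OF integrable_pair_mult[OF P integrable_gaussian[OF \<alpha>]]])
    show "case_prod ?F \<in> borel_measurable (lborel \<Otimes>\<^sub>M lborel)" by measurable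
    have "norm (?F t \<xi>) \<le> norm (P t * exp (- (\<alpha> * (norm \<xi>)\<^sup>2)))" for t \<xi>
    proof (cases "0 < t")
      case True
      have "\<bar>W t \<xi>\<bar> * norm (Q \<xi>) \<le> 1 * 1" using W1[OF True] Q1 by (intro mult_mono) auto
      from mult_left_mono[OF this, of "\<bar>P t\<bar> * exp (- (\<alpha> * (norm \<xi>)\<^sup>2))"]
      show ?thesis by (simp add: norm_mult abs_mult mult_ac)
    qed (simp add: P0)
    then show "AE z in lborel \<Otimes>\<^sub>M lborel. norm (case_prod ?F z) \<le> norm (case z of (t, \<xi>) \<Rightarrow> P t * exp (- (\<alpha> * (norm \<xi>)\<^sup>2)))"
      by (intro AE_I2) (simp add: split_beta)
  qed
  have "(LINT \<xi>|lborel. of_real (exp (- (\<alpha> * (norm \<xi>)\<^sup>2)) * m \<xi>) * Q \<xi>) = (LINT \<xi>|lborel. LINT t|lborel. ?F t \<xi>)"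
  proof (rule integral_cong_AE)
    show "AE \<xi> in lborel. of_real (exp (- (\<alpha> * (norm \<xi>)\<^sup>2)) * m \<xi>) * Q \<xi> = (LINT t|lborel. ?F t \<xi>)"
    proof (rule AE_I[where N="{0}"])
      show "{\<xi> \<in> space lborel. of_real (exp (- (\<alpha> * (norm \<xi>)\<^sup>2)) * m \<xi>) * Q \<xi> \<noteq> (LINT t|lborel. ?F t \<xi>)} \<subseteq> {0}"
      proof (clarsimp, rule ccontr)
        fix \<xi> :: 'a assume n: "\<xi> \<noteq> 0" and ne: "complex_of_real (exp (- (\<alpha> * (norm \<xi>)\<^sup>2))) * of_real (m \<xi>) * Q \<xi> \<noteq>
          (LINT t|lborel. of_real (P t) * (of_real (exp (- (\<alpha> * (norm \<xi>)\<^sup>2))) * of_real (W t \<xi>) * Q \<xi>))"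
        have "(LINT t|lborel. of_real (P t) * (of_real (exp (- (\<alpha> * (norm \<xi>)\<^sup>2))) * of_real (W t \<xi>) * Q \<xi>)) =
          (LINT t|lborel. of_real (P t * W t \<xi>) * (of_real (exp (- (\<alpha> * (norm \<xi>)\<^sup>2))) * Q \<xi>))"
          by (simp add: mult_ac)
        also have "\<dots> = of_real (m \<xi>) * (of_real (exp (- (\<alpha> * (norm \<xi>)\<^sup>2))) * Q \<xi>)"
          by (simp only: integral_mult_left_zero integral_complex_of_real m_eq[OF n])
        finally show False using ne by (simp add: mult_ac)
      qed
    qed auto
  qed measurable
  also have "\<dots> = (LINT t|lborel. LINT \<xi>|lborel. ?F t \<xi>)"
    by (rule lborel_pair.Fubini_integral[OF int])
  finally show ?thesis by (simp only: integral_mult_right_zero)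
qed

lemma integral_eq_of_nn_integral_Ioi:
  fixes f :: "real \<Rightarrow> real"
  assumes "(\<integral>\<^sup>+t. ennreal (f t) * indicator {0<..} t \<partial>lborel) = ennreal v" "0 \<le> v"
    "\<And>t. 0 < t \<Longrightarrow> 0 \<le> f t" "f \<in> borel_measurable borel"
  shows "(LINT t|lborel. indicator {0<..} t * f t) = v"
proof -
  have [measurable]: "f \<in> borel_measurable borel" by fact
  have "(\<lambda>t. indicator {0<..} t * f t) \<in> borel_measurable borel" by measurable
  moreover have "(\<integral>\<^sup>+t. ennreal (indicator {0<..} t * f t) \<partial>lborel) = (\<integral>\<^sup>+t. ennreal (f t) * indicator {0<..} t \<partial>lborel)"
    by (intro nn_integral_cong) (auto split: split_indicator)
  ultimately show ?thesis using assms
    by (subst integral_eq_nn_integral) (auto intro!: AE_I2 split: split_indicator)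
qed

lemma norm_sq_powr: "(norm \<xi>)\<^sup>2 powr s = norm \<xi> powr (2 * s)"
  by (cases "norm \<xi> = 0") (simp_all add: powr_powr flip: powr_numeral)

section \<open>Uniform bound on the heat kernel\<close>

context
  fixes s :: real
begin

text \<open>The coefficients of |\<xi>|^2 and of |\<xi>|^(2s) are kept apart:
  \<open>\<alpha>\<close> = \<open>t\<close> is the heat kernel, and \<open>\<alpha>\<close> =
  \<epsilon> + t its damped version.\<close>

definition regular_heat :: "real \<Rightarrow> real \<Rightarrow> 'a::euclidean_space \<Rightarrow> complex" where
  "regular_heat \<alpha> t x = (LINT \<xi>|lborel. of_real (exp (- (\<alpha> * (norm \<xi>)\<^sup>2)) * exp (- (t * norm \<xi> powr (2 * s)))) * echar x \<xi>)"

lemma measurable_regular_heat[measurable (raw)]: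
  assumes [measurable]: "f \<in> borel_measurable borel" "g \<in> borel_measurable borel"
  shows "(\<lambda>t::real. regular_heat (f t) (g t) x) \<in> borel_measurable borel"
proof -
  have "(\<lambda>t. regular_heat (f t) (g t) x) \<in> borel_measurable lborel"
    unfolding regular_heat_def by measurable
  then show ?thesis by simp
qed

definition subord_kernel :: "'a::euclidean_space \<Rightarrow> real" where
  "subord_kernel x = (LINT t|lborel. indicator {0<..} t * (subord_density 1 1 s t * gauss_kernel t x))"

lemma measurable_subord_kernel[measurable]: "subord_kernel \<in> borel_measurable (borel :: 'a::euclidean_space measure)"
proof -
  have "(\<lambda>x::'a. LINT t|lborel. indicator {0<..} t * (subord_density 1 1 s t * gauss_kernel t x)) \<in> borel_measurable lborel"
    by measurable
  then show ?thesis unfolding subord_kernel_def[abs_def] by simp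
qed

context
  assumes s: "0 < s" "s < 1"
begin

lemma subord_laplace_integral:
  fixes \<xi> :: "'a::euclidean_space"
  assumes "0 \<le> a" "0 < b" "\<xi> \<noteq> 0"
  shows "1 / (1 + a * (norm \<xi>)\<^sup>2 + b * norm \<xi> powr (2 * s)) =
    (LINT t|lborel. (indicator {0<..} t * subord_density a b s t) * exp (- (t * (norm \<xi>)\<^sup>2)))"
proof -
  have "(LINT t|lborel. indicator {0<..} t * (exp (- ((norm \<xi>)\<^sup>2 * t)) * subord_density a b s t)) =
     1 / (1 + a * (norm \<xi>)\<^sup>2 + b * norm \<xi> powr (2 * s))"
  proof (rule integral_eq_of_nn_integral_Ioi)
    show "(\<integral>\<^sup>+t. ennreal (exp (- ((norm \<xi>)\<^sup>2 * t)) * subord_density a b s t) * indicator {0<..} t \<partial>lborel) =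
      ennreal (1 / (1 + a * (norm \<xi>)\<^sup>2 + b * norm \<xi> powr (2 * s)))"
      using assms s by (subst subord_laplace) (auto simp: norm_sq_powr)
    show "0 < t \<Longrightarrow> 0 \<le> exp (- ((norm \<xi>)\<^sup>2 * t)) * subord_density a b s t" for t
      using subord_density_pos[of a b s t] assms s by simp
  qed (use assms in \<open>auto intro!: divide_nonneg_nonneg\<close>)
  then show ?thesis by (simp add: mult_ac)
qed

lemma integrable_subord_density_indicator:
  assumes "0 \<le> a" "0 < b"
  shows "integrable lborel (\<lambda>t. indicator {0<..} t * subord_density a b s t)"
  using integrable_subord_density_Ioi[OF assms s] by (simp add: set_integrable_def)

lemma integral_subord_density_le_1:
  assumes "0 \<le> a" "0 < b"
  shows "(LINT t|lborel. indicator {0<..} t * subord_density a b s t) \<le> 1"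
proof -
  have p0: "0 \<le> indicator {0<..} t * subord_density a b s t" for t
    using subord_density_pos[of a b s t] assms s by (auto split: split_indicator)
  have "ennreal (LINT t|lborel. indicator {0<..} t * subord_density a b s t) = (\<integral>\<^sup>+t. ennreal (indicator {0<..} t * subord_density a b s t) \<partial>lborel)"
    by (rule nn_integral_eq_integral[symmetric]) (use integrable_subord_density_indicator assms p0 in auto)
  also have "\<dots> = (\<integral>\<^sup>+t. ennreal (subord_density a b s t) * indicator {0<..} t \<partial>lborel)"
    by (intro nn_integral_cong) (auto split: split_indicator)
  also have "\<dots> \<le> ennreal 1" using subord_mass[OF assms s] by simp
  finally show ?thesis by (subst (asm) ennreal_le_iff) auto
qed

text \<open>Multiplying by \<open>1 / (1 + c |\<xi>|\<^sup>2\<^sup>s)\<close> mixes the Gaussians with a density of mass at most 1, hence keeps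
  the uniform bound.\<close>

lemma resolvent_power_bound:
  fixes x :: "'a::euclidean_space"
  assumes c: "0 < c" and \<alpha>: "0 < \<alpha>" and B: "\<And>t. \<alpha> \<le> t \<Longrightarrow> gauss_kernel t x \<le> B"
  shows "norm (LINT \<xi>|lborel. of_real (exp (- (\<alpha> * (norm \<xi>)\<^sup>2)) * (1 / (1 + c * norm \<xi> powr (2 * s)) ^ m)) * echar x \<xi>) \<le> B"
  using \<alpha> B
proof (induction m arbitrary: \<alpha>)
  case 0
  then show ?case by (simp add: fourier_gaussian)
next
  case (Suc m)
  define P where "P t = indicator {0<..} t * subord_density 0 c s t" for t
  have P: "integrable lborel P" unfolding P_def using c by (intro integrable_subord_density_indicator) auto
  have P0: "0 \<le> P t" for t using subord_density_pos[of 0 c s t] c s by (auto simp: P_def split: split_indicator)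
  define Q where "Q \<xi> = of_real (1 / (1 + c * norm \<xi> powr (2 * s)) ^ m) * echar x \<xi>" for \<xi>
  have [measurable]: "Q \<in> borel_measurable borel" unfolding Q_def by measurable
  have B0: "0 \<le> B" using Suc.prems(2)[of \<alpha>] gauss_kernel_nonneg order_trans by blast
  have "(LINT \<xi>|lborel. of_real (exp (- (\<alpha> * (norm \<xi>)\<^sup>2)) * (1 / (1 + c * norm \<xi> powr (2 * s)) ^ Suc m)) * echar x \<xi>) =
    (LINT \<xi>|lborel. of_real (exp (- (\<alpha> * (norm \<xi>)\<^sup>2)) * (1 / (1 + c * norm \<xi> powr (2 * s)))) * Q \<xi>)"
    by (simp add: Q_def mult_ac)
  also have "\<dots> = (LINT t|lborel. of_real (P t) * (LINT \<xi>|lborel. of_real (exp (- (\<alpha> * (norm \<xi>)\<^sup>2)) * exp (- (t * (norm \<xi>)\<^sup>2))) * Q \<xi>))"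
  proof (rule mixture_fubini[OF P _ _ _ Suc.prems(1)])
    have "1 \<le> (1 + c * norm \<xi> powr (2 * s)) ^ m" for \<xi> :: 'a using c by (intro one_le_power) simp
    then show "norm (Q \<xi>) \<le> 1" for \<xi> using c
      by (auto simp: Q_def norm_mult norm_divide norm_power divide_le_eq simp del: of_real_add of_real_mult)
    show "\<xi> \<noteq> 0 \<Longrightarrow> 1 / (1 + c * norm \<xi> powr (2 * s)) = (LINT t|lborel. P t * exp (- (t * (norm \<xi>)\<^sup>2)))" for \<xi> :: 'a
      using subord_laplace_integral[of 0 c \<xi>] c by (simp add: P_def)
  qed (auto simp: P_def)
  also have "norm \<dots> \<le> (LINT t|lborel. P t * B)"
  proof (rule Bochner_Integration.integral_norm_bound_integral)
    define I where "I t = (LINT \<xi>|lborel. of_real (exp (- (\<alpha> * (norm \<xi>)\<^sup>2)) * exp (- (t * (norm \<xi>)\<^sup>2))) * Q \<xi>)" for t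
    have [measurable]: "I \<in> borel_measurable borel" unfolding I_def
    proof -
      have "(\<lambda>t. LINT \<xi>|lborel. complex_of_real (exp (- (\<alpha> * (norm \<xi>)\<^sup>2)) * exp (- (t * (norm \<xi>)\<^sup>2))) * Q \<xi>) \<in> borel_measurable lborel"
        by measurable
      then show "(\<lambda>t. LINT \<xi>|lborel. complex_of_real (exp (- (\<alpha> * (norm \<xi>)\<^sup>2)) * exp (- (t * (norm \<xi>)\<^sup>2))) * Q \<xi>) \<in> borel_measurable borel"
        by simp
    qed
    have Pm[measurable]: "P \<in> borel_measurable borel" using P by auto
    have le: "norm (of_real (P t) * I t) \<le> P t * B" for t
    proof (cases "0 < t")
      case True
      have "I t = (LINT \<xi>|lborel. of_real (exp (- ((\<alpha> + t) * (norm \<xi>)\<^sup>2)) * (1 / (1 + c * norm \<xi> powr (2 * s)) ^ m)) * echar x \<xi>)"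
      proof -
        have e: "exp (- ((\<alpha> + t) * r)) = exp (- (\<alpha> * r)) * exp (- (t * r))" for r
          by (simp add: exp_add[symmetric] distrib_right)
        show ?thesis unfolding I_def Q_def e by (simp add: mult_ac)
      qed
      \<comment> \<open>The factor exp (- t |\<xi>|^2) only increases the Gaussian parameter, so the
        hypothesis on all parameters from \<open>\<alpha>\<close> on is inherited by
        \<open>\<alpha> + t\<close>. This is why \<open>\<alpha>\<close> varies in the
        induction.\<close>
      also have "norm \<dots> \<le> B" using Suc.IH[of "\<alpha> + t"] Suc.prems True by simp
      finally show ?thesis using P0[of t] by (simp add: norm_mult mult_left_mono)
    qed (simp add: P_def)
    show "integrable lborel (\<lambda>t. P t * B)" using P by simp
    show "integrable lborel (\<lambda>t. of_real (P t) * I t)"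
      by (rule Bochner_Integration.integrable_bound[OF \<open>integrable lborel (\<lambda>t. P t * B)\<close>])
        (use le P0 B0 in \<open>auto simp: abs_mult intro!: AE_I2\<close>)
    show "norm (of_real (P t) * I t) \<le> P t * B" for t by (rule le)
  qed
  also have "\<dots> = (LINT t|lborel. P t) * B" by simp
  also have "\<dots> \<le> 1 * B"
    using integral_subord_density_le_1[of 0 c] c B0 by (intro mult_right_mono) (auto simp: P_def)
  finally show ?case by simp
qed

text \<open>exp (- t |\<xi>|^(2s)) is the Euler limit of the powers 1 / (1 + t |\<xi>|^(2s) / m)^m,
  each of which satisfies the bound; the Gaussian factor dominates all of them.\<close>

lemma regular_heat_bound:
  fixes x :: "'a::euclidean_space"
  assumes t: "0 < t" and \<alpha>: "0 < \<alpha>" and B: "\<And>t. \<alpha> \<le> t \<Longrightarrow> gauss_kernel t x \<le> B"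
  shows "norm (regular_heat \<alpha> t x) \<le> B"
proof (rule LIMSEQ_le_const2[OF tendsto_norm])
  let ?f = "\<lambda>m \<xi>. of_real (exp (- (\<alpha> * (norm \<xi>)\<^sup>2)) * (1 / (1 + t / real (Suc m) * norm \<xi> powr (2 * s)) ^ Suc m)) * echar x \<xi>"
  show "(\<lambda>m. LINT \<xi>|lborel. ?f m \<xi>) \<longlonglongrightarrow> regular_heat \<alpha> t x"
    unfolding regular_heat_def
  proof (rule integral_dominated_convergence[OF _ _ integrable_gaussian[OF \<alpha>]])
    show "AE \<xi> in lborel. (\<lambda>m. ?f m \<xi>) \<longlonglongrightarrow> of_real (exp (- (\<alpha> * (norm \<xi>)\<^sup>2)) * exp (- (t * norm \<xi> powr (2 * s)))) * echar x \<xi>"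
    proof (rule AE_I2)
      fix \<xi> :: 'a
      have "(\<lambda>m. (1 + (t * norm \<xi> powr (2 * s)) / real m) ^ m) \<longlonglongrightarrow> exp (t * norm \<xi> powr (2 * s))"
        by (rule tendsto_exp_limit_sequentially)
      then have "(\<lambda>m. 1 / (1 + (t * norm \<xi> powr (2 * s)) / real (Suc m)) ^ Suc m) \<longlonglongrightarrow> 1 / exp (t * norm \<xi> powr (2 * s))"
        by (intro tendsto_intros) (auto dest: LIMSEQ_Suc)
      then have l: "(\<lambda>m. 1 / (1 + t / real (Suc m) * norm \<xi> powr (2 * s)) ^ Suc m) \<longlonglongrightarrow> exp (- (t * norm \<xi> powr (2 * s)))"
        by (simp add: exp_minus inverse_eq_divide del: of_nat_Suc power_Suc)
      show "(\<lambda>m. ?f m \<xi>) \<longlonglongrightarrow> of_real (exp (- (\<alpha> * (norm \<xi>)\<^sup>2)) * exp (- (t * norm \<xi> powr (2 * s)))) * echar x \<xi>"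
        by (intro tendsto_mult tendsto_of_real tendsto_const l)
    qed
    show "AE \<xi> in lborel. norm (?f m \<xi>) \<le> exp (- (\<alpha> * (norm \<xi>)\<^sup>2))" for m
    proof (rule AE_I2)
      fix \<xi> :: 'a
      have "0 \<le> t / real (Suc m) * norm \<xi> powr (2 * s)" using t by simp
      then have "1 \<le> (1 + t / real (Suc m) * norm \<xi> powr (2 * s)) ^ Suc m" by (intro one_le_power) simp
      then have "exp (- (\<alpha> * (norm \<xi>)\<^sup>2)) * (1 / (1 + t / real (Suc m) * norm \<xi> powr (2 * s)) ^ Suc m) \<le> exp (- (\<alpha> * (norm \<xi>)\<^sup>2)) * 1"
        and "0 \<le> exp (- (\<alpha> * (norm \<xi>)\<^sup>2)) * (1 / (1 + t / real (Suc m) * norm \<xi> powr (2 * s)) ^ Suc m)"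
        by (intro mult_left_mono, simp_all del: power_Suc of_nat_Suc add: divide_le_eq)
      then show "norm (?f m \<xi>) \<le> exp (- (\<alpha> * (norm \<xi>)\<^sup>2))"
        unfolding norm_mult norm_of_real norm_echar by linarith
    qed
  qed measurable
  show "\<exists>N. \<forall>m\<ge>N. norm (LINT \<xi>|lborel. ?f m \<xi>) \<le> B"
    using t by (intro exI[of _ 0] allI impI resolvent_power_bound \<alpha> B) auto
qed

lemma heat_kernel_eq_regular_heat:
  fixes x :: "'a::euclidean_space"
  shows "heat_kernel s x t = regular_heat t t x"
proof -
  have "heat_kernel s x t = (LINT \<xi>|lborel. exp (of_real (- t * symbol s \<xi>) + 2 * of_real pi * \<i> * of_real (x \<bullet> \<xi>)))"
    unfolding heat_kernel_def symbol_def
    by (rule integral_completion) measurable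
  also have "\<dots> = regular_heat t t x"
    unfolding regular_heat_def
    by (intro Bochner_Integration.integral_cong refl)
      (simp add: symbol_def exp_add exp_diff exp_minus distrib_left exp_of_real echar_def field_simps flip: of_real_mult of_real_power)
  finally show ?thesis .
qed

end

end

section \<open>Integrability of powers and exponentials on the half-line\<close>

lemma integrable_powr_near_0:
  fixes a :: real
  assumes "-1 < a"
  shows "integrable lborel (\<lambda>t. indicator {0<..1} t * t powr a)"
proof -
  have "((\<lambda>x. x powr a) has_integral (1 powr (a + 1) / (a + 1))) {0..1}"
    by (rule has_integral_powr_from_0) (use assms in auto)
  then have "(\<lambda>x. x powr a) absolutely_integrable_on {0..1}"
    by (intro nonnegative_absolutely_integrable_1) (auto simp: integrable_on_def)
  then have "integrable lborel (\<lambda>t. indicator {0..1} t * t powr a)"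
    by (simp add: set_integrable_def integrable_completion)
  then show ?thesis
    by (rule Bochner_Integration.integrable_bound) (auto split: split_indicator)
qed

lemma integrable_powr_near_infinity:
  fixes a :: real
  assumes "a < -1"
  shows "integrable lborel (\<lambda>t. indicator {1<..} t * t powr a)"
proof -
  have "((\<lambda>x. x powr a) has_integral - (1 powr (a + 1)) / (a + 1)) {1..}"
    by (rule has_integral_powr_to_inf) (use assms in auto)
  then have "(\<lambda>x. x powr a) absolutely_integrable_on {1..}"
    by (intro nonnegative_absolutely_integrable_1) (auto simp: integrable_on_def)
  then have "integrable lborel (\<lambda>t. indicator {1..} t * t powr a)"
    by (simp add: set_integrable_def integrable_completion)
  then show ?thesis
    by (rule Bochner_Integration.integrable_bound) (auto split: split_indicator)
qed

text \<open>Meant for the origin in dimension 1, where the Gaussians blow up like t powr (- 1/2).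
  Near 0 the boundedness of \<open>f\<close> is used, near infinity its integrability.\<close>

lemma integrable_powr_mult_bounded:
  fixes a :: real
  assumes a: "-1 < a" "a \<le> 0" and f: "integrable lborel (\<lambda>t. indicator {0<..} t * f t)"
    and f1: "\<And>t. 0 < t \<Longrightarrow> \<bar>f t\<bar> \<le> M" and [measurable]: "f \<in> borel_measurable borel"
  shows "integrable lborel (\<lambda>t. indicator {0<..} t * (f t * t powr a))"
proof (rule Bochner_Integration.integrable_bound)
  show "integrable lborel (\<lambda>t. M * (indicator {0<..1} t * t powr a) + \<bar>indicator {0<..} t * f t\<bar>)"
    by (intro Bochner_Integration.integrable_add integrable_mult_right integrable_powr_near_0 integrable_abs f a)
  show "AE t in lborel. norm (indicator {0<..} t * (f t * t powr a)) \<le> norm (M * (indicator {0<..1} t * t powr a) + \<bar>indicator {0<..} t * f t\<bar>)"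
  proof (rule AE_I2)
    fix t :: real
    have M: "0 \<le> M" using f1[of 1] by simp
    consider "t \<le> 0" | "0 < t" "t \<le> 1" | "1 < t" by linarith
    then show "norm (indicator {0<..} t * (f t * t powr a)) \<le> norm (M * (indicator {0<..1} t * t powr a) + \<bar>indicator {0<..} t * f t\<bar>)"
    proof cases
      case 2
      then have "\<bar>f t\<bar> * t powr a \<le> M * t powr a + \<bar>f t\<bar>" by (intro add_increasing2 mult_right_mono f1) auto
      then show ?thesis using 2 M by (simp add: abs_mult del: mult_le_cancel_right)
    next
      case 3
      have "t powr a \<le> 1" using 3 a powr_mono[of a 0 t] by simp
      then have "\<bar>f t\<bar> * t powr a \<le> \<bar>f t\<bar> * 1" by (intro mult_left_mono) auto
      then show ?thesis using 3 M by (simp add: abs_mult)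
    qed simp
  qed
qed measurable

lemma integrable_exp_neg_Ioi: "integrable lborel (\<lambda>t::real. indicator {0<..} t * exp (- t))"
proof (rule integrableI_nonneg)
  have "(\<integral>\<^sup>+t. ennreal (indicator {0<..} t * exp (- t)) \<partial>lborel) = (\<integral>\<^sup>+t. ennreal (exp (- (1 * t))) * indicator {0<..} t \<partial>lborel)"
    by (intro nn_integral_cong) (auto split: split_indicator)
  then show "(\<integral>\<^sup>+t. ennreal (indicator {0<..} t * exp (- t)) \<partial>lborel) < \<infinity>"
    using nn_integral_exp_decay[of 1] by simp
qed (auto split: split_indicator)

section \<open>Identification of the kernel with the mixture of Gaussians\<close>

context
  fixes s :: real
  assumes s: "0 < s" "s < 1"
begin

text \<open>A factor \<open>exp (- \<epsilon> |\<xi>|\<^sup>2)\<close> makes all iterated integrals converge absolutely; it is removed at the end by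
  dominated convergence with the majorant \<open>\<beta>\<close>.\<close>

lemma kernel_representation:
  fixes x :: "'a::euclidean_space"
  assumes \<beta>: "\<And>t t'. 0 < t \<Longrightarrow> t \<le> t' \<Longrightarrow> gauss_kernel t' x \<le> \<beta> t"
    and \<beta>1: "integrable lborel (\<lambda>t. indicator {0<..} t * (exp (- t) * \<beta> t))"
    and \<beta>2: "integrable lborel (\<lambda>t. indicator {0<..} t * (subord_density 1 1 s t * \<beta> t))"
    and [measurable]: "\<beta> \<in> borel_measurable borel"
  shows "set_integrable lebesgue {0<..} (kernel_integrand s x)"
    and "complex_kernel s x = of_real (subord_kernel s x)"
    and "integrable lborel (\<lambda>t. indicator {0<..} t * (subord_density 1 1 s t * gauss_kernel t x))"
proof -
  define p where "p = subord_density 1 1 s"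
  have [measurable]: "p \<in> borel_measurable borel" unfolding p_def by measurable
  have p0: "0 < t \<Longrightarrow> 0 \<le> p t" for t using subord_density_pos[of 1 1 s t] s by (simp add: p_def)
  have \<beta>0: "0 < t \<Longrightarrow> 0 \<le> \<beta> t" for t using \<beta>[of t t] gauss_kernel_nonneg[of t x] by (meson order_refl order_trans)
  \<comment> \<open>The damped heat kernel has Gaussian parameter \<open>\<epsilon> + t\<close>,
    which explains why \<open>\<beta> t\<close> has to majorise the Gaussians of all parameters from
    \<open>t\<close> on.\<close>
  have hb: "norm (regular_heat s \<alpha> t x) \<le> \<beta> t" if "0 < t" "t \<le> \<alpha>" for t \<alpha>
    by (rule regular_heat_bound) (use s that \<beta>[of t] in auto)
  have [measurable]: "(\<lambda>t. regular_heat s (f t) t x) \<in> borel_measurable borel" if "f \<in> borel_measurable borel" for f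
    using measurable_regular_heat[OF that, where g="\<lambda>t. t" and x=x] by simp
  define J where "J \<epsilon> t = of_real (indicator {0<..} t * exp (- t)) * regular_heat s (\<epsilon> + t) t x" for \<epsilon> t
  have [measurable]: "J \<epsilon> \<in> borel_measurable borel" for \<epsilon> unfolding J_def by measurable
  have J_bound: "norm (J \<epsilon> t) \<le> indicator {0<..} t * (exp (- t) * \<beta> t)" if "0 \<le> \<epsilon>" for \<epsilon> t
    using hb[of t "\<epsilon> + t"] that by (auto simp: J_def norm_mult split: split_indicator)
  have J_int: "integrable lborel (J \<epsilon>)" if "0 \<le> \<epsilon>" for \<epsilon>
    by (rule Bochner_Integration.integrable_bound[OF \<beta>1])
      (auto intro!: AE_I2 order_trans[OF J_bound[OF that]])
  have ki: "indicator {0<..} t *\<^sub>R kernel_integrand s x t = J 0 t" for t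
    by (auto simp: J_def kernel_integrand_def heat_kernel_eq_regular_heat[OF s] split: split_indicator)
  show "set_integrable lebesgue {0<..} (kernel_integrand s x)"
    unfolding set_integrable_def ki by (subst integrable_completion) (use J_int[of 0] in auto)
  show gi: "integrable lborel (\<lambda>t. indicator {0<..} t * (subord_density 1 1 s t * gauss_kernel t x))"
    by (rule Bochner_Integration.integrable_bound[OF \<beta>2])
      (use p0 \<beta> in \<open>auto intro!: AE_I2 mult_left_mono simp: p_def[symmetric] abs_mult \<beta>0 split: split_indicator\<close>)
  define P where "P t = indicator {0<..} t * p t" for t
  have P: "integrable lborel P" unfolding P_def p_def using s by (intro integrable_subord_density_indicator) auto
  \<comment> \<open>Both sides are the inverse Fourier transform at \<open>x\<close> of exp (-
    \<epsilon> |\<xi>|^2) / (1 + |\<xi>|^2 + |\<xi>|^(2s)). The left writes the fraction 1 / r as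
    the integral of exp (- r t), the right as the Laplace transform of the density at
    |\<xi>|^2.\<close>
  have eq: "(LINT t|lborel. J \<epsilon> t) = (LINT t|lborel. of_real (P t * gauss_kernel (\<epsilon> + t) x))" if \<epsilon>: "0 < \<epsilon>" for \<epsilon>
  proof -
    define m where "m \<xi> = 1 / (1 + 1 * (norm \<xi>)\<^sup>2 + 1 * norm \<xi> powr (2 * s))" for \<xi> :: 'a
    have [measurable]: "m \<in> borel_measurable borel" unfolding m_def by measurable
    define E where "E t = indicator {0<..} t * exp (- t)" for t :: real
    have E: "integrable lborel E" unfolding E_def by (rule integrable_exp_neg_Ioi)
    have "(LINT \<xi>|lborel. of_real (exp (- (\<epsilon> * (norm \<xi>)\<^sup>2)) * m \<xi>) * echar x \<xi>) =
      (LINT t|lborel. of_real (E t) * (LINT \<xi>|lborel. of_real (exp (- (\<epsilon> * (norm \<xi>)\<^sup>2)) * exp (- (t * (norm \<xi>)\<^sup>2) - t * norm \<xi> powr (2 * s))) * echar x \<xi>))"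
    proof (rule mixture_fubini[OF E _ _ _ \<epsilon>])
      fix \<xi> :: 'a
      define r where "r = 1 + (norm \<xi>)\<^sup>2 + norm \<xi> powr (2 * s)"
      have r: "0 < r" by (simp add: r_def add_pos_nonneg)
      have "(LINT t|lborel. indicator {0<..} t * exp (- (r * t))) = 1 / r"
        by (rule integral_eq_of_nn_integral_Ioi[OF nn_integral_exp_decay]) (use r in auto)
      moreover have "E t * exp (- (t * (norm \<xi>)\<^sup>2) - t * norm \<xi> powr (2 * s)) = indicator {0<..} t * exp (- (r * t))" for t
        by (simp add: E_def r_def exp_add[symmetric] algebra_simps)
      ultimately show "m \<xi> = (LINT t|lborel. E t * exp (- (t * (norm \<xi>)\<^sup>2) - t * norm \<xi> powr (2 * s)))"
        by (simp add: m_def r_def)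
      show "\<bar>exp (- (t * (norm \<xi>)\<^sup>2) - t * norm \<xi> powr (2 * s))\<bar> \<le> 1" if "0 < t" for t
      proof -
        have "0 \<le> t * (norm \<xi>)\<^sup>2" "0 \<le> t * norm \<xi> powr (2 * s)" using that by auto
        then have "- (t * (norm \<xi>)\<^sup>2) - t * norm \<xi> powr (2 * s) \<le> 0" by linarith
        then show ?thesis by (simp only: abs_exp_cancel exp_le_one_iff)
      qed
    qed (auto simp: E_def)
    also have "\<dots> = (LINT t|lborel. J \<epsilon> t)"
    proof (intro Bochner_Integration.integral_cong refl)
      fix t
      have "exp (- (\<epsilon> * r)) * exp (- (t * r) - q) = exp (- ((\<epsilon> + t) * r)) * exp (- q)" for r q
        by (simp add: exp_add[symmetric] algebra_simps)
      then show "of_real (E t) * (LINT \<xi>|lborel. of_real (exp (- (\<epsilon> * (norm \<xi>)\<^sup>2)) * exp (- (t * (norm \<xi>)\<^sup>2) - t * norm \<xi> powr (2 * s))) * echar x \<xi>) = J \<epsilon> t"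
        by (simp only: E_def J_def regular_heat_def)
    qed
    finally have 1: "(LINT \<xi>|lborel. of_real (exp (- (\<epsilon> * (norm \<xi>)\<^sup>2)) * m \<xi>) * echar x \<xi>) = (LINT t|lborel. J \<epsilon> t)" .
    have "(LINT \<xi>|lborel. of_real (exp (- (\<epsilon> * (norm \<xi>)\<^sup>2)) * m \<xi>) * echar x \<xi>) =
      (LINT t|lborel. of_real (P t) * (LINT \<xi>|lborel. of_real (exp (- (\<epsilon> * (norm \<xi>)\<^sup>2)) * exp (- (t * (norm \<xi>)\<^sup>2))) * echar x \<xi>))"
    proof (rule mixture_fubini[OF P _ _ _ \<epsilon>])
      show "\<xi> \<noteq> 0 \<Longrightarrow> m \<xi> = (LINT t|lborel. P t * exp (- (t * (norm \<xi>)\<^sup>2)))" for \<xi> :: 'a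
        using subord_laplace_integral[OF s, of 1 1 \<xi>] by (simp add: m_def P_def p_def)
    qed (auto simp: P_def)
    also have "\<dots> = (LINT t|lborel. of_real (P t * gauss_kernel (\<epsilon> + t) x))"
    proof (intro Bochner_Integration.integral_cong refl)
      fix t
      have "exp (- (\<epsilon> * r)) * exp (- (t * r)) = exp (- ((\<epsilon> + t) * r))" for r
        by (simp add: exp_add[symmetric] algebra_simps)
      then show "of_real (P t) * (LINT \<xi>|lborel. of_real (exp (- (\<epsilon> * (norm \<xi>)\<^sup>2)) * exp (- (t * (norm \<xi>)\<^sup>2))) * echar x \<xi>) = of_real (P t * gauss_kernel (\<epsilon> + t) x)"
        using \<epsilon> by (cases "0 < t") (simp_all add: fourier_gaussian P_def)
    qed
    finally show ?thesis using 1 by simp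
  qed
  define e where "e j = 1 / real (Suc j)" for j
  have e0: "0 < e j" for j by (simp add: e_def)
  have e: "e \<longlonglongrightarrow> 0" unfolding e_def by (rule LIMSEQ_Suc[OF lim_1_over_n])
  have "(\<lambda>j. LINT t|lborel. J (e j) t) \<longlonglongrightarrow> (LINT t|lborel. J 0 t)"
  proof (rule integral_dominated_convergence[OF _ _ \<beta>1])
    show "AE t in lborel. norm (J (e j) t) \<le> indicator {0<..} t * (exp (- t) * \<beta> t)" for j
      using J_bound[of "e j"] e0[of j] by simp
    show "AE t in lborel. (\<lambda>j. J (e j) t) \<longlonglongrightarrow> J 0 t"
    proof (rule AE_I2)
      fix t :: real
      show "(\<lambda>j. J (e j) t) \<longlonglongrightarrow> J 0 t"
      proof (cases "0 < t")
        case True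
        have "(\<lambda>j. regular_heat s (e j + t) t x) \<longlonglongrightarrow> regular_heat s (0 + t) t x"
          unfolding regular_heat_def
        proof (rule integral_dominated_convergence[OF _ _ integrable_gaussian[OF True]])
          show "AE \<xi> in lborel. (\<lambda>j. complex_of_real (exp (- ((e j + t) * (norm \<xi>)\<^sup>2)) * exp (- (t * norm \<xi> powr (2 * s)))) * echar x \<xi>)
              \<longlonglongrightarrow> complex_of_real (exp (- ((0 + t) * (norm \<xi>)\<^sup>2)) * exp (- (t * norm \<xi> powr (2 * s)))) * echar x \<xi>"
            by (intro AE_I2 tendsto_intros e)
          show "AE \<xi> in lborel. norm (complex_of_real (exp (- ((e j + t) * (norm \<xi>)\<^sup>2)) * exp (- (t * norm \<xi> powr (2 * s)))) * echar x \<xi>) \<le> exp (- (t * (norm \<xi>)\<^sup>2))" for j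
          proof (rule AE_I2)
            fix \<xi> :: 'a
            have "exp (- ((e j + t) * (norm \<xi>)\<^sup>2)) * exp (- (t * norm \<xi> powr (2 * s))) \<le> exp (- (t * (norm \<xi>)\<^sup>2)) * 1"
              using True e0[of j] by (intro mult_mono) (auto simp: distrib_right)
            then show "norm (complex_of_real (exp (- ((e j + t) * (norm \<xi>)\<^sup>2)) * exp (- (t * norm \<xi> powr (2 * s)))) * echar x \<xi>) \<le> exp (- (t * (norm \<xi>)\<^sup>2))"
              by (simp add: norm_mult)
          qed
        qed measurable
        then show ?thesis unfolding J_def by (intro tendsto_mult tendsto_const)
      qed (simp add: J_def)
    qed
  qed measurable
  moreover have "(\<lambda>j. LINT t|lborel. of_real (P t * gauss_kernel (e j + t) x) :: complex) \<longlonglongrightarrow> (LINT t|lborel. of_real (P t * gauss_kernel t x))"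
  proof (rule integral_dominated_convergence[OF _ _ \<beta>2])
    show "AE t in lborel. (\<lambda>j. complex_of_real (P t * gauss_kernel (e j + t) x)) \<longlonglongrightarrow> of_real (P t * gauss_kernel t x)"
    proof (rule AE_I2)
      fix t :: real
      show "(\<lambda>j. complex_of_real (P t * gauss_kernel (e j + t) x)) \<longlonglongrightarrow> of_real (P t * gauss_kernel t x)"
      proof (cases "0 < t")
        case True
        have "(\<lambda>j. gauss_kernel (e j + t) x) \<longlonglongrightarrow> gauss_kernel (0 + t) x"
          unfolding gauss_kernel_def using True by (intro tendsto_intros e) auto
        then show ?thesis by (intro tendsto_intros) simp
      qed (simp add: P_def)
    qed
    show "AE t in lborel. norm (complex_of_real (P t * gauss_kernel (e j + t) x)) \<le> indicator {0<..} t * (subord_density 1 1 s t * \<beta> t)" for j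
      using e0[of j] p0 \<beta>
      by (intro AE_I2) (auto simp: P_def p_def[symmetric] abs_mult norm_mult intro!: mult_left_mono split: split_indicator)
  qed (auto simp: P_def)
  ultimately have "(LINT t|lborel. J 0 t) = (LINT t|lborel. of_real (P t * gauss_kernel t x))"
    unfolding eq[OF e0] by (rule LIMSEQ_unique)
  also have "\<dots> = of_real (subord_kernel s x)"
    unfolding integral_complex_of_real subord_kernel_def by (simp add: P_def p_def mult.assoc)
  finally have "(LINT t|lborel. J 0 t) = of_real (subord_kernel s x)" .
  moreover have "complex_kernel s x = (LINT t|lborel. J 0 t)"
    unfolding complex_kernel_def set_lebesgue_integral_def ki by (rule integral_completion) measurable
  ultimately show "complex_kernel s x = of_real (subord_kernel s x)" by simp
qed

lemma kernel_representation_dom: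
  fixes x :: "'a::euclidean_space"
  assumes x: "x \<in> kernel_dom"
  shows "set_integrable lebesgue {0<..} (kernel_integrand s x)" (is ?A)
    and "complex_kernel s x = of_real (subord_kernel s x)" (is ?B)
    and "integrable lborel (\<lambda>t. indicator {0<..} t * (subord_density 1 1 s t * gauss_kernel t x))" (is ?C)
proof -
  have pint: "integrable lborel (\<lambda>t. indicator {0<..} t * subord_density 1 1 s t)"
    using s by (intro integrable_subord_density_indicator) auto
  have "?A \<and> ?B \<and> ?C"
  proof (cases "x = 0")
    case False
    define c where "c = (DIM('a) / 2 / pi) powr (DIM('a) / 2) * norm x powr (- real DIM('a))"
    have c: "0 < t \<Longrightarrow> t \<le> t' \<Longrightarrow> gauss_kernel t' x \<le> c" for t t'
      unfolding c_def using False by (intro gauss_kernel_le) auto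
    have i1: "integrable lborel (\<lambda>t. indicator {0<..} t * (exp (- t) * c))"
      using integrable_mult_left[OF integrable_exp_neg_Ioi, of c] by (simp add: mult.assoc)
    have i2: "integrable lborel (\<lambda>t. indicator {0<..} t * (subord_density 1 1 s t * c))"
      using integrable_mult_left[OF pint, of c] by (simp add: mult.assoc)
    show ?thesis using kernel_representation[of x "\<lambda>_. c", OF c i1 i2] by simp
  next
    case True
    then have dim: "DIM('a) = 1" using x by (simp add: kernel_dom_def)
    define \<beta> where "\<beta> t = pi powr (1 / 2) * t powr (- (1 / 2))" for t :: real
    have \<beta>: "gauss_kernel t' x \<le> \<beta> t" if "0 < t" "t \<le> t'" for t t'
    proof -
      have "gauss_kernel t' x = (pi / t') powr (1 / 2)" using True dim by (simp add: gauss_kernel_def)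
      also have "\<dots> \<le> (pi / t) powr (1 / 2)" using that by (intro powr_mono2 divide_left_mono) auto
      also have "\<dots> = \<beta> t" using that by (simp only: \<beta>_def powr_divide powr_minus_divide times_divide_eq_right mult_1_right)
      finally show ?thesis .
    qed
    have i1: "integrable lborel (\<lambda>t. indicator {0<..} t * (exp (- t) * \<beta> t))"
    proof -
      have "integrable lborel (\<lambda>t::real. indicator {0<..} t * (exp (- t) * t powr (- (1/2))))"
        by (rule integrable_powr_mult_bounded[where M=1]) (use integrable_exp_neg_Ioi in auto)
      from integrable_mult_left[OF this, of "pi powr (1 / 2)"] show ?thesis
        unfolding \<beta>_def by (rule back_subst[where P="integrable lborel"]) (simp add: fun_eq_iff)
    qed
    have i2: "integrable lborel (\<lambda>t. indicator {0<..} t * (subord_density 1 1 s t * \<beta> t))"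
    proof -
      have "integrable lborel (\<lambda>t. indicator {0<..} t * (subord_density 1 1 s t * t powr (- (1/2))))"
      proof (rule integrable_powr_mult_bounded[where M=1])
        show "0 < t \<Longrightarrow> \<bar>subord_density 1 1 s t\<bar> \<le> 1" for t
          using subord_density_le_1[OF s, of t] subord_density_pos[of 1 1 s t] s by simp
      qed (use pint in auto)
      from integrable_mult_left[OF this, of "pi powr (1 / 2)"] show ?thesis
        unfolding \<beta>_def by (rule back_subst[where P="integrable lborel"]) (simp add: fun_eq_iff)
    qed
    have "\<beta> \<in> borel_measurable borel" unfolding \<beta>_def by measurable
    then show ?thesis using kernel_representation[of x \<beta>, OF \<beta> i1 i2] by simp
  qed
  then show ?A ?B ?C by auto
qed

lemma mixed_kernel_eq: "x \<in> kernel_dom \<Longrightarrow> mixed_kernel s x = subord_kernel s x"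
  by (simp add: mixed_kernel_def kernel_representation_dom)

end

subsection \<open>Regularity of the kernel\<close>

text \<open>Dominated convergence for difference quotients along sequences; the mean value
  inequality bounds each quotient by \<open>g\<close>.\<close>

lemma DERIV_under_integral:
  fixes f f' :: "real \<Rightarrow> 'b \<Rightarrow> real"
  assumes e: "0 < e"
    and der: "\<And>y t. \<bar>y - x\<bar> < e \<Longrightarrow> ((\<lambda>y. f y t) has_real_derivative f' y t) (at y)"
    and int: "\<And>y. \<bar>y - x\<bar> < e \<Longrightarrow> integrable M (f y)"
    and g: "integrable M g" and bound: "\<And>y t. \<bar>y - x\<bar> < e \<Longrightarrow> \<bar>f' y t\<bar> \<le> g t"
    and f'm: "f' x \<in> borel_measurable M"
  shows "((\<lambda>y. LINT t|M. f y t) has_real_derivative (LINT t|M. f' x t)) (at x)"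
proof -
  have "((\<lambda>y. ((LINT t|M. f y t) - (LINT t|M. f x t)) / (y - x)) \<longlongrightarrow> (LINT t|M. f' x t)) (at x)"
    unfolding tendsto_at_iff_sequentially
  proof (intro allI impI)
    fix X :: "nat \<Rightarrow> real" assume X0: "\<forall>i. X i \<in> UNIV - {x}" and X: "X \<longlonglongrightarrow> x"
    have "\<forall>\<^sub>F i in sequentially. dist (X i) x < e" using X e by (rule tendstoD)
    then obtain N where N: "\<And>i. N \<le> i \<Longrightarrow> \<bar>X i - x\<bar> < e" by (auto simp: eventually_sequentially dist_real_def)
    define Y where "Y i = X (i + N)" for i
    have Y: "Y \<longlonglongrightarrow> x" "\<And>i. \<bar>Y i - x\<bar> < e" "\<And>i. Y i \<noteq> x"
      using LIMSEQ_ignore_initial_segment[OF X, of N] N X0 by (auto simp: Y_def[abs_def])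
    have x0: "\<bar>x - x\<bar> < e" using e by simp
    have "(\<lambda>i. LINT t|M. (f (Y i) t - f x t) / (Y i - x)) \<longlonglongrightarrow> (LINT t|M. f' x t)"
    proof (rule integral_dominated_convergence[OF f'm _ g])
      show "(\<lambda>t. (f (Y i) t - f x t) / (Y i - x)) \<in> borel_measurable M" for i
        using int[OF Y(2)[of i]] int[OF x0] by auto
      show "AE t in M. (\<lambda>i. (f (Y i) t - f x t) / (Y i - x)) \<longlonglongrightarrow> f' x t"
      proof (rule AE_I2)
        fix t
        have "((\<lambda>y. (f y t - f x t) / (y - x)) \<longlongrightarrow> f' x t) (at x)"
          using der[OF x0, of t] by (simp add: has_field_derivative_iff)
        then show "(\<lambda>i. (f (Y i) t - f x t) / (Y i - x)) \<longlonglongrightarrow> f' x t"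
          unfolding tendsto_at_iff_sequentially using Y by (auto simp: o_def)
      qed
      show "AE t in M. norm ((f (Y i) t - f x t) / (Y i - x)) \<le> g t" for i
      proof (rule AE_I2)
        fix t
        have "norm (f (Y i) t - f x t) \<le> g t * norm (Y i - x)"
        proof (rule field_differentiable_bound[where S="ball x e" and f'="\<lambda>y. f' y t"])
          fix z assume "z \<in> ball x e"
          then have z: "\<bar>z - x\<bar> < e" by (simp add: dist_real_def abs_minus_commute)
          show "((\<lambda>y. f y t) has_real_derivative f' z t) (at z within ball x e)"
            using der[OF z] by (rule DERIV_subset) simp
          show "norm (f' z t) \<le> g t" using bound[OF z] by simp
        qed (use Y(2)[of i] e in \<open>auto simp: dist_real_def abs_minus_commute\<close>)
        then show "norm ((f (Y i) t - f x t) / (Y i - x)) \<le> g t"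
          using Y(3)[of i] by (simp add: divide_le_eq)
      qed
    qed
    moreover have "(LINT t|M. (f (Y i) t - f x t) / (Y i - x)) = ((LINT t|M. f (Y i) t) - (LINT t|M. f x t)) / (Y i - x)" for i
      using int[OF Y(2)[of i]] int[OF x0] by simp
    ultimately have "(\<lambda>i. ((LINT t|M. f (X (i + N)) t) - (LINT t|M. f x t)) / (X (i + N) - x)) \<longlonglongrightarrow> (LINT t|M. f' x t)"
      by (simp only: Y_def)
    then show "((\<lambda>y. ((LINT t|M. f y t) - (LINT t|M. f x t)) / (y - x)) \<circ> X) \<longlonglongrightarrow> (LINT t|M. f' x t)"
      unfolding o_def by (rule LIMSEQ_offset)
  qed
  then show ?thesis by (simp add: has_field_derivative_iff)
qed

lemma inverse_gamma_integrable:
  fixes \<beta> :: real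
  assumes \<beta>: "0 < \<beta>"
  shows "integrable lborel (\<lambda>t. indicator {0<..} t * (t powr (- \<beta> - 1) * exp (- (1 / t))))"
proof (rule Bochner_Integration.integrable_bound)
  let ?M = "(\<beta> + 1) powr (\<beta> + 1)"
  show "integrable lborel (\<lambda>t::real. ?M * (indicator {0<..1} t * t powr 0) + indicator {1<..} t * t powr (- \<beta> - 1))"
    by (intro Bochner_Integration.integrable_add integrable_mult_right integrable_powr_near_0 integrable_powr_near_infinity) (use \<beta> in auto)
  show "AE t in lborel. norm (indicator {0<..} t * (t powr (- \<beta> - 1) * exp (- (1 / t))))
     \<le> norm (?M * (indicator {0<..1} t * t powr 0) + indicator {1<..} t * t powr (- \<beta> - 1))"
  proof (rule AE_I2)
    fix t :: real
    consider "t \<le> 0" | "0 < t" "t \<le> 1" | "1 < t" by linarith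
    then show "norm (indicator {0<..} t * (t powr (- \<beta> - 1) * exp (- (1 / t))))
     \<le> norm (?M * (indicator {0<..1} t * t powr 0) + indicator {1<..} t * t powr (- \<beta> - 1))"
    proof cases
      case 2
      have "(1 / t) powr (\<beta> + 1) = t powr (- (\<beta> + 1))"
        using 2 by (simp only: powr_divide powr_minus_divide) simp
      then have "t powr (- \<beta> - 1) = (1 / t) powr (\<beta> + 1)" by simp
      then have "t powr (- \<beta> - 1) * exp (- (1 / t)) \<le> ?M"
        using powr_times_exp_minus_le[of "\<beta> + 1" "1 / t"] 2 \<beta> by simp
      then show ?thesis using 2 by simp
    qed (auto simp: mult_left_le)
  qed
qed measurable

text \<open>For positive \<open>\<beta>\<close> this is Gamma \<beta>, by the substitution of 1 / t
  for t.\<close>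

definition inverse_gamma_const :: "real \<Rightarrow> real" where
  "inverse_gamma_const \<beta> = (LINT t|lborel. indicator {0<..} t * (t powr (- \<beta> - 1) * exp (- (1 / t))))"

lemma inverse_gamma_const_nonneg: "0 \<le> inverse_gamma_const \<beta>"
  unfolding inverse_gamma_const_def by (rule Bochner_Integration.integral_nonneg) (auto split: split_indicator)

text \<open>Scaling of t by \<open>\<rho>\<close>. With \<open>\<rho>\<close> a multiple of |x|^2
  this is where the powers of |x| in the upper bounds originate.\<close>

lemma inverse_gamma_scaled:
  fixes \<beta> \<rho> :: real
  assumes \<beta>: "0 < \<beta>" and \<rho>: "0 < \<rho>"
  shows "integrable lborel (\<lambda>t. indicator {0<..} t * (t powr (- \<beta> - 1) * exp (- (\<rho> / t))))" (is ?I)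
    and "(LINT t|lborel. indicator {0<..} t * (t powr (- \<beta> - 1) * exp (- (\<rho> / t)))) = inverse_gamma_const \<beta> * \<rho> powr (- \<beta>)" (is ?E)
proof -
  define f where "f t = indicator {0<..} t * (t powr (- \<beta> - 1) * exp (- (1 / t)))" for t :: real
  have f: "integrable lborel f" unfolding f_def by (rule inverse_gamma_integrable[OF \<beta>])
  have sc: "indicator {0<..} t * (t powr (- \<beta> - 1) * exp (- (\<rho> / t))) = \<rho> powr (- \<beta> - 1) * f (0 + 1 / \<rho> * t)" for t
  proof (cases "0 < t")
    case True
    have "\<rho> powr (- \<beta> - 1) * (t / \<rho>) powr (- \<beta> - 1) = t powr (- \<beta> - 1)"
      using True \<rho> by (simp add: powr_mult[symmetric])
    then show ?thesis using True \<rho> by (simp add: f_def)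
  next
    case False
    then have "\<not> 0 < t / \<rho>" using \<rho> by (simp add: zero_less_divide_iff)
    then show ?thesis using False by (simp add: f_def)
  qed
  have "integrable lborel (\<lambda>t. f (0 + 1 / \<rho> * t))"
    by (rule lborel_integrable_real_affine[OF f]) (use \<rho> in simp)
  then show ?I unfolding sc by (rule integrable_mult_right)
  have "(LINT t|lborel. f t) = (1 / \<rho>) * (LINT t|lborel. f (0 + 1 / \<rho> * t))"
    using lborel_integral_real_affine[of "1 / \<rho>" f 0] \<rho> by simp
  then have "(LINT t|lborel. f (0 + 1 / \<rho> * t)) = \<rho> * inverse_gamma_const \<beta>"
    using \<rho> by (simp add: inverse_gamma_const_def f_def field_simps)
  moreover have "\<rho> powr (- \<beta> - 1) * \<rho> = \<rho> powr (- \<beta>)"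
    using \<rho> powr_add[of \<rho> "- \<beta> - 1" 1] by simp
  ultimately show ?E unfolding sc integral_mult_right_zero by (simp add: mult_ac)
qed

text \<open>Derivatives on an open set are local, so regularity can be shown for a convenient
  representative that agrees with the kernel off the origin.\<close>

lemma Ck_on_cong:
  assumes "open S" "\<And>x. x \<in> S \<Longrightarrow> f x = g x"
  shows "Ck_on k f S \<longleftrightarrow> Ck_on k g S"
  using assms(2)
proof (induction k arbitrary: f g)
  case 0
  then show ?case by (simp cong: continuous_on_cong)
next
  case (Suc k)
  have der: "(f has_derivative D) (at x) \<longleftrightarrow> (g has_derivative D) (at x)" if "x \<in> S" for x D
    using that Suc.prems assms(1) has_derivative_transform_within_open[of f D x UNIV S g]
      has_derivative_transform_within_open[of g D x UNIV S f] by auto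
  then have fd: "frechet_derivative f (at x) v = frechet_derivative g (at x) v" if "x \<in> S" for x v
    using that by (simp add: frechet_derivative_def)
  have dd: "f differentiable (at x) \<longleftrightarrow> g differentiable (at x)" if "x \<in> S" for x
    using der[OF that] by (simp add: differentiable_def)
  show ?case unfolding Ck_on.simps using dd Suc.IH[OF fd] by auto
qed

section \<open>Moments of the density, smoothness and derivative bounds\<close>

context
  fixes s :: real
begin

text \<open>\<open>\<rho>\<close> stands for |x|^2. The kernel is a constant times the moment with
  \<open>\<alpha>\<close> = n / 2, and differentiation in \<open>\<rho>\<close> stays within the
  family, raising \<open>\<alpha>\<close> by 1.\<close>

definition moment_integrand :: "real \<Rightarrow> real \<Rightarrow> real \<Rightarrow> real" where
  "moment_integrand \<alpha> \<rho> t = indicator {0<..} t * (t powr (- \<alpha>) * exp (- (pi\<^sup>2 * \<rho> / t)) * subord_density 1 1 s t)"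

definition subord_moment :: "real \<Rightarrow> real \<Rightarrow> real" where
  "subord_moment \<alpha> \<rho> = (LINT t|lborel. moment_integrand \<alpha> \<rho> t)"

lemma measurable_moment_integrand[measurable]: "moment_integrand \<alpha> \<rho> \<in> borel_measurable borel"
  unfolding moment_integrand_def[abs_def] by measurable

text \<open>This class contains the kernel and is closed under directional derivatives on \<open>UNIV - {0}\<close>.\<close>

inductive moment_class :: "('a::euclidean_space \<Rightarrow> real) \<Rightarrow> bool" where
  moment: "0 < \<alpha> \<Longrightarrow> moment_class (\<lambda>x. subord_moment \<alpha> (x \<bullet> x))"
| add: "moment_class f \<Longrightarrow> moment_class g \<Longrightarrow> moment_class (\<lambda>x. f x + g x)"
| scale: "moment_class f \<Longrightarrow> moment_class (\<lambda>x. c * f x)"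
| inner: "moment_class f \<Longrightarrow> moment_class (\<lambda>x. (x \<bullet> v) * f x)"

context
  assumes s: "0 < s" "s < 1"
begin

lemma subord_density_1_nonneg: "0 < t \<Longrightarrow> 0 \<le> subord_density 1 1 s t"
  using subord_density_pos[of 1 1 s t] s by simp

lemma integrable_subord_density_1: "integrable lborel (\<lambda>t. indicator {0<..} t * subord_density 1 1 s t)"
  using s by (intro integrable_subord_density_indicator) auto

lemma moment_integrand_nonneg: "0 \<le> moment_integrand \<alpha> \<rho> t"
  using subord_density_1_nonneg[of t] by (auto simp: moment_integrand_def split: split_indicator)

text \<open>For q > 0 the function t powr (- \<alpha>) * exp (- q / t) is bounded, so a multiple of
  the density is a majorant.\<close>

lemma moment_integrable:
  assumes \<alpha>: "0 < \<alpha>" and \<rho>: "0 < \<rho>"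
  shows "integrable lborel (moment_integrand \<alpha> \<rho>)"
proof (rule Bochner_Integration.integrable_bound[OF integrable_mult_right[OF integrable_subord_density_1]])
  let ?c = "\<alpha> powr \<alpha> * (pi\<^sup>2 * \<rho>) powr (- \<alpha>)"
  show "AE t in lborel. norm (moment_integrand \<alpha> \<rho> t) \<le> norm (?c * (indicator {0<..} t * subord_density 1 1 s t))"
  proof (rule AE_I2)
    fix t :: real
    show "norm (moment_integrand \<alpha> \<rho> t) \<le> norm (?c * (indicator {0<..} t * subord_density 1 1 s t))"
    proof (cases "0 < t")
      case True
      define q where "q = pi\<^sup>2 * \<rho>"
      have q: "0 < q" using \<rho> by (simp add: q_def)
      have "t powr (- \<alpha>) = q powr (- \<alpha>) * (q / t) powr \<alpha>"
        using q True by (simp add: powr_divide powr_minus_divide)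
      then have "t powr (- \<alpha>) * exp (- (q / t)) = q powr (- \<alpha>) * ((q / t) powr \<alpha> * exp (- (q / t)))" by simp
      also have "\<dots> \<le> q powr (- \<alpha>) * \<alpha> powr \<alpha>"
        using q True \<alpha> by (intro mult_left_mono powr_times_exp_minus_le) auto
      finally have "t powr (- \<alpha>) * exp (- (q / t)) \<le> \<alpha> powr \<alpha> * q powr (- \<alpha>)" by (simp add: mult.commute)
      from mult_right_mono[OF this subord_density_1_nonneg[OF True]]
      show ?thesis using True subord_density_1_nonneg[OF True]
        by (simp add: moment_integrand_def q_def[symmetric] abs_mult)
    qed (simp add: moment_integrand_def)
  qed
qed simp

lemma subord_moment_nonneg: "0 \<le> subord_moment \<alpha> \<rho>"
  unfolding subord_moment_def by (rule Bochner_Integration.integral_nonneg) (rule moment_integrand_nonneg)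

text \<open>The integrands decrease in \<open>\<rho>\<close>, so on the neighbourhood of radius
  \<rho> / 2 the derivative is dominated in modulus by its value at \<rho> / 2.\<close>

lemma subord_moment_deriv:
  assumes \<alpha>: "0 < \<alpha>" and \<rho>: "0 < \<rho>"
  shows "(subord_moment \<alpha> has_real_derivative - (pi\<^sup>2 * subord_moment (\<alpha> + 1) \<rho>)) (at \<rho>)"
proof -
  have "((\<lambda>y. LINT t|lborel. moment_integrand \<alpha> y t) has_real_derivative (LINT t|lborel. - pi\<^sup>2 * moment_integrand (\<alpha> + 1) \<rho> t)) (at \<rho>)"
  proof (rule DERIV_under_integral[where e="\<rho> / 2" and g="\<lambda>t. pi\<^sup>2 * moment_integrand (\<alpha> + 1) (\<rho> / 2) t" and f'="\<lambda>y t. - pi\<^sup>2 * moment_integrand (\<alpha> + 1) y t"])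
    fix y t :: real
    show "((\<lambda>y. moment_integrand \<alpha> y t) has_real_derivative - pi\<^sup>2 * moment_integrand (\<alpha> + 1) y t) (at y)"
    proof (cases "0 < t")
      case True
      have t1: "t powr (- \<alpha>) / t = t powr (- (\<alpha> + 1))"
        using True powr_diff[of t "- \<alpha>" 1] by simp
      have t2: "t powr (- (\<alpha> + 1)) = t powr (- \<alpha>) / t" by (rule t1[symmetric])
      have "((\<lambda>y. t powr (- \<alpha>) * exp (- (pi\<^sup>2 * y / t)) * subord_density 1 1 s t) has_real_derivative
         - pi\<^sup>2 * (t powr (- (\<alpha> + 1)) * exp (- (pi\<^sup>2 * y / t)) * subord_density 1 1 s t)) (at y)"
        unfolding t2 using True by (auto intro!: derivative_eq_intros)
      then show ?thesis using True by (simp add: moment_integrand_def)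
    qed (simp add: moment_integrand_def)
    assume y: "\<bar>y - \<rho>\<bar> < \<rho> / 2"
    then have y2: "\<rho> / 2 \<le> y" "0 < y" using \<rho> by (auto simp: abs_if split: if_splits)
    show "integrable lborel (moment_integrand \<alpha> y)" by (rule moment_integrable[OF \<alpha> y2(2)])
    have "moment_integrand (\<alpha> + 1) y t \<le> moment_integrand (\<alpha> + 1) (\<rho> / 2) t"
    proof (cases "0 < t")
      case True
      have "pi\<^sup>2 * (\<rho> / 2) / t \<le> pi\<^sup>2 * y / t"
        using y2 True by (intro divide_right_mono mult_left_mono) auto
      then show ?thesis using True subord_density_1_nonneg[OF True]
        unfolding moment_integrand_def by (intro mult_left_mono mult_right_mono) auto
    qed (simp add: moment_integrand_def)
    then show "\<bar>- pi\<^sup>2 * moment_integrand (\<alpha> + 1) y t\<bar> \<le> pi\<^sup>2 * moment_integrand (\<alpha> + 1) (\<rho> / 2) t"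
      using moment_integrand_nonneg[of "\<alpha> + 1" y t] by (simp add: abs_mult)
  qed (use \<rho> \<alpha> in \<open>auto intro!: moment_integrable\<close>)
  then show ?thesis by (simp add: subord_moment_def[abs_def])
qed

text \<open>The decay t powr (- 1 - s) of the density bounds the moment by an inverse gamma integral
  with exponent \<open>\<alpha> + s\<close>.\<close>

lemma subord_moment_upper:
  assumes \<alpha>: "0 < \<alpha>"
  obtains C where "0 < C" "\<And>\<rho>. 0 < \<rho> \<Longrightarrow> subord_moment \<alpha> \<rho> \<le> C * \<rho> powr (- \<alpha> - s)"
proof -
  obtain C where C: "0 < C" "\<And>t. 0 < t \<Longrightarrow> subord_density 1 1 s t \<le> C * t powr (- 1 - s)"
    using subord_density_upper[OF s] by blast
  \<comment> \<open>The summand 1 makes the constant positive, given that the gamma integral is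
    nonnegative.\<close>
  define D where "D = C * inverse_gamma_const (\<alpha> + s) * (pi\<^sup>2) powr (- (\<alpha> + s)) + 1"
  have D0: "0 < D" using C inverse_gamma_const_nonneg by (auto simp: D_def intro!: add_nonneg_pos mult_nonneg_nonneg)
  have "subord_moment \<alpha> \<rho> \<le> D * \<rho> powr (- \<alpha> - s)" if \<rho>: "0 < \<rho>" for \<rho>
  proof -
    define g where "g t = indicator {0<..} t * (t powr (- (\<alpha> + s) - 1) * exp (- (pi\<^sup>2 * \<rho> / t)))" for t :: real
    have q: "0 < \<alpha> + s" "0 < pi\<^sup>2 * \<rho>" using \<alpha> s \<rho> by auto
    have "subord_moment \<alpha> \<rho> \<le> (LINT t|lborel. C * g t)"
      unfolding subord_moment_def
    proof (rule integral_mono)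
      show "integrable lborel (\<lambda>t. C * g t)"
        unfolding g_def by (intro integrable_mult_right inverse_gamma_scaled(1) q)
      fix t :: real
      show "moment_integrand \<alpha> \<rho> t \<le> C * g t"
      proof (cases "0 < t")
        case True
        have e: "t powr (- (\<alpha> + s) - 1) = t powr (- \<alpha>) * t powr (- 1 - s)"
        proof -
          have "- (\<alpha> + s) - 1 = - \<alpha> + (- 1 - s)" by simp
          then show ?thesis by (simp only: powr_add)
        qed
        show ?thesis using True mult_left_mono[OF C(2)[OF True], of "t powr (- \<alpha>) * exp (- (pi\<^sup>2 * \<rho> / t))"]
          unfolding g_def e by (simp add: moment_integrand_def mult_ac)
      qed (simp add: moment_integrand_def g_def)
    qed (rule moment_integrable[OF \<alpha> \<rho>])
    also have "\<dots> = C * (inverse_gamma_const (\<alpha> + s) * (pi\<^sup>2 * \<rho>) powr (- (\<alpha> + s)))"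
      unfolding integral_mult_right_zero g_def inverse_gamma_scaled(2)[OF q] ..
    also have "\<dots> = (C * inverse_gamma_const (\<alpha> + s) * (pi\<^sup>2) powr (- (\<alpha> + s))) * \<rho> powr (- \<alpha> - s)"
      using \<rho> by (simp add: powr_mult)
    also have "\<dots> \<le> D * \<rho> powr (- \<alpha> - s)"
      by (intro mult_right_mono) (auto simp: D_def)
    finally show ?thesis .
  qed
  then show thesis using that D0 by blast
qed

lemma subord_kernel_eq_moment:
  fixes x :: "'a::euclidean_space"
  shows "subord_kernel s x = pi powr (DIM('a) / 2) * subord_moment (DIM('a) / 2) (x \<bullet> x)"
proof -
  have "indicator {0<..} t * (subord_density 1 1 s t * gauss_kernel t x) = pi powr (DIM('a) / 2) * moment_integrand (DIM('a) / 2) (x \<bullet> x) t" for t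
    by (cases "0 < t") (auto simp: moment_integrand_def gauss_kernel_def powr_divide powr_minus_divide power2_norm_eq_inner)
  then show ?thesis unfolding subord_kernel_def subord_moment_def by simp
qed

lemma moment_has_derivative:
  fixes x :: "'a::euclidean_space"
  assumes "0 < \<alpha>" "x \<noteq> 0"
  shows "((\<lambda>x. subord_moment \<alpha> (x \<bullet> x)) has_derivative
     (\<lambda>h. (- (2 * pi\<^sup>2)) * ((x \<bullet> h) * subord_moment (\<alpha> + 1) (x \<bullet> x)))) (at x)"
proof -
  have "0 < x \<bullet> x" using assms by simp
  then have d: "(subord_moment \<alpha> has_derivative (\<lambda>h. - (pi\<^sup>2 * subord_moment (\<alpha> + 1) (x \<bullet> x)) * h)) (at (x \<bullet> x))"
    using subord_moment_deriv[OF assms(1)] by (simp only: has_field_derivative_def)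
  have "((\<lambda>x. x \<bullet> x) has_derivative (\<lambda>h. x \<bullet> h + h \<bullet> x)) (at x)"
    by (intro has_derivative_inner has_derivative_ident)
  from has_derivative_compose[OF this d]
  show ?thesis by (rule has_derivative_eq_rhs) (auto simp: fun_eq_iff inner_commute algebra_simps)
qed

lemma moment_class_derivative:
  assumes "moment_class f"
  shows "\<exists>f'. (\<forall>x. x \<noteq> 0 \<longrightarrow> (f has_derivative f' x) (at x)) \<and> (\<forall>v. moment_class (\<lambda>x. f' x v))"
  using assms
proof induction
  case (moment \<alpha>)
  have "moment_class (\<lambda>x. (- (2 * pi\<^sup>2)) * ((x \<bullet> v) * subord_moment (\<alpha> + 1) (x \<bullet> x)))" for v :: 'a
    using moment by (intro moment_class.intros) auto
  then show ?case using moment_has_derivative[OF moment] by (intro exI conjI allI impI) auto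
next
  case (add f g)
  then obtain f' g' where "\<forall>x. x \<noteq> 0 \<longrightarrow> (f has_derivative f' x) (at x)" "\<forall>v. moment_class (\<lambda>x. f' x v)"
    "\<forall>x. x \<noteq> 0 \<longrightarrow> (g has_derivative g' x) (at x)" "\<forall>v. moment_class (\<lambda>x. g' x v)" by blast
  then show ?case
    by (intro exI[of _ "\<lambda>x h. f' x h + g' x h"]) (auto intro!: has_derivative_add moment_class.intros)
next
  case (scale f c)
  then obtain f' where "\<forall>x. x \<noteq> 0 \<longrightarrow> (f has_derivative f' x) (at x)" "\<forall>v. moment_class (\<lambda>x. f' x v)" by blast
  then show ?case
    by (intro exI[of _ "\<lambda>x h. c * f' x h"]) (auto intro!: has_derivative_mult_right moment_class.intros)
next
  case (inner f v)
  then obtain f' where f': "\<forall>x. x \<noteq> 0 \<longrightarrow> (f has_derivative f' x) (at x)" "\<forall>v. moment_class (\<lambda>x. f' x v)" by blast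
  have "((\<lambda>x. (x \<bullet> v) * f x) has_derivative (\<lambda>h. (x \<bullet> v) * f' x h + (h \<bullet> v) * f x)) (at x)" if "x \<noteq> 0" for x
    using that f' by (intro has_derivative_mult has_derivative_inner_left has_derivative_ident) auto
  moreover have "moment_class (\<lambda>x. (x \<bullet> v) * f' x w + (w \<bullet> v) * f x)" for w
    using f' inner by (intro moment_class.intros) auto
  ultimately show ?case by (intro exI[of _ "\<lambda>x h. (x \<bullet> v) * f' x h + (h \<bullet> v) * f x"]) auto
qed

lemma moment_class_Ck: "moment_class f \<Longrightarrow> Ck_on k f (UNIV - {0})"
proof (induction k arbitrary: f)
  case 0
  obtain f' where "\<And>x. x \<noteq> 0 \<Longrightarrow> (f has_derivative f' x) (at x)"
    using moment_class_derivative[OF 0] by auto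
  then have "\<forall>x\<in>UNIV - {0}. isCont f x" by (metis has_derivative_continuous DiffD2 singletonI)
  then show ?case by (simp add: continuous_at_imp_continuous_on)
next
  case (Suc k)
  obtain f' where f': "\<And>x. x \<noteq> 0 \<Longrightarrow> (f has_derivative f' x) (at x)" "\<And>v. moment_class (\<lambda>x. f' x v)"
    using moment_class_derivative[OF Suc.prems] by auto
  have "Ck_on k (\<lambda>x. frechet_derivative f (at x) v) (UNIV - {0}) \<longleftrightarrow> Ck_on k (\<lambda>x. f' x v) (UNIV - {0})" for v
    by (rule Ck_on_cong) (auto simp: frechet_derivative_at[OF f'(1), symmetric])
  moreover have "f differentiable (at x)" if "x \<noteq> 0" for x
    using f'(1)[OF that] by (auto simp: differentiable_def)
  ultimately show ?case using f' Suc.IH by auto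
qed

lemma smooth_subord_kernel: "smooth_on (subord_kernel s :: 'a::euclidean_space \<Rightarrow> real) (UNIV - {0})"
proof -
  have "moment_class (\<lambda>x::'a. pi powr (DIM('a) / 2) * subord_moment (DIM('a) / 2) (x \<bullet> x))"
    by (intro moment_class.intros) auto
  moreover have "subord_kernel s = (\<lambda>x::'a. pi powr (DIM('a) / 2) * subord_moment (DIM('a) / 2) (x \<bullet> x))"
    by (rule ext) (rule subord_kernel_eq_moment)
  ultimately have "moment_class (subord_kernel s :: 'a \<Rightarrow> real)" by simp
  then show ?thesis by (simp add: smooth_on_def moment_class_Ck)
qed

lemma gradient_eqI: "GDERIV f x :> D \<Longrightarrow> gradient f x = D"
  unfolding gradient_def
proof (rule the_equality)
  fix D' assume "GDERIV f x :> D" "GDERIV f x :> D'"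
  then have "(\<lambda>h. h \<bullet> D) = (\<lambda>h. h \<bullet> D')" unfolding gderiv_def by (rule has_derivative_unique)
  then have "\<forall>h. h \<bullet> D = h \<bullet> D'" by (rule fun_cong[THEN allI])
  then show "D' = D" by (metis vector_eq_ldot)
qed

text \<open>By radial symmetry the gradient is a multiple of m 1 * x, and the Hessian adds to the m
  1 term one with m 2 * (x \<bullet> v) * x, where m k at |x|^2 is at most a constant times |x| powr
  (- n - 2 s - 2 k). Any \<open>K\<close> that agrees with \<open>subord_kernel\<close> off the
  origin is allowed, since derivatives at x \<noteq> 0 do not see the value at 0.\<close>

lemma kernel_derivative_bounds:
  obtains C where "0 < C"
    "\<And>K x::'a::euclidean_space. x \<noteq> 0 \<Longrightarrow> (\<And>y. y \<noteq> 0 \<Longrightarrow> K y = subord_kernel s y) \<Longrightarrow>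
      norm (gradient K x) \<le> C * norm x powr (- (DIM('a) + 2 * s + 1)) \<and>
      onorm (hessian K x) \<le> C * norm x powr (- (DIM('a) + 2 * s + 2))"
proof -
  define n where "n = real DIM('a)"
  define c where "c = pi powr (n / 2)"
  define m where "m k r = subord_moment (n / 2 + k) r" for k r
  have n: "n > 0" by (simp add: n_def)
  have c: "c > 0" by (simp add: c_def)
  obtain C1 where C1: "0 < C1" "\<And>\<rho>. 0 < \<rho> \<Longrightarrow> m 1 \<rho> \<le> C1 * \<rho> powr (- (n / 2 + 1) - s)"
    using subord_moment_upper[of "n / 2 + 1"] n unfolding m_def by auto
  obtain C2 where C2: "0 < C2" "\<And>\<rho>. 0 < \<rho> \<Longrightarrow> m 2 \<rho> \<le> C2 * \<rho> powr (- (n / 2 + 2) - s)"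
    using subord_moment_upper[of "n / 2 + 2"] n unfolding m_def by auto
  have m0: "0 \<le> m k r" for k r by (simp add: m_def subord_moment_nonneg)
  have sq: "(x \<bullet> x) powr a = norm x powr (2 * a)" for x :: 'a and a
    by (simp only: power2_norm_eq_inner[symmetric] norm_sq_powr)
  show ?thesis
  \<comment> \<open>The Hessian takes C1 for its first term and 2 pi^2 C2 for its second; the sum
    covers the gradient as well.\<close>
  proof (rule that[of "2 * pi\<^sup>2 * c * (C1 + 2 * pi\<^sup>2 * C2)"], goal_cases)
    case 1 then show ?case using c C1 C2 by (auto intro!: mult_pos_pos add_pos_pos)
  next
    case (2 K x)
    define S where "S = UNIV - {0::'a}"
    have S: "open S" by (simp add: S_def open_delete)
    have Kd: "(K has_derivative (\<lambda>h. h \<bullet> (- (2 * pi\<^sup>2 * c) * m 1 (y \<bullet> y)) *\<^sub>R y)) (at y)" if y: "y \<noteq> 0" for y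
    proof -
      have "((\<lambda>y. c * m 0 (y \<bullet> y)) has_derivative (\<lambda>h. c * ((- (2 * pi\<^sup>2)) * ((y \<bullet> h) * m 1 (y \<bullet> y))))) (at y)"
        using moment_has_derivative[of "n / 2" y] n y unfolding m_def by (intro has_derivative_mult_right) simp
      then have "((\<lambda>y. c * m 0 (y \<bullet> y)) has_derivative (\<lambda>h. h \<bullet> (- (2 * pi\<^sup>2 * c) * m 1 (y \<bullet> y)) *\<^sub>R y)) (at y)"
        by (rule has_derivative_eq_rhs) (auto simp: inner_commute fun_eq_iff)
      then show ?thesis
        by (rule has_derivative_transform_within_open[OF _ S])
          (use y 2(2) in \<open>auto simp: S_def subord_kernel_eq_moment c_def n_def m_def\<close>)
    qed
    then have grad: "gradient K y = (- (2 * pi\<^sup>2 * c) * m 1 (y \<bullet> y)) *\<^sub>R y" if "y \<noteq> 0" for y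
      using that by (intro gradient_eqI) (simp add: gderiv_def)
    define r where "r = x \<bullet> x"
    have r: "0 < r" using 2 by (simp add: r_def)
    have nx: "norm x powr a * norm x = norm x powr (a + 1)" for a using 2(1) by (simp add: powr_add)
    have m1: "m 1 r \<le> C1 * norm x powr (- n - 2 * s - 2)"
    proof -
      have "2 * (- (n / 2 + 1) - s) = - n - 2 * s - 2" by (simp add: algebra_simps)
      then show ?thesis using C1(2)[OF r] by (simp only: r_def sq)
    qed
    have m2: "m 2 r \<le> C2 * norm x powr (- n - 2 * s - 4)"
    proof -
      have "2 * (- (n / 2 + 2) - s) = - n - 2 * s - 4" by (simp add: algebra_simps)
      then show ?thesis using C2(2)[OF r] by (simp only: r_def sq)
    qed
    have "norm (gradient K x) = 2 * pi\<^sup>2 * c * (m 1 r * norm x)"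
      using 2(1) c m0[of 1 r] by (simp add: grad r_def abs_mult)
    also have "\<dots> \<le> 2 * pi\<^sup>2 * c * (C1 * norm x powr (- n - 2 * s - 2) * norm x)"
      using m1 c by (intro mult_left_mono mult_right_mono) auto
    also have "\<dots> = 2 * pi\<^sup>2 * c * (C1 * norm x powr (- (n + 2 * s + 1)))"
      unfolding mult.assoc[of C1] nx by (simp add: algebra_simps)
    also have "\<dots> \<le> 2 * pi\<^sup>2 * c * ((C1 + 2 * pi\<^sup>2 * C2) * norm x powr (- (n + 2 * s + 1)))"
      using c C2 by (intro mult_left_mono mult_right_mono) auto
    finally have g: "norm (gradient K x) \<le> 2 * pi\<^sup>2 * c * (C1 + 2 * pi\<^sup>2 * C2) * norm x powr (- (n + 2 * s + 1))" by simp
    define H where "H v = (- (2 * pi\<^sup>2 * c)) *\<^sub>R (m 1 r *\<^sub>R v - (2 * pi\<^sup>2 * m 2 r * (x \<bullet> v)) *\<^sub>R x)" for v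
    have "((\<lambda>y. (- (2 * pi\<^sup>2 * c)) *\<^sub>R (m 1 (y \<bullet> y) *\<^sub>R y)) has_derivative
       (\<lambda>h. (- (2 * pi\<^sup>2 * c)) *\<^sub>R (m 1 (x \<bullet> x) *\<^sub>R h + ((- (2 * pi\<^sup>2)) * ((x \<bullet> h) * m 2 (x \<bullet> x))) *\<^sub>R x))) (at x)"
      using moment_has_derivative[of "n / 2 + 1" x] n 2(1) unfolding m_def
      by (intro has_derivative_scaleR_right has_derivative_scaleR has_derivative_ident) (simp add: add.assoc)
    then have "((\<lambda>y. (- (2 * pi\<^sup>2 * c)) *\<^sub>R (m 1 (y \<bullet> y) *\<^sub>R y)) has_derivative H) (at x)"
      by (rule has_derivative_eq_rhs) (auto simp: H_def r_def fun_eq_iff mult_ac)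
    then have "(gradient K has_derivative H) (at x)"
      by (rule has_derivative_transform_within_open[OF _ S]) (use 2(1) in \<open>auto simp: S_def grad\<close>)
    then have hess: "hessian K x = H" unfolding hessian_def by (rule frechet_derivative_at[symmetric])
    have "onorm H \<le> 2 * pi\<^sup>2 * c * (C1 + 2 * pi\<^sup>2 * C2) * norm x powr (- (n + 2 * s + 2))"
    proof (rule onorm_le)
      fix v
      have "norm (m 1 r *\<^sub>R v - (2 * pi\<^sup>2 * m 2 r * (x \<bullet> v)) *\<^sub>R x) \<le> m 1 r * norm v + 2 * pi\<^sup>2 * (m 2 r * (\<bar>x \<bullet> v\<bar> * norm x))"
        using norm_triangle_ineq4[of "m 1 r *\<^sub>R v" "(2 * pi\<^sup>2 * m 2 r * (x \<bullet> v)) *\<^sub>R x"] m0[of 1 r] m0[of 2 r]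
        by (simp add: abs_mult mult_ac)
      also have "\<dots> \<le> (C1 * norm x powr (- n - 2 * s - 2)) * norm v + 2 * pi\<^sup>2 * ((C2 * norm x powr (- n - 2 * s - 4)) * ((norm x * norm v) * norm x))"
        using m1 m2 m0[of 2 r] Cauchy_Schwarz_ineq2[of x v]
        by (intro add_mono mult_right_mono mult_left_mono mult_mono) auto
      also have "\<dots> = (C1 + 2 * pi\<^sup>2 * C2) * norm x powr (- (n + 2 * s + 2)) * norm v"
      proof -
        have "norm x powr (- n - 2 * s - 4) * norm x * norm x = norm x powr (- (n + 2 * s + 2))"
          unfolding nx by (simp add: algebra_simps)
        then have "C2 * norm x powr (- n - 2 * s - 4) * ((norm x * norm v) * norm x) = C2 * norm x powr (- (n + 2 * s + 2)) * norm v"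
          by (simp only: mult_ac)
        moreover have "- n - 2 * s - 2 = - (n + 2 * s + 2)" by simp
        ultimately show ?thesis by (simp only: distrib_right mult.assoc)
      qed
      finally have "norm (m 1 r *\<^sub>R v - (2 * pi\<^sup>2 * m 2 r * (x \<bullet> v)) *\<^sub>R x) \<le> (C1 + 2 * pi\<^sup>2 * C2) * norm x powr (- (n + 2 * s + 2)) * norm v" .
      from mult_left_mono[OF this, of "2 * pi\<^sup>2 * c"] c
      show "norm (H v) \<le> 2 * pi\<^sup>2 * c * (C1 + 2 * pi\<^sup>2 * C2) * norm x powr (- (n + 2 * s + 2)) * norm v"
        by (simp add: H_def mult.assoc)
    qed
    then show ?case using g by (simp add: hess n_def)
  qed
qed

end

end

subsection \<open>Two-sided bounds and integrability\<close>

lemma gauss_kernel_mono_norm: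
  fixes x y :: "'a::euclidean_space"
  shows "0 < t \<Longrightarrow> norm x \<le> norm y \<Longrightarrow> gauss_kernel t y \<le> gauss_kernel t x"
  unfolding gauss_kernel_def
  by (intro mult_left_mono) (auto intro!: divide_right_mono mult_left_mono power_mono)

lemma integrable_lborel_interval_powr:
  fixes c :: real
  assumes "0 \<le> c" "c < 1"
  shows "(\<integral>\<^sup>+y. ennreal (indicator {-1..1} y * \<bar>y\<bar> powr (- c)) \<partial>lborel) < \<infinity>"
proof -
  have i: "integrable lborel (\<lambda>t. indicator {0<..1} t * t powr (- c))"
    by (rule integrable_powr_near_0) (use assms in simp)
  have i': "integrable lborel (\<lambda>t. indicator {0<..1} (0 + (-1) * t) * (0 + (-1) * t) powr (- c))"
    by (rule lborel_integrable_real_affine[OF i]) simp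
  have "indicator {-1..1} y * \<bar>y\<bar> powr (- c) =
      indicator {0<..1} y * y powr (- c) + indicator {0<..1} (0 + (-1) * y) * (0 + (-1) * y) powr (- c)" for y :: real
    by (cases "y = 0") (auto split: split_indicator)
  then have "integrable lborel (\<lambda>y. indicator {-1..1} y * \<bar>y\<bar> powr (- c))"
    using Bochner_Integration.integrable_add[OF i i'] by simp
  then show ?thesis by (subst nn_integral_eq_integral) auto
qed

text \<open>Since \<open>|x| \<ge> |x\<^sub>i|\<close>, the power \<open>|x|\<close>\<open>powr (- b)\<close> is at most the product of the \<open>|x\<^sub>i|\<close>\<open>powr (- b / n)\<close>.\<close>

lemma integrable_norm_powr_ball:
  fixes b :: real
  assumes b: "0 \<le> b" "b < DIM('a)"
  shows "integrable lborel (\<lambda>x::'a::euclidean_space. indicator (cball 0 1) x * norm x powr (- b))"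
proof (rule integrableI_nonneg)
  have [measurable]: "cball (0::'a) 1 \<in> sets borel" by (intro borel_closed closed_cball)
  show "(\<lambda>x::'a. indicator (cball 0 1) x * norm x powr (- b)) \<in> borel_measurable lborel" by measurable
  define c where "c = b / DIM('a)"
  have c: "0 \<le> c" "c < 1" using b by (auto simp: c_def)
  define f where "f y = indicator {-1..1} y * \<bar>y\<bar> powr (- c)" for y :: real
  \<comment> \<open>On a coordinate hyperplane one factor of the product is 0, by the convention 0
    powr a = 0, and the pointwise inequality fails; these hyperplanes are null sets.\<close>
  have AE0: "AE x in lborel. \<forall>i\<in>Basis. (x::'a) \<bullet> i \<noteq> 0"
    by (subst AE_finite_all) (auto intro: AE_lborel_inner_neq)
  have "(\<integral>\<^sup>+x. ennreal (indicator (cball 0 1) x * norm (x::'a) powr (- b)) \<partial>lborel) \<le> (\<integral>\<^sup>+x. (\<Prod>i\<in>Basis. ennreal (f ((x::'a) \<bullet> i))) \<partial>lborel)"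
  proof (rule nn_integral_mono_AE)
    show "AE x in lborel. ennreal (indicator (cball 0 1) x * norm (x::'a) powr (- b)) \<le> (\<Prod>i\<in>Basis. ennreal (f (x \<bullet> i)))"
      using AE0
    proof eventually_elim
      case (elim x)
      have f0: "0 \<le> f y" for y by (simp add: f_def)
      have x0: "norm x \<noteq> 0" using elim nonempty_Basis by auto
      have "indicator (cball 0 1) x * norm x powr (- b) \<le> (\<Prod>i\<in>Basis. f (x \<bullet> i))"
      proof (cases "x \<in> cball 0 1")
        case True
        have "norm x powr (- b) = (\<Prod>i\<in>(Basis::'a set). norm x powr (- c))"
          using x0 by (subst prod_constant, subst powr_power) (auto simp: c_def)
        also have "\<dots> \<le> (\<Prod>i\<in>Basis. f (x \<bullet> i))"
        proof (rule prod_mono, intro conjI)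
          fix i :: 'a assume i: "i \<in> Basis"
          have le: "\<bar>x \<bullet> i\<bar> \<le> norm x" by (rule Basis_le_norm[OF i])
          then have "f (x \<bullet> i) = \<bar>x \<bullet> i\<bar> powr (- c)" using True by (auto simp: f_def abs_le_iff)
          moreover have "norm x powr (- c) \<le> \<bar>x \<bullet> i\<bar> powr (- c)"
            using le elim i c by (intro powr_mono2') auto
          ultimately show "norm x powr (- c) \<le> f (x \<bullet> i)" by simp
        qed simp
        finally show ?thesis using True by simp
      qed (simp add: prod_nonneg f0)
      then show ?case using f0 by (subst prod_ennreal) (auto intro!: ennreal_leI)
    qed
  qed
  also have "\<dots> = (\<Prod>i\<in>(Basis::'a set). \<integral>\<^sup>+y. ennreal (f y) \<partial>lborel)"
    by (rule nn_integral_lborel_prod) (auto simp: f_def)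
  also have "\<dots> < \<infinity>"
    using integrable_lborel_interval_powr[OF c] by (auto simp: f_def less_top[symmetric] power_eq_top_ennreal)
  finally show "(\<integral>\<^sup>+x. ennreal (indicator (cball 0 1) x * norm (x::'a) powr (- b)) \<partial>lborel) < \<infinity>" .
qed (auto intro!: AE_I2)

context
  fixes s :: real
  assumes s: "0 < s" "s < 1"
begin

lemma subord_density_1_pos: "0 < t \<Longrightarrow> 0 < subord_density 1 1 s t"
  using subord_density_pos[of 1 1 s t] s by simp

lemma subord_kernel_nonneg: "0 \<le> subord_kernel s x"
  unfolding subord_kernel_def
  by (rule Bochner_Integration.integral_nonneg) (auto simp: less_imp_le[OF subord_density_1_pos] split: split_indicator)

lemma subord_kernel_pos:
  assumes "x \<in> kernel_dom"
  shows "0 < subord_kernel s x"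
  unfolding subord_kernel_def
  by (rule integral_pos_of_pos_on[where A="{0<..<1}"])
    (use kernel_representation_dom(3)[OF s assms] in \<open>auto simp: subord_density_1_pos gauss_kernel_pos less_imp_le split: split_indicator\<close>)

lemma subord_kernel_antimono:
  fixes x y :: "'a::euclidean_space"
  assumes "x \<in> kernel_dom" "y \<in> kernel_dom" "norm x \<le> norm y"
  shows "subord_kernel s y \<le> subord_kernel s x"
  unfolding subord_kernel_def
  by (rule integral_mono[OF kernel_representation_dom(3)[OF s assms(2)] kernel_representation_dom(3)[OF s assms(1)]])
    (use assms(3) in \<open>auto intro!: mult_left_mono gauss_kernel_mono_norm simp: less_imp_le[OF subord_density_1_pos] split: split_indicator\<close>)

lemma subord_kernel_minus: "subord_kernel s (- x) = subord_kernel s x"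
  unfolding subord_kernel_def by simp

lemma subord_kernel_upper_far:
  obtains C where "0 < C" "\<And>x::'a::euclidean_space. x \<noteq> 0 \<Longrightarrow> subord_kernel s x \<le> C * norm x powr (- (DIM('a) + 2 * s))"
proof -
  obtain C where C: "0 < C" "\<And>\<rho>. 0 < \<rho> \<Longrightarrow> subord_moment s (DIM('a) / 2) \<rho> \<le> C * \<rho> powr (- (DIM('a) / 2) - s)"
    using subord_moment_upper[OF s, of "DIM('a) / 2"] by auto
  show ?thesis
  proof (rule that[of "pi powr (DIM('a) / 2) * C"])
    fix x :: 'a assume x: "x \<noteq> 0"
    have "(x \<bullet> x) powr (- (DIM('a) / 2) - s) = norm x powr (2 * (- (DIM('a) / 2) - s))"
      by (simp only: power2_norm_eq_inner[symmetric] norm_sq_powr)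
    also have "2 * (- (DIM('a) / 2) - s) = - (DIM('a) + 2 * s)" by simp
    finally have e: "(x \<bullet> x) powr (- (DIM('a) / 2) - s) = norm x powr (- (DIM('a) + 2 * s))" .
    have "subord_moment s (DIM('a) / 2) (x \<bullet> x) \<le> C * norm x powr (- (DIM('a) + 2 * s))"
      using C(2)[of "x \<bullet> x"] x unfolding e by simp
    from mult_left_mono[OF this, of "pi powr (DIM('a) / 2)"]
    show "subord_kernel s x \<le> pi powr (DIM('a) / 2) * C * norm x powr (- (DIM('a) + 2 * s))"
      by (simp add: subord_kernel_eq_moment[OF s] mult.assoc)
  qed (use C in simp)
qed

text \<open>Only the times between r^2 and 2 r^2 with r = |x| are kept: there the Gaussian is at
  least d * r powr (- n), and the interval has length r^2. The factor min 1 ((2 r^2) powr (- 1 - s))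
  from the density is bounded below for r \<le> 1 and decays like r powr (- 2 - 2 s) for r \<ge>
  1.\<close>

lemma subord_kernel_lower:
  obtains c where "0 < c"
    "\<And>x::'a::euclidean_space. x \<noteq> 0 \<Longrightarrow> norm x \<le> 1 \<Longrightarrow> c * norm x powr (2 - real DIM('a)) \<le> subord_kernel s x"
    "\<And>x::'a::euclidean_space. 1 \<le> norm x \<Longrightarrow> c * norm x powr (- (DIM('a) + 2 * s)) \<le> subord_kernel s x"
proof -
  define n where "n = real DIM('a)"
  obtain c where c: "0 < c" "\<And>t. 0 < t \<Longrightarrow> c * min 1 (t powr (- 1 - s)) \<le> subord_density 1 1 s t"
    using subord_density_lower[OF s] by blast
  \<comment> \<open>On the time interval (pi / t) powr (n / 2) is smallest at t = 2 r^2 and the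
    exponential at t = r^2, where it equals exp (- pi^2); \<open>d\<close> collects what is left of
    both beside r powr (- n).\<close>
  define d where "d = (pi / 2) powr (n / 2) * exp (- pi\<^sup>2)"
  have d: "0 < d" by (simp add: d_def)
  have n: "n > 0" by (simp add: n_def)
  have main: "c * min 1 ((2 * r\<^sup>2) powr (- 1 - s)) * (d * r powr (2 - n)) \<le> subord_kernel s x"
    if x: "x \<noteq> 0" and r: "r = norm x" for x :: 'a and r
  proof -
    have r0: "0 < r" using x r by simp
    let ?L = "c * min 1 ((2 * r\<^sup>2) powr (- 1 - s)) * (d * r powr (- n))"
    have L: "0 \<le> ?L" using c d by simp
    have "r powr (2 - n) = r\<^sup>2 * r powr (- n)" using r0 powr_add[of r 2 "- n"] by simp
    then have "c * min 1 ((2 * r\<^sup>2) powr (- 1 - s)) * (d * r powr (2 - n)) = (LINT t|lborel. indicator {r\<^sup>2..2 * r\<^sup>2} t * ?L)"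
      using r0 by simp
    also have "\<dots> \<le> subord_kernel s x"
      unfolding subord_kernel_def
    proof (rule integral_mono)
      show "integrable lborel (\<lambda>t. indicator {r\<^sup>2..2 * r\<^sup>2} t * ?L)"
        by (intro integrable_mult_left integrable_real_indicator) (auto simp: emeasure_lborel_Icc_eq)
      show "integrable lborel (\<lambda>t. indicator {0<..} t * (subord_density 1 1 s t * gauss_kernel t x))"
        by (rule kernel_representation_dom(3)[OF s]) (use x in \<open>simp add: kernel_dom_def\<close>)
      fix t :: real
      show "indicator {r\<^sup>2..2 * r\<^sup>2} t * ?L \<le> indicator {0<..} t * (subord_density 1 1 s t * gauss_kernel t x)"
      proof (cases "t \<in> {r\<^sup>2..2 * r\<^sup>2}")
        case True
        then have t: "0 < t" "r\<^sup>2 \<le> t" "t \<le> 2 * r\<^sup>2" using r0 by (auto intro: less_le_trans[of 0 "r\<^sup>2"])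
        have "(2 * r\<^sup>2) powr (- 1 - s) \<le> t powr (- 1 - s)" using t s by (intro powr_mono2') auto
        then have "c * min 1 ((2 * r\<^sup>2) powr (- 1 - s)) \<le> c * min 1 (t powr (- 1 - s))"
          using c by (intro mult_left_mono) auto
        also have "\<dots> \<le> subord_density 1 1 s t" by (rule c(2)[OF t(1)])
        finally have 1: "c * min 1 ((2 * r\<^sup>2) powr (- 1 - s)) \<le> subord_density 1 1 s t" .
        have "(r\<^sup>2) powr (- (n / 2)) = r powr (- n)" using r norm_sq_powr[of x "- (n / 2)"] by simp
        then have "d * r powr (- n) = (pi / (2 * r\<^sup>2)) powr (n / 2) * exp (- pi\<^sup>2)"
          using r0 by (simp add: d_def powr_divide powr_mult powr_minus_divide)
        also have "\<dots> \<le> (pi / t) powr (n / 2) * exp (- (pi\<^sup>2 * r\<^sup>2 / t))"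
          using t r0 n by (intro mult_mono powr_mono2 divide_left_mono) (auto simp: divide_le_eq)
        also have "\<dots> = gauss_kernel t x" by (simp add: gauss_kernel_def n_def r)
        finally have 2: "d * r powr (- n) \<le> gauss_kernel t x" .
        have "?L \<le> subord_density 1 1 s t * gauss_kernel t x"
          using 1 2 d subord_density_1_pos[OF t(1)] by (intro mult_mono) auto
        then show ?thesis using True t by simp
      next
        case False
        then show ?thesis using subord_density_1_pos[of t] by (auto simp: less_imp_le split: split_indicator)
      qed
    qed
    finally show ?thesis .
  qed
  show ?thesis
  proof (rule that[of "c * 2 powr (- 1 - s) * d"])
    fix x :: 'a
    assume x: "x \<noteq> 0" "norm x \<le> 1"
    have "(norm x)\<^sup>2 \<le> 1" using x by (simp add: power_le_one)
    then have "2 powr (- 1 - s) \<le> (2 * (norm x)\<^sup>2) powr (- 1 - s)"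
      using x s by (intro powr_mono2') auto
    moreover have "2 powr (- 1 - s) \<le> 1" using powr_mono[of "- 1 - s" 0 2] s by simp
    ultimately have "c * 2 powr (- 1 - s) * (d * norm x powr (2 - n)) \<le> c * min 1 ((2 * (norm x)\<^sup>2) powr (- 1 - s)) * (d * norm x powr (2 - n))"
      using c d by (intro mult_right_mono mult_left_mono) auto
    also have "\<dots> \<le> subord_kernel s x" by (rule main[OF x(1) refl])
    finally show "c * 2 powr (- 1 - s) * d * norm x powr (2 - real DIM('a)) \<le> subord_kernel s x"
      by (simp add: n_def mult.assoc)
  next
    fix x :: 'a
    assume x: "1 \<le> norm x"
    then have x0: "x \<noteq> 0" by auto
    define r where "r = norm x"
    have r: "1 \<le> r" using x by (simp add: r_def)
    have e: "(2 * r\<^sup>2) powr (- 1 - s) = 2 powr (- 1 - s) * r powr (- 2 - 2 * s)"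
      using norm_sq_powr[of x "- 1 - s"] by (simp add: powr_mult r_def algebra_simps)
    have "2 powr (- 1 - s) * r powr (- 2 - 2 * s) \<le> 1 * 1"
      using powr_mono[of "- 1 - s" 0 2] powr_mono[of "- 2 - 2 * s" 0 r] s r by (intro mult_mono) auto
    then have m: "min 1 ((2 * r\<^sup>2) powr (- 1 - s)) = 2 powr (- 1 - s) * r powr (- 2 - 2 * s)" by (simp add: e)
    have "- (n + 2 * s) = (- 2 - 2 * s) + (2 - n)" by simp
    then have "r powr (- (n + 2 * s)) = r powr (- 2 - 2 * s) * r powr (2 - n)" by (simp only: powr_add)
    then have "c * 2 powr (- 1 - s) * d * r powr (- (n + 2 * s)) = c * min 1 ((2 * r\<^sup>2) powr (- 1 - s)) * (d * r powr (2 - n))"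
      by (simp add: m)
    also have "\<dots> \<le> subord_kernel s x" by (rule main[OF x0 r_def])
    finally show "c * 2 powr (- 1 - s) * d * norm x powr (- (DIM('a) + 2 * s)) \<le> subord_kernel s x"
      by (simp add: n_def r_def)
  qed (use c d in simp)
qed

text \<open>For n \<ge> 3 the density is bounded by 1 and the Gaussians alone integrate to a
  multiple of |x|^(2 - n), by an inverse gamma integral with exponent n / 2 - 1. For n = 2 that
  integral diverges at infinity, so the integrability of the density takes over for t > 1, and the
  logarithm comes from 1 / t between |x|^2 and 1. For n = 1 the value at the origin is an upper
  bound.\<close>

lemma subord_kernel_upper_near:
  obtains C where "0 < C"
    "\<And>x::'a::euclidean_space. 0 < norm x \<Longrightarrow> norm x \<le> 1 \<Longrightarrow> subord_kernel s x \<le> C *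
        (if DIM('a) \<ge> 3 then norm x powr (2 - real DIM('a)) else if DIM('a) = 2 then 1 + \<bar>ln (norm x)\<bar> else 1)"
proof -
  define n where "n = real DIM('a)"
  have p1: "0 < t \<Longrightarrow> subord_density 1 1 s t \<le> 1" for t by (rule subord_density_le_1[OF s])
  have ki: "integrable lborel (\<lambda>t. indicator {0<..} t * (subord_density 1 1 s t * gauss_kernel t x))" if "x \<in> kernel_dom" for x :: 'a
    using kernel_representation_dom(3)[OF s that] .
  have dom: "0 < norm x \<Longrightarrow> x \<in> kernel_dom" for x :: 'a by (auto simp: kernel_dom_def)
  have pos: "1 \<le> DIM('a)" by (simp add: Suc_le_eq)
  consider "DIM('a) \<ge> 3" | "DIM('a) = 2" | "DIM('a) = 1" using pos by linarith
  then show ?thesis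
  proof cases
    case 1
    define \<beta> where "\<beta> = n / 2 - 1"
    have \<beta>: "0 < \<beta>" using 1 by (simp add: \<beta>_def n_def)
    define M where "M = pi powr (n / 2) * inverse_gamma_const \<beta> * (pi\<^sup>2) powr (- \<beta>)"
    have M0: "0 \<le> M" by (simp add: M_def inverse_gamma_const_nonneg)
    show ?thesis
    proof (rule that[of "M + 1"])
      fix x :: 'a assume x: "0 < norm x" "norm x \<le> 1"
      define \<rho> where "\<rho> = pi\<^sup>2 * (norm x)\<^sup>2"
      have \<rho>: "0 < \<rho>" using x by (auto simp: \<rho>_def)
      have "subord_kernel s x \<le> (LINT t|lborel. pi powr (n / 2) * (indicator {0<..} t * (t powr (- \<beta> - 1) * exp (- (\<rho> / t)))))"
        unfolding subord_kernel_def
      proof (rule integral_mono[OF ki[OF dom[OF x(1)]]])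
        show "integrable lborel (\<lambda>t. pi powr (n / 2) * (indicator {0<..} t * (t powr (- \<beta> - 1) * exp (- (\<rho> / t)))))"
          by (intro integrable_mult_right inverse_gamma_scaled \<beta> \<rho>)
        fix t :: real
        show "indicator {0<..} t * (subord_density 1 1 s t * gauss_kernel t x) \<le> pi powr (n / 2) * (indicator {0<..} t * (t powr (- \<beta> - 1) * exp (- (\<rho> / t))))"
        proof (cases "0 < t")
          case True
          have "gauss_kernel t x = pi powr (n / 2) * (t powr (- \<beta> - 1) * exp (- (\<rho> / t)))"
            using True by (simp add: gauss_kernel_def \<rho>_def \<beta>_def n_def powr_divide powr_minus_divide)
          moreover have "subord_density 1 1 s t * gauss_kernel t x \<le> 1 * gauss_kernel t x"
            by (intro mult_right_mono p1 True) auto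
          ultimately show ?thesis using True by simp
        qed simp
      qed
      also have "\<dots> = M * norm x powr (2 - n)"
      proof -
        have "\<rho> powr (- \<beta>) = (pi\<^sup>2) powr (- \<beta>) * norm x powr (2 - n)"
          using norm_sq_powr[of x "- \<beta>"] by (simp add: \<rho>_def powr_mult \<beta>_def algebra_simps)
        then show ?thesis unfolding integral_mult_right_zero inverse_gamma_scaled(2)[OF \<beta> \<rho>] by (simp add: M_def)
      qed
      also have "\<dots> \<le> (M + 1) * norm x powr (2 - n)" by (intro mult_right_mono) auto
      finally show "subord_kernel s x \<le> (M + 1) * (if DIM('a) \<ge> 3 then norm x powr (2 - real DIM('a)) else if DIM('a) = 2 then 1 + \<bar>ln (norm x)\<bar> else 1)"
        using 1 by (simp add: n_def)
    qed (use M0 in simp)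
  next
    case 2
    show ?thesis
    proof (rule that[of "2 * pi"])
      fix x :: 'a assume x: "0 < norm x" "norm x \<le> 1"
      define r where "r = (norm x)\<^sup>2"
      have r: "0 < r" "r \<le> 1" using x by (auto simp: r_def power_le_one)
      \<comment> \<open>Up to the factor pi, the three summands majorise the integrand for t \<le>
        r, for r < t \<le> 1 and for t > 1. Their integrals are 1, - ln r = 2 |ln |x|| and at most
        1, whence the constant 2 pi.\<close>
      define h where "h t = 1 / r * indicator {0..r} t + (1 / t * indicator {r..1} t) + indicator {0<..} t * subord_density 1 1 s t" for t
      have b1: "has_bochner_integral lborel (\<lambda>t. 1 / t * indicator {r..1} t) (ln 1 - ln r)"
        by (rule has_bochner_integral_FTC_Icc_real) (use r in \<open>auto intro!: derivative_eq_intros continuous_intros\<close>)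
      have i0: "integrable lborel (\<lambda>t. 1 / r * indicator {0..r} t)"
        by (intro integrable_mult_right integrable_real_indicator) (use r in \<open>auto simp: emeasure_lborel_Icc_eq\<close>)
      have i1: "integrable lborel (\<lambda>t. 1 / t * indicator {r..1} t)" using b1 by (simp only: has_bochner_integral_iff)
      have hi: "integrable lborel h" unfolding h_def
        by (intro Bochner_Integration.integrable_add i0 i1 integrable_subord_density_1[OF s])
      have "subord_kernel s x \<le> (LINT t|lborel. pi * h t)"
        unfolding subord_kernel_def
      proof (rule integral_mono[OF ki[OF dom[OF x(1)]]])
        show "integrable lborel (\<lambda>t. pi * h t)" by (intro integrable_mult_right hi)
        fix t :: real
        show "indicator {0<..} t * (subord_density 1 1 s t * gauss_kernel t x) \<le> pi * h t"
        proof (cases "0 < t")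
          case True
          let ?p = "subord_density 1 1 s t"
          have p: "0 \<le> ?p" "?p \<le> 1" using subord_density_1_pos[OF True] p1[OF True] by auto
          have g: "gauss_kernel t x = pi * (1 / t * exp (- (pi\<^sup>2 * r / t)))"
            using True 2 by (simp add: gauss_kernel_def r_def)
          have e1: "exp (- (pi\<^sup>2 * r / t)) \<le> 1" using True r by simp
          have "?p * (1 / t * exp (- (pi\<^sup>2 * r / t))) \<le> h t"
          proof -
            consider "t \<le> r" | "r < t" "t \<le> 1" | "1 < t" by linarith
            then show ?thesis
            proof cases
              case 1
              define y where "y = pi\<^sup>2 * r / t"
              have y: "0 < y" using True r by (simp add: y_def)
              have "y * exp (- y) \<le> 1" proof -
                have "y \<le> exp y" using exp_ge_add_one_self[of y] by linarith
                then show ?thesis by (simp add: exp_minus divide_simps)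
              qed
              moreover have "1 / t * exp (- y) = 1 / (pi\<^sup>2 * r) * (y * exp (- y))" using True r by (simp add: y_def)
              ultimately have "1 / t * exp (- y) \<le> 1 / (pi\<^sup>2 * r) * 1" using r by (simp only:) (intro mult_left_mono, auto)
              also have "\<dots> \<le> 1 / r"
              proof -
                have "1 \<le> pi" using pi_gt3 by simp
                then have "1 \<le> pi\<^sup>2" by (rule one_le_power)
                then have "1 * r \<le> pi\<^sup>2 * r" using r by (intro mult_right_mono) auto
                then show ?thesis using r by (simp add: frac_le)
              qed
              finally have "1 / t * exp (- y) \<le> 1 / r" .
              then have "?p * (1 / t * exp (- y)) \<le> 1 * (1 / r)" using p True by (intro mult_mono) auto
              also have "\<dots> \<le> h t" using True 1 p r by (auto simp: h_def split: split_indicator)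
              finally show ?thesis by (simp add: y_def)
            next
              case 2
              have "?p * (1 / t * exp (- (pi\<^sup>2 * r / t))) \<le> 1 * (1 / t * 1)" using p e1 True by (intro mult_mono) auto
              also have "\<dots> \<le> h t" using True 2 p r by (auto simp: h_def split: split_indicator)
              finally show ?thesis .
            next
              case 3
              have "1 / t * exp (- (pi\<^sup>2 * r / t)) \<le> 1 * 1" using 3 e1 by (intro mult_mono) auto
              then have "?p * (1 / t * exp (- (pi\<^sup>2 * r / t))) \<le> ?p * 1" using p by (intro mult_left_mono) auto
              also have "\<dots> \<le> h t" using True 3 p r by (auto simp: h_def split: split_indicator)
              finally show ?thesis .
            qed
          qed
          from mult_left_mono[OF this, of pi] show ?thesis using True by (simp add: g mult_ac)
        next
          case False
          then show ?thesis using r by (auto simp: h_def split: split_indicator)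
        qed
      qed
      also have "\<dots> = pi * (1 + (ln 1 - ln r) + (LINT t|lborel. indicator {0<..} t * subord_density 1 1 s t))"
      proof -
        have "(LINT t|lborel. h t) = (LINT t|lborel. 1 / r * indicator {0..r} t) + (LINT t|lborel. 1 / t * indicator {r..1} t)
            + (LINT t|lborel. indicator {0<..} t * subord_density 1 1 s t)"
          unfolding h_def using i0 i1 integrable_subord_density_1[OF s] by simp
        then show ?thesis using r has_bochner_integral_integral_eq[OF b1] by simp
      qed
      also have "\<dots> \<le> pi * (1 + (ln 1 - ln r) + 1)"
        using integral_subord_density_le_1[OF s, of 1 1] by (intro mult_left_mono add_mono) auto
      also have "ln r = - (2 * \<bar>ln (norm x)\<bar>)" using x by (simp add: r_def ln_realpow abs_if)
      finally show "subord_kernel s x \<le> 2 * pi * (if DIM('a) \<ge> 3 then norm x powr (2 - real DIM('a)) else if DIM('a) = 2 then 1 + \<bar>ln (norm x)\<bar> else 1)"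
        using 2 by (simp add: algebra_simps)
    qed simp
  next
    case 3
    then have d0: "(0::'a) \<in> kernel_dom" by (simp add: kernel_dom_def)
    show ?thesis
    proof (rule that[of "subord_kernel s (0::'a)"])
      show "0 < subord_kernel s (0::'a)" by (rule subord_kernel_pos[OF d0])
      fix x :: 'a assume x: "0 < norm x" "norm x \<le> 1"
      show "subord_kernel s x \<le> subord_kernel s (0::'a) * (if DIM('a) \<ge> 3 then norm x powr (2 - real DIM('a)) else if DIM('a) = 2 then 1 + \<bar>ln (norm x)\<bar> else 1)"
        using subord_kernel_antimono[OF d0 dom[OF x(1)]] 3 by simp
    qed
  qed
qed

text \<open>Tonelli: every Gaussian has mass 1, so the kernel has the mass of the density.\<close>

lemma nn_integral_subord_kernel_le_1:
  "(\<integral>\<^sup>+x. ennreal (subord_kernel s (x::'a::euclidean_space)) \<partial>lborel) \<le> 1"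
proof -
  have k: "ennreal (subord_kernel s x) = (\<integral>\<^sup>+t. ennreal (indicator {0<..} t * (subord_density 1 1 s t * gauss_kernel t x)) \<partial>lborel)" if "x \<noteq> 0" for x :: 'a
    unfolding subord_kernel_def
    by (rule nn_integral_eq_integral[symmetric, OF kernel_representation_dom(3)[OF s]])
      (use that subord_density_1_pos in \<open>auto simp: kernel_dom_def less_imp_le split: split_indicator\<close>)
  have "(\<integral>\<^sup>+x. ennreal (subord_kernel s (x::'a)) \<partial>lborel) =
    (\<integral>\<^sup>+x. (\<integral>\<^sup>+t. ennreal (indicator {0<..} t * (subord_density 1 1 s t * gauss_kernel t (x::'a))) \<partial>lborel) \<partial>lborel)"
    by (rule nn_integral_cong_AE, rule AE_I[where N="{0}"]) (use k in blast, auto)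
  also have "\<dots> = (\<integral>\<^sup>+t. (\<integral>\<^sup>+x. ennreal (indicator {0<..} t * (subord_density 1 1 s t * gauss_kernel t (x::'a))) \<partial>lborel) \<partial>lborel)"
    by (rule lborel_pair.Fubini') measurable
  also have "\<dots> = (\<integral>\<^sup>+t. ennreal (subord_density 1 1 s t) * indicator {0<..} t \<partial>lborel)"
  proof (intro nn_integral_cong)
    fix t :: real
    show "(\<integral>\<^sup>+x. ennreal (indicator {0<..} t * (subord_density 1 1 s t * gauss_kernel t (x::'a))) \<partial>lborel) = ennreal (subord_density 1 1 s t) * indicator {0<..} t"
    proof (cases "0 < t")
      case True
      have "(\<integral>\<^sup>+x. ennreal (subord_density 1 1 s t * gauss_kernel t (x::'a)) \<partial>lborel) = ennreal (LINT x::'a|lborel. subord_density 1 1 s t * gauss_kernel t x)"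
        by (rule nn_integral_eq_integral) (use True subord_density_1_pos[OF True] in \<open>auto intro!: integrable_mult_right integrable_gauss_kernel\<close>)
      then show ?thesis using True by (simp add: integral_gauss_kernel)
    qed simp
  qed
  also have "\<dots> \<le> 1" using subord_mass[of 1 1 s] s by simp
  finally show ?thesis .
qed

lemma integrable_subord_kernel: "integrable lborel (subord_kernel s :: 'a::euclidean_space \<Rightarrow> real)"
  by (rule integrableI_nonneg) (use nn_integral_subord_kernel_le_1 in \<open>auto simp: subord_kernel_nonneg intro: le_less_trans\<close>)

text \<open>In the unit ball the assumed power bound decides. Outside it the kernel is at most
  \<open>D\<close>, so its q-th power is at most D powr (q - 1) times the kernel, which is
  integrable.\<close>

lemma in_Lq_mixed_kernel:
  fixes a q C :: real
  assumes a: "0 \<le> a" "a * q < DIM('a)" and q: "1 \<le> q"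
    and near: "\<And>x::'a::euclidean_space. 0 < norm x \<Longrightarrow> norm x \<le> 1 \<Longrightarrow> subord_kernel s x \<le> C * norm x powr (- a)"
  shows "in_Lq q (mixed_kernel s :: 'a \<Rightarrow> real)"
proof -
  let ?k = "subord_kernel s :: 'a \<Rightarrow> real" and ?K = "mixed_kernel s :: 'a \<Rightarrow> real"
  have K: "?K x = (if x = 0 then ?K 0 else ?k x)" for x
    using mixed_kernel_eq[OF s, of x] by (simp add: kernel_dom_def)
  have Km: "?K \<in> borel_measurable borel"
    by (subst K[abs_def]) measurable
  obtain D where D: "0 < D" "\<And>x::'a. x \<noteq> 0 \<Longrightarrow> ?k x \<le> D * norm x powr (- (DIM('a) + 2 * s))"
    using subord_kernel_upper_far by blast
  have "integrable lborel (\<lambda>x. \<bar>?K x\<bar> powr q)"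
  proof (rule Bochner_Integration.integrable_bound)
    let ?h = "\<lambda>x::'a. C powr q * (indicator (cball 0 1) x * norm x powr (- (a * q))) + D powr (q - 1) * ?k x"
    show "integrable lborel ?h"
      using a q by (intro Bochner_Integration.integrable_add integrable_mult_right integrable_norm_powr_ball integrable_subord_kernel) auto
    show "(\<lambda>x. \<bar>?K x\<bar> powr q) \<in> borel_measurable lborel" using Km by measurable
    show "AE x in lborel. norm (\<bar>?K x\<bar> powr q) \<le> norm (?h x)"
    proof (rule AE_I[where N="{0}"])
      show "{x \<in> space lborel. \<not> norm (\<bar>?K x\<bar> powr q) \<le> norm (?h x)} \<subseteq> {0}"
      proof (clarsimp, rule ccontr)
        fix x :: 'a assume ne: "\<not> \<bar>mixed_kernel s x\<bar> powr q \<le> \<bar>C powr q * (indicator (cball 0 1) x * norm x powr (- (a * q))) + D powr (q - 1) * subord_kernel s x\<bar>" and x: "x \<noteq> 0"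
        have k0: "0 \<le> ?k x" by (rule subord_kernel_nonneg)
        have h0: "0 \<le> C powr q * (indicator (cball 0 1) x * norm x powr (- (a * q)))" "0 \<le> D powr (q - 1) * ?k x" using k0 by auto
        have "?k x powr q \<le> ?h x"
        proof (cases "norm x \<le> 1")
          case True
          have kc: "?k x \<le> C * norm x powr (- a)" using near x True by simp
          have C0: "0 \<le> C"
          proof (rule ccontr)
            assume "\<not> 0 \<le> C"
            then have "C * norm x powr (- a) < 0" using x by (intro mult_neg_pos) auto
            then show False using kc k0 by linarith
          qed
          have "?k x powr q \<le> (C * norm x powr (- a)) powr q"
            using kc q k0 by (intro powr_mono2) auto
          also have "\<dots> = C powr q * norm x powr (- (a * q))"
            using C0 by (simp add: powr_mult powr_powr)
          finally show ?thesis using True h0(2) by simp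
        next
          case False
          have "norm x powr (- (DIM('a) + 2 * s)) \<le> 1"
            using False x s powr_mono[of "- (DIM('a) + 2 * s)" 0 "norm x"] by simp
          from mult_left_mono[OF this, of D] have "?k x \<le> D * 1" using D(2)[OF x] D(1) by linarith
          then have "?k x powr (q - 1) \<le> D powr (q - 1)" using q k0 by (intro powr_mono2) auto
          then have "?k x powr (q - 1) * ?k x \<le> D powr (q - 1) * ?k x" using k0 by (rule mult_right_mono)
          moreover have "?k x powr q = ?k x powr (q - 1) * ?k x"
            using k0 powr_add[of "?k x" "q - 1" 1] by (cases "?k x = 0") auto
          ultimately show ?thesis using h0(1) by linarith
        qed
        then show False using ne x K[of x] k0 by simp
      qed
    qed auto
  qed
  then show ?thesis using Km unfolding in_Lq_def
    by (auto simp: integrable_completion measurable_completion)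
qed

lemma mixed_kernel_in_Lq_high_dim:
  assumes "3 \<le> DIM('a::euclidean_space)" "1 \<le> q" "q < DIM('a) / (real DIM('a) - 2)"
  shows "in_Lq q (mixed_kernel s :: 'a \<Rightarrow> real)"
proof -
  obtain C where C: "\<And>x::'a. 0 < norm x \<Longrightarrow> norm x \<le> 1 \<Longrightarrow> subord_kernel s x \<le> C *
        (if DIM('a) \<ge> 3 then norm x powr (2 - real DIM('a)) else if DIM('a) = 2 then 1 + \<bar>ln (norm x)\<bar> else 1)"
    using subord_kernel_upper_near by blast
  show ?thesis
  proof (rule in_Lq_mixed_kernel[where a="real DIM('a) - 2" and C=C])
    show "(real DIM('a) - 2) * q < DIM('a)" using assms by (simp add: less_divide_eq mult.commute)
    show "0 < norm x \<Longrightarrow> norm x \<le> 1 \<Longrightarrow> subord_kernel s x \<le> C * norm x powr (- (real DIM('a) - 2))" for x :: 'a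
      using C[of x] assms(1) by simp
  qed (use assms in auto)
qed

lemma mixed_kernel_in_Lq_low_dim:
  assumes "DIM('a::euclidean_space) = 1 \<or> DIM('a) = 2" "1 \<le> q"
  shows "in_Lq q (mixed_kernel s :: 'a \<Rightarrow> real)"
proof -
  obtain C where C: "0 < C" "\<And>x::'a. 0 < norm x \<Longrightarrow> norm x \<le> 1 \<Longrightarrow> subord_kernel s x \<le> C *
        (if DIM('a) \<ge> 3 then norm x powr (2 - real DIM('a)) else if DIM('a) = 2 then 1 + \<bar>ln (norm x)\<bar> else 1)"
    using subord_kernel_upper_near by blast
  from assms(1) show ?thesis
  proof
    assume d: "DIM('a) = 1"
    show ?thesis
    proof (rule in_Lq_mixed_kernel[where a=0 and C=C])
      show "0 < norm x \<Longrightarrow> norm x \<le> 1 \<Longrightarrow> subord_kernel s x \<le> C * norm x powr (- 0)" for x :: 'a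
        using C(2)[of x] d by simp
    qed (use assms d in auto)
  next
    assume d: "DIM('a) = 2"
    show ?thesis
    \<comment> \<open>The logarithm is absorbed into |x| powr (- 1 / q), whose q-th power has the
      exponent -1, admissible in dimension 2.\<close>
    proof (rule in_Lq_mixed_kernel[where a="1 / q" and C="C * (1 + q)"])
      fix x :: 'a assume x: "0 < norm x" "norm x \<le> 1"
      define y where "y = norm x powr (- (1 / q))"
      have "\<bar>ln (norm x)\<bar> = q * ln y" using x assms by (simp add: y_def ln_powr abs_if)
      moreover have y1: "1 \<le> y"
        using powr_mono'[of "- (1 / q)" 0 "norm x"] x assms by (simp add: y_def)
      moreover have "ln y \<le> y" using ln_le_minus_one[of y] y1 by simp
      ultimately have "1 + \<bar>ln (norm x)\<bar> \<le> (1 + q) * y" using assms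
        by (simp add: distrib_right add_mono mult_left_mono)
      then have "C * (1 + \<bar>ln (norm x)\<bar>) \<le> C * (1 + q) * y" using C by simp
      then show "subord_kernel s x \<le> C * (1 + q) * norm x powr (- (1 / q))"
        using C(2)[OF x] d by (simp add: y_def)
    qed (use assms d in auto)
  qed
qed

end

subsection \<open>Test functions and the mixed Laplacian\<close>

lemma integral_translation:
  fixes g :: "'a::euclidean_space \<Rightarrow> 'b::{banach, second_countable_topology}"
  assumes [measurable]: "g \<in> borel_measurable borel"
  shows "(LINT x|lborel. g (x + h)) = (LINT x|lborel. g x)"
proof -
  have "(LINT x|lborel. g x) = (LINT x|distr lborel borel ((+) h). g x)"
    by (simp only: lborel_distr_plus)
  also have "\<dots> = (LINT x|lborel. g (h + x))" by (rule integral_distr) auto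
  finally show ?thesis by (simp add: add.commute)
qed

lemma integrable_translation:
  fixes g :: "'a::euclidean_space \<Rightarrow> 'b::{banach, second_countable_topology}"
  assumes "integrable lborel g"
  shows "integrable lborel (\<lambda>x. g (x + h))"
proof -
  have "integrable (distr lborel borel ((+) h)) g" using assms by (simp only: lborel_distr_plus)
  then have "integrable lborel (\<lambda>x. g (h + x))" by (rule integrable_distr[rotated]) auto
  then show ?thesis by (simp add: add.commute)
qed

lemma lborel_distr_uminus_euclidean: "distr lborel borel uminus = (lborel :: 'a::euclidean_space measure)"
proof -
  have "lborel = density (distr lborel borel (\<lambda>x::'a. 0 + (- 1) *\<^sub>R x)) (\<lambda>_. ennreal (\<bar>- 1\<bar> ^ DIM('a)))"
    using lborel_affine[of "- 1" "0::'a"] by simp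
  also have "\<dots> = distr lborel borel uminus" by (simp add: density_1)
  finally show ?thesis by (rule sym)
qed

lemma integral_reflection:
  fixes g :: "'a::euclidean_space \<Rightarrow> 'b::{banach, second_countable_topology}"
  assumes [measurable]: "g \<in> borel_measurable borel"
  shows "(LINT x|lborel. g (a - x)) = (LINT x|lborel. g x)"
proof -
  have "(LINT x|lborel. g x) = (LINT x|lborel. g (x + a))" by (rule integral_translation[symmetric]) fact
  also have "\<dots> = (LINT x|distr lborel borel uminus. g (x + a))"
    by (simp only: lborel_distr_uminus_euclidean)
  also have "\<dots> = (LINT x|lborel. g (- x + a))" by (rule integral_distr) auto
  finally show ?thesis by simp
qed

lemma fourier_lborel:
  assumes [measurable]: "u \<in> borel_measurable borel"
  shows "fourier u \<xi> = (LINT x|lborel. of_real (u x) * echar (- \<xi>) x)"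
proof -
  have "fourier u \<xi> = (LINT x|lborel. complex_of_real (u x) * exp (- 2 * of_real pi * \<i> * of_real (x \<bullet> \<xi>)))"
    unfolding fourier_def by (rule integral_completion) measurable
  then show ?thesis by (simp add: echar_def inner_commute)
qed

lemma integrable_mult_echar:
  fixes u :: "'a::euclidean_space \<Rightarrow> real"
  assumes "integrable lborel u"
  shows "integrable lborel (\<lambda>x. complex_of_real (u x) * echar \<xi> x)"
proof -
  have [measurable]: "u \<in> borel_measurable borel" using assms by auto
  show ?thesis by (rule Bochner_Integration.integrable_bound[OF assms]) (auto simp: norm_mult)
qed

lemma fourier_translation:
  fixes u :: "'a::euclidean_space \<Rightarrow> real"
  assumes u: "integrable lborel u"
  shows "(LINT x|lborel. complex_of_real (u (x + h)) * echar (- \<xi>) x) = echar \<xi> h * fourier u \<xi>"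
proof -
  have [measurable]: "u \<in> borel_measurable borel" using u by auto
  have e: "echar (- \<xi>) x = echar \<xi> h * echar (- \<xi>) (x + h)" for x
    by (simp add: echar_commute[of "- \<xi>"] echar_commute[of \<xi> h] echar_def inner_add_left exp_add[symmetric] algebra_simps)
  have "(LINT x|lborel. complex_of_real (u (x + h)) * echar (- \<xi>) x) = (LINT x|lborel. echar \<xi> h * (complex_of_real (u (x + h)) * echar (- \<xi>) (x + h)))"
    by (subst e) (simp add: mult_ac)
  also have "\<dots> = echar \<xi> h * (LINT x|lborel. complex_of_real (u (x + h)) * echar (- \<xi>) (x + h))" by simp
  also have "(LINT x|lborel. complex_of_real (u (x + h)) * echar (- \<xi>) (x + h)) = fourier u \<xi>"
    by (subst fourier_lborel, measurable) (rule integral_translation[where g="\<lambda>x. complex_of_real (u x) * echar (- \<xi>) x"], measurable)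
  finally show ?thesis .
qed

section \<open>Supports, bounds and differences of test functions\<close>

lemma
  fixes \<phi> :: "'a::euclidean_space \<Rightarrow> real"
  assumes "test_function \<phi>"
  shows test_function_has_derivative: "(\<phi> has_derivative frechet_derivative \<phi> (at x)) (at x)"
    and test_function_continuous: "continuous_on UNIV \<phi>"
    and test_function_measurable: "\<phi> \<in> borel_measurable borel"
    and test_function_derivative: "test_function (\<lambda>x. frechet_derivative \<phi> (at x) v)"
proof -
  have ck: "Ck_on k \<phi> UNIV" for k using assms by (auto simp: test_function_def smooth_on_def)
  have c: "compact (closure {x. \<phi> x \<noteq> 0})" using assms by (simp add: test_function_def)
  show d: "(\<phi> has_derivative frechet_derivative \<phi> (at x)) (at x)" for x
    using ck[of 1] frechet_derivative_works by auto
  show cont: "continuous_on UNIV \<phi>" using ck[of 0] by simp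
  then show "\<phi> \<in> borel_measurable borel" by (rule borel_measurable_continuous_onI)
  have "Ck_on k (\<lambda>x. frechet_derivative \<phi> (at x) v) UNIV" for k using ck[of "Suc k"] by simp
  moreover have "compact (closure {x. frechet_derivative \<phi> (at x) v \<noteq> 0})"
  proof -
    have "{x. frechet_derivative \<phi> (at x) v \<noteq> 0} \<subseteq> closure {x. \<phi> x \<noteq> 0}"
    proof (rule ccontr)
      assume "\<not> ?thesis"
      then obtain x where x: "frechet_derivative \<phi> (at x) v \<noteq> 0" "x \<in> - closure {x. \<phi> x \<noteq> 0}" by auto
      have "((\<lambda>_. 0) has_derivative frechet_derivative \<phi> (at x)) (at x)"
        by (rule has_derivative_transform_within_open[OF d _ x(2)]) (use closure_subset[of "{x. \<phi> x \<noteq> 0}"] in \<open>auto simp: open_Compl\<close>)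
      then have "frechet_derivative \<phi> (at x) = (\<lambda>_. 0)"
        by (rule has_derivative_unique) (rule has_derivative_const)
      then show False using x by simp
    qed
    then have "closure {x. frechet_derivative \<phi> (at x) v \<noteq> 0} \<subseteq> closure {x. \<phi> x \<noteq> 0}"
      by (rule closure_minimal) simp
    then show ?thesis using c by (metis closed_closure compact_Int_closed inf.absorb_iff2)
  qed
  ultimately show "test_function (\<lambda>x. frechet_derivative \<phi> (at x) v)"
    by (simp add: test_function_def smooth_on_def)
qed

lemma test_function_support:
  fixes \<phi> :: "'a::euclidean_space \<Rightarrow> real"
  assumes "test_function \<phi>"
  obtains R where "0 < R" "\<And>x. R < norm x \<Longrightarrow> \<phi> x = 0"
proof -
  have "bounded (closure {x. \<phi> x \<noteq> 0})" using assms compact_imp_bounded by (auto simp: test_function_def)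
  then obtain R where "0 < R" "\<And>x. x \<in> closure {x. \<phi> x \<noteq> 0} \<Longrightarrow> norm x \<le> R" using bounded_pos by blast
  then show ?thesis using closure_subset[of "{x. \<phi> x \<noteq> 0}"] by (intro that[of R]) force+
qed

lemma test_function_bounded:
  fixes \<phi> :: "'a::euclidean_space \<Rightarrow> real"
  assumes "test_function \<phi>"
  obtains B where "0 \<le> B" "\<And>x. \<bar>\<phi> x\<bar> \<le> B"
proof -
  obtain R where R: "0 < R" "\<And>x. R < norm x \<Longrightarrow> \<phi> x = 0" using test_function_support[OF assms] by blast
  have "compact (\<phi> ` cball 0 R)"
    by (intro compact_continuous_image continuous_on_subset[OF test_function_continuous[OF assms]]) auto
  then have "bounded (\<phi> ` cball 0 R)" by (rule compact_imp_bounded)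
  then obtain B where B: "0 < B" "\<And>x. x \<in> cball 0 R \<Longrightarrow> \<bar>\<phi> x\<bar> \<le> B" unfolding bounded_pos by auto
  have "\<bar>\<phi> x\<bar> \<le> B" for x using B R(2)[of x] by (cases "norm x \<le> R") auto
  then show ?thesis using B(1) by (intro that[of B]) auto
qed

lemma integrable_indicator_cball: "integrable lborel (indicator (cball a R) :: 'a::euclidean_space \<Rightarrow> real)"
  by (intro integrable_real_indicator) (use emeasure_bounded_finite[OF bounded_cball, of a R] in \<open>auto simp: less_top\<close>)

lemma test_function_integrable:
  fixes \<phi> :: "'a::euclidean_space \<Rightarrow> real"
  assumes "test_function \<phi>"
  shows "integrable lborel \<phi>"
proof -
  obtain R where R: "0 < R" "\<And>x. R < norm x \<Longrightarrow> \<phi> x = 0" using test_function_support[OF assms] by blast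
  obtain B where B: "0 \<le> B" "\<And>x. \<bar>\<phi> x\<bar> \<le> B" using test_function_bounded[OF assms] by blast
  show ?thesis
  proof (rule Bochner_Integration.integrable_bound)
    show "integrable lborel (\<lambda>x::'a. B * indicator (cball 0 R) x)"
      by (intro integrable_mult_right integrable_indicator_cball)
    show "\<phi> \<in> borel_measurable lborel" using test_function_measurable[OF assms] by simp
    have "\<bar>\<phi> x\<bar> \<le> \<bar>B * indicator (cball 0 R) x\<bar>" for x
      using B R(2)[of x] by (cases "norm x \<le> R") auto
    then show "AE x in lborel. norm (\<phi> x) \<le> norm (B * indicator (cball 0 R) x)" by simp
  qed
qed

lemma test_function_lipschitz:
  fixes \<phi> :: "'a::euclidean_space \<Rightarrow> real"
  assumes \<phi>: "test_function \<phi>"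
  obtains L where "0 \<le> L" "\<And>x y. \<bar>\<phi> x - \<phi> y\<bar> \<le> L * norm (x - y)"
proof -
  have "\<exists>B. 0 \<le> B \<and> (\<forall>x. \<bar>frechet_derivative \<phi> (at x) b\<bar> \<le> B)" for b
    using test_function_bounded[OF test_function_derivative[OF \<phi>, of b]] by metis
  then obtain B where B: "\<And>b. 0 \<le> B b" "\<And>b x. \<bar>frechet_derivative \<phi> (at x) b\<bar> \<le> B b" by metis
  define L where "L = (\<Sum>b\<in>Basis. B b)"
  have L: "0 \<le> L" using B by (simp add: L_def sum_nonneg)
  have bd: "onorm (frechet_derivative \<phi> (at x)) \<le> L" for x
  proof (rule onorm_le)
    fix h
    have lin: "linear (frechet_derivative \<phi> (at x))"
      using test_function_has_derivative[OF \<phi>] has_derivative_linear by blast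
    have "frechet_derivative \<phi> (at x) h = (\<Sum>b\<in>Basis. (h \<bullet> b) * frechet_derivative \<phi> (at x) b)"
      by (subst euclidean_representation[symmetric, of h]) (simp add: linear_sum[OF lin] linear_scale[OF lin])
    also have "norm \<dots> \<le> (\<Sum>b\<in>Basis. norm h * B b)"
      by (rule order_trans[OF norm_sum sum_mono]) (auto simp: abs_mult intro!: mult_mono B Basis_le_norm)
    finally show "norm (frechet_derivative \<phi> (at x) h) \<le> L * norm h"
      by (simp add: L_def sum_distrib_right mult.commute[of "norm h"])
  qed
  have "norm (\<phi> x - \<phi> y) \<le> L * norm (x - y)" for x y
    by (rule differentiable_bound[where S=UNIV and f'="\<lambda>x. frechet_derivative \<phi> (at x)"])
      (use bd test_function_has_derivative[OF \<phi>] in auto)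
  then show ?thesis using L by (intro that[of L]) auto
qed

text \<open>The mean value theorem is applied to the even function h t = \<phi> (x + t z) + \<phi>
  (x - t z). Its derivative is the difference of the derivatives in direction z at two points 2 t z
  apart, which is quadratic in z because the derivatives are Lipschitz.\<close>

lemma test_function_second_difference:
  fixes \<phi> :: "'a::euclidean_space \<Rightarrow> real"
  assumes \<phi>: "test_function \<phi>"
  obtains B where "0 \<le> B" "\<And>x z. \<bar>2 * \<phi> x - \<phi> (x + z) - \<phi> (x - z)\<bar> \<le> B * (norm z)\<^sup>2"
proof -
  let ?D = "\<lambda>x. frechet_derivative \<phi> (at x)"
  have "\<exists>L. 0 \<le> L \<and> (\<forall>x y. \<bar>?D x b - ?D y b\<bar> \<le> L * norm (x - y))" for b
    using test_function_lipschitz[OF test_function_derivative[OF \<phi>, of b]] by metis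
  then obtain L where L: "\<And>b. 0 \<le> L b" "\<And>b x y. \<bar>?D x b - ?D y b\<bar> \<le> L b * norm (x - y)" by metis
  define M where "M = (\<Sum>b\<in>Basis. L b)"
  have lin: "linear (?D x)" for x
    using test_function_has_derivative[OF \<phi>] has_derivative_linear by blast
  have Ld: "\<bar>?D x h - ?D y h\<bar> \<le> M * norm h * norm (x - y)" for x y h
  proof -
    have e: "?D x h = (\<Sum>b\<in>Basis. (h \<bullet> b) * ?D x b)" for x
      by (subst euclidean_representation[symmetric, of h]) (simp add: linear_sum[OF lin] linear_scale[OF lin])
    have "?D x h - ?D y h = (\<Sum>b\<in>Basis. (h \<bullet> b) * (?D x b - ?D y b))"
      unfolding e[of x] e[of y] by (simp add: sum_subtractf right_diff_distrib)
    also have "norm \<dots> \<le> (\<Sum>b\<in>Basis. norm h * (L b * norm (x - y)))"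
      by (rule order_trans[OF norm_sum sum_mono]) (auto simp: abs_mult intro!: mult_mono L Basis_le_norm)
    finally show ?thesis by (simp add: M_def sum_distrib_left sum_distrib_right mult_ac)
  qed
  have M: "0 \<le> M" using L by (simp add: M_def sum_nonneg)
  show ?thesis
  proof (rule that[of "2 * M"])
    fix x z
    define h where "h t = \<phi> (x + t *\<^sub>R z) + \<phi> (x - t *\<^sub>R z)" for t :: real
    define h' where "h' t = ?D (x + t *\<^sub>R z) z - ?D (x - t *\<^sub>R z) z" for t
    have hd: "(h has_real_derivative h' t) (at t)" for t
    proof -
      have d1: "((\<lambda>t. x + t *\<^sub>R z) has_derivative (\<lambda>d. d *\<^sub>R z)) (at t)"
        "((\<lambda>t. x - t *\<^sub>R z) has_derivative (\<lambda>d. - (d *\<^sub>R z))) (at t)"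
        by (auto intro!: derivative_eq_intros)
      have "(h has_derivative (\<lambda>d. ?D (x + t *\<^sub>R z) (d *\<^sub>R z) + ?D (x - t *\<^sub>R z) (- (d *\<^sub>R z)))) (at t)"
        unfolding h_def
        by (intro has_derivative_add has_derivative_compose[OF d1(1) test_function_has_derivative[OF \<phi>]]
          has_derivative_compose[OF d1(2) test_function_has_derivative[OF \<phi>]])
      also have "(\<lambda>d. ?D (x + t *\<^sub>R z) (d *\<^sub>R z) + ?D (x - t *\<^sub>R z) (- (d *\<^sub>R z))) = (*) (h' t)"
        by (auto simp: fun_eq_iff h'_def linear_scale[OF lin] linear_neg[OF lin] algebra_simps)
      finally show ?thesis by (simp add: has_field_derivative_def)
    qed
    obtain t where t: "0 < t" "t < 1" "h 1 - h 0 = (1 - 0) * h' t"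
      using MVT2[of 0 1 h h'] hd by auto
    have "\<bar>h' t\<bar> \<le> M * norm z * norm ((x + t *\<^sub>R z) - (x - t *\<^sub>R z))" unfolding h'_def by (rule Ld)
    also have "(x + t *\<^sub>R z) - (x - t *\<^sub>R z) = (2 * t) *\<^sub>R z" by (simp add: scaleR_2[symmetric] flip: scaleR_scaleR)
    also have "M * norm z * norm ((2 * t) *\<^sub>R z) \<le> M * norm z * (2 * norm z)"
      using t M by (intro mult_left_mono) (auto intro: mult_left_le_one_le)
    finally have "\<bar>h 1 - h 0\<bar> \<le> 2 * M * (norm z)\<^sup>2" using t by (simp add: power2_eq_square)
    moreover have "\<bar>2 * \<phi> x - \<phi> (x + z) - \<phi> (x - z)\<bar> = \<bar>h 1 - h 0\<bar>" by (simp add: h_def)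
    ultimately show "\<bar>2 * \<phi> x - \<phi> (x + z) - \<phi> (x - z)\<bar> \<le> 2 * M * (norm z)\<^sup>2" by simp
  qed (use M in simp)
qed

text \<open>Difference quotients take the place of integration by parts: a translation multiplies
  the transform by a character, so the quotient multiplies it by a difference quotient of that
  character. The Lipschitz bound on the ball of radius R + |v| justifies the limit.\<close>

lemma fourier_directional_derivative:
  fixes \<phi> :: "'a::euclidean_space \<Rightarrow> real"
  assumes \<phi>: "test_function \<phi>"
  shows "fourier (\<lambda>x. frechet_derivative \<phi> (at x) v) \<xi> = (2 * of_real pi * \<i> * of_real (\<xi> \<bullet> v)) * fourier \<phi> \<xi>"
proof -
  note [measurable] = test_function_measurable[OF \<phi>] test_function_measurable[OF test_function_derivative[OF \<phi>, of v]]
  obtain R where R: "0 < R" "\<And>x. R < norm x \<Longrightarrow> \<phi> x = 0" using test_function_support[OF \<phi>] by blast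
  obtain L where L: "0 \<le> L" "\<And>x y. \<bar>\<phi> x - \<phi> y\<bar> \<le> L * norm (x - y)" using test_function_lipschitz[OF \<phi>] by blast
  define e where "e j = 1 / real (Suc j)" for j
  have e0: "0 < e j" "e j \<le> 1" for j by (auto simp: e_def)
  have e: "e \<longlonglongrightarrow> 0" unfolding e_def by (rule LIMSEQ_Suc[OF lim_1_over_n])
  have eat: "filterlim e (at 0) sequentially"
    using e e0 by (auto simp: filterlim_at intro!: always_eventually less_imp_neq[symmetric])
  let ?q = "\<lambda>j x. (\<phi> (x + e j *\<^sub>R v) - \<phi> x) / e j"
  have int: "integrable lborel \<phi>" by (rule test_function_integrable[OF \<phi>])
  have 1: "(LINT x|lborel. complex_of_real (?q j x) * echar (- \<xi>) x) = fourier \<phi> \<xi> * ((echar \<xi> (e j *\<^sub>R v) - 1) / of_real (e j))" for j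
  proof -
    have i1: "integrable lborel (\<lambda>x. complex_of_real (\<phi> (x + e j *\<^sub>R v)) * echar (- \<xi>) x)"
      by (intro integrable_mult_echar integrable_translation int)
    have i2: "integrable lborel (\<lambda>x. complex_of_real (\<phi> x) * echar (- \<xi>) x)"
      by (intro integrable_mult_echar int)
    have "(LINT x|lborel. complex_of_real (?q j x) * echar (- \<xi>) x) =
       (LINT x|lborel. (complex_of_real (\<phi> (x + e j *\<^sub>R v)) * echar (- \<xi>) x - complex_of_real (\<phi> x) * echar (- \<xi>) x) / of_real (e j))"
      by (simp add: left_diff_distrib diff_divide_distrib)
    also have "\<dots> = (echar \<xi> (e j *\<^sub>R v) * fourier \<phi> \<xi> - fourier \<phi> \<xi>) / of_real (e j)"
      using i1 i2 by (simp add: fourier_translation[OF int] fourier_lborel)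
    finally show ?thesis by (simp add: algebra_simps diff_divide_distrib)
  qed
  have "(\<lambda>j. LINT x|lborel. complex_of_real (?q j x) * echar (- \<xi>) x) \<longlonglongrightarrow> (LINT x|lborel. complex_of_real (frechet_derivative \<phi> (at x) v) * echar (- \<xi>) x)"
  proof (rule integral_dominated_convergence)
    show "integrable lborel (\<lambda>x::'a. L * norm v * indicator (cball 0 (R + norm v)) x)"
      by (intro integrable_mult_right integrable_indicator_cball)
    show "AE x in lborel. norm (complex_of_real (?q j x) * echar (- \<xi>) x) \<le> L * norm v * indicator (cball 0 (R + norm v)) x" for j
    proof (rule AE_I2)
      fix x :: 'a
      have "\<bar>?q j x\<bar> \<le> L * norm v * indicator (cball 0 (R + norm v)) x"
      proof (cases "norm x \<le> R + norm v")
        case True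
        have "\<bar>\<phi> (x + e j *\<^sub>R v) - \<phi> x\<bar> \<le> L * (e j * norm v)" using L(2)[of "x + e j *\<^sub>R v" x] e0[of j] by simp
        then show ?thesis using True e0[of j] by (simp add: divide_le_eq mult_ac)
      next
        case False
        have "norm (e j *\<^sub>R v) \<le> norm v" using e0[of j] by (simp add: mult_left_le_one_le)
        then have "R < norm (x + e j *\<^sub>R v)" using False norm_diff_ineq[of x "e j *\<^sub>R v"] by linarith
        moreover have "R < norm x" using False norm_ge_zero[of v] by linarith
        ultimately show ?thesis using False by (simp add: R)
      qed
      then show "norm (complex_of_real (?q j x) * echar (- \<xi>) x) \<le> L * norm v * indicator (cball 0 (R + norm v)) x"
        by (simp only: norm_mult norm_of_real norm_echar mult_1_right)
    qed
    show "AE x in lborel. (\<lambda>j. complex_of_real (?q j x) * echar (- \<xi>) x) \<longlonglongrightarrow> complex_of_real (frechet_derivative \<phi> (at x) v) * echar (- \<xi>) x"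
    proof (rule AE_I2)
      fix x :: 'a
      have lin: "linear (frechet_derivative \<phi> (at x))"
        using test_function_has_derivative[OF \<phi>] has_derivative_linear by blast
      have "((\<lambda>t. x + t *\<^sub>R v) has_derivative (\<lambda>d. d *\<^sub>R v)) (at 0)" by (auto intro!: derivative_eq_intros)
      moreover have "(\<phi> has_derivative frechet_derivative \<phi> (at x)) (at (x + 0 *\<^sub>R v))"
        using test_function_has_derivative[OF \<phi>, of x] by simp
      ultimately have "((\<lambda>t. \<phi> (x + t *\<^sub>R v)) has_derivative (\<lambda>d. frechet_derivative \<phi> (at x) (d *\<^sub>R v))) (at 0)"
        by (rule has_derivative_compose)
      then have "((\<lambda>t. \<phi> (x + t *\<^sub>R v)) has_real_derivative frechet_derivative \<phi> (at x) v) (at 0)"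
        unfolding has_field_derivative_def
        by (rule has_derivative_eq_rhs) (auto simp: fun_eq_iff linear_scale[OF lin])
      then have "((\<lambda>t. (\<phi> (x + t *\<^sub>R v) - \<phi> x) / t) \<longlongrightarrow> frechet_derivative \<phi> (at x) v) (at 0)"
        by (simp add: has_field_derivative_iff)
      from filterlim_compose[OF this eat]
      show "(\<lambda>j. complex_of_real (?q j x) * echar (- \<xi>) x) \<longlonglongrightarrow> complex_of_real (frechet_derivative \<phi> (at x) v) * echar (- \<xi>) x"
        by (intro tendsto_mult tendsto_of_real tendsto_const)
    qed
  qed measurable
  moreover have "(\<lambda>j. fourier \<phi> \<xi> * ((echar \<xi> (e j *\<^sub>R v) - 1) / of_real (e j))) \<longlonglongrightarrow> fourier \<phi> \<xi> * (2 * of_real pi * \<i> * of_real (\<xi> \<bullet> v))"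
  proof (intro tendsto_mult tendsto_const)
    define c where "c = 2 * of_real pi * \<i> * of_real (\<xi> \<bullet> v)"
    have "((\<lambda>z. exp (c * z)) has_field_derivative c) (at 0)"
      by (auto intro!: derivative_eq_intros)
    then have "((\<lambda>z. (exp (c * z) - 1) / z) \<longlongrightarrow> c) (at 0)" by (simp add: has_field_derivative_iff)
    moreover have "filterlim (\<lambda>j. complex_of_real (e j)) (at 0) sequentially"
      using e e0 by (auto simp: filterlim_at intro!: always_eventually less_imp_neq[symmetric] tendsto_of_real[of _ 0, simplified])
    ultimately have "(\<lambda>j. (exp (c * of_real (e j)) - 1) / of_real (e j)) \<longlonglongrightarrow> c" by (rule filterlim_compose)
    then show "(\<lambda>j. (echar \<xi> (e j *\<^sub>R v) - 1) / of_real (e j)) \<longlonglongrightarrow> 2 * of_real pi * \<i> * of_real (\<xi> \<bullet> v)"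
      by (simp add: echar_def c_def mult_ac)
  qed
  ultimately have "(LINT x|lborel. complex_of_real (frechet_derivative \<phi> (at x) v) * echar (- \<xi>) x) = fourier \<phi> \<xi> * (2 * of_real pi * \<i> * of_real (\<xi> \<bullet> v))"
    unfolding 1 by (rule LIMSEQ_unique)
  then show ?thesis by (subst fourier_lborel) (auto simp: mult.commute)
qed

text \<open>With the \<open>2 \<pi>\<close> in the exponent of \<^const>\<open>fourier\<close>, the usual \<open>-\<Delta>\<close> has the symbol \<open>4 \<pi>\<^sup>2 |\<xi>|\<^sup>2\<close>.\<close>

definition scaled_laplacian :: "('a::euclidean_space \<Rightarrow> real) \<Rightarrow> 'a \<Rightarrow> real" where
  "scaled_laplacian \<phi> x = (\<Sum>b\<in>Basis. - 1 / (4 * pi\<^sup>2) * frechet_derivative (\<lambda>y. frechet_derivative \<phi> (at y) b) (at x) b)"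

lemma scaled_laplacian_test_function:
  fixes \<phi> :: "'a::euclidean_space \<Rightarrow> real"
  assumes \<phi>: "test_function \<phi>"
  shows "continuous_on UNIV (scaled_laplacian \<phi>)" and "integrable lborel (scaled_laplacian \<phi>)"
    and "\<exists>B. \<forall>x. \<bar>scaled_laplacian \<phi> x\<bar> \<le> B"
    and "fourier (scaled_laplacian \<phi>) \<xi> = of_real ((norm \<xi>)\<^sup>2) * fourier \<phi> \<xi>"
proof -
  let ?D = "\<lambda>b x. frechet_derivative (\<lambda>y. frechet_derivative \<phi> (at y) b) (at x) b"
  have tD: "test_function (?D b)" for b by (intro test_function_derivative \<phi>)
  show c: "continuous_on UNIV (scaled_laplacian \<phi>)" unfolding scaled_laplacian_def[abs_def]
    by (intro continuous_intros test_function_continuous tD)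
  show i: "integrable lborel (scaled_laplacian \<phi>)" unfolding scaled_laplacian_def[abs_def]
    by (intro Bochner_Integration.integrable_sum integrable_mult_right test_function_integrable tD)
  have "\<exists>B. \<forall>x. \<bar>?D b x\<bar> \<le> B" for b using test_function_bounded[OF tD[of b]] by metis
  then obtain B where B: "\<And>b x. \<bar>?D b x\<bar> \<le> B b" by metis
  have "\<bar>scaled_laplacian \<phi> x\<bar> \<le> (\<Sum>b\<in>Basis. 1 / (4 * pi\<^sup>2) * B b)" for x
    unfolding scaled_laplacian_def
    by (rule order_trans[OF sum_abs sum_mono]) (simp add: abs_mult divide_right_mono B)
  then show "\<exists>B. \<forall>x. \<bar>scaled_laplacian \<phi> x\<bar> \<le> B" by blast
  have fD: "fourier (?D b) \<xi> = - of_real (4 * pi\<^sup>2 * (\<xi> \<bullet> b)\<^sup>2) * fourier \<phi> \<xi>" for b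
    unfolding fourier_directional_derivative[OF test_function_derivative[OF \<phi>]] fourier_directional_derivative[OF \<phi>]
    by (simp add: power2_eq_square)
  have [measurable]: "scaled_laplacian \<phi> \<in> borel_measurable borel" using i by auto
  have "fourier (scaled_laplacian \<phi>) \<xi> = (LINT x|lborel. (\<Sum>b\<in>Basis. of_real (- 1 / (4 * pi\<^sup>2)) * (of_real (?D b x) * echar (- \<xi>) x)))"
    by (simp add: fourier_lborel scaled_laplacian_def sum_distrib_right sum_negf mult.assoc)
  also have "\<dots> = (\<Sum>b\<in>Basis. of_real (- 1 / (4 * pi\<^sup>2)) * fourier (?D b) \<xi>)"
    by (subst Bochner_Integration.integral_sum)
      (auto simp: fourier_lborel test_function_measurable[OF tD] intro!: integrable_mult_right integrable_mult_echar test_function_integrable tD)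
  also have "\<dots> = (\<Sum>b\<in>Basis. of_real ((\<xi> \<bullet> b)\<^sup>2) * fourier \<phi> \<xi>)"
    by (intro sum.cong refl) (simp add: fD)
  also have "\<dots> = of_real (\<Sum>b\<in>Basis. (\<xi> \<bullet> b)\<^sup>2) * fourier \<phi> \<xi>" by (simp add: sum_distrib_right)
  also have "(\<Sum>b\<in>Basis. (\<xi> \<bullet> b)\<^sup>2) = (norm \<xi>)\<^sup>2"
    by (subst power2_norm_eq_inner, subst euclidean_inner) (simp add: power2_eq_square)
  finally show "fourier (scaled_laplacian \<phi>) \<xi> = of_real ((norm \<xi>)\<^sup>2) * fourier \<phi> \<xi>" .
qed

text \<open>Half of the exponent absorbs |x|^2 through y * exp (- y) \<le> 1; the other half is the
  exponent of the kernel with doubled parameter.\<close>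

lemma gauss_kernel_second_moment_le:
  fixes x :: "'a::euclidean_space"
  assumes t: "0 < t"
  shows "(norm x)\<^sup>2 * gauss_kernel t x \<le> (2 * 2 powr (DIM('a) / 2) / pi\<^sup>2 * t) * gauss_kernel (2 * t) x"
proof -
  define y where "y = pi\<^sup>2 * (norm x)\<^sup>2 / (2 * t)"
  have y: "0 \<le> y" using t by (simp add: y_def)
  have "y \<le> exp y" using exp_ge_add_one_self[of y] by linarith
  then have "y * exp (- y) \<le> 1" by (simp add: exp_minus divide_simps)
  then have 1: "2 * t / pi\<^sup>2 * (y * exp (- y)) * exp (- y) \<le> 2 * t / pi\<^sup>2 * 1 * exp (- y)"
    using t by (intro mult_right_mono mult_left_mono) auto
  have "(norm x)\<^sup>2 = 2 * t / pi\<^sup>2 * y" using t by (simp add: y_def)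
  moreover have "exp (- (pi\<^sup>2 * (norm x)\<^sup>2 / t)) = exp (- y) * exp (- y)"
    using t by (simp add: y_def exp_add[symmetric])
  ultimately have "(norm x)\<^sup>2 * exp (- (pi\<^sup>2 * (norm x)\<^sup>2 / t)) \<le> 2 * t / pi\<^sup>2 * exp (- y)"
    using 1 by (simp only: mult.assoc mult_1_left mult_1_right)
  from mult_left_mono[OF this, of "(pi / t) powr (DIM('a) / 2)"]
  have "(norm x)\<^sup>2 * gauss_kernel t x \<le> (pi / t) powr (DIM('a) / 2) * (2 * t / pi\<^sup>2 * exp (- y))"
    by (simp add: gauss_kernel_def mult_ac)
  also have "(pi / t) powr (DIM('a) / 2) = 2 powr (DIM('a) / 2) * (pi / (2 * t)) powr (DIM('a) / 2)"
    using t by (simp add: powr_mult[symmetric])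
  also have "2 powr (DIM('a) / 2) * (pi / (2 * t)) powr (DIM('a) / 2) * (2 * t / pi\<^sup>2 * exp (- y)) =
     (2 * 2 powr (DIM('a) / 2) / pi\<^sup>2 * t) * gauss_kernel (2 * t) x"
    by (simp add: gauss_kernel_def y_def)
  finally show ?thesis .
qed

text \<open>The integrability weight of Levy measures: quadratic at the origin and bounded at
  infinity, like the bounds on the second differences of a test function.\<close>

definition truncated_sq :: "'a::real_normed_vector \<Rightarrow> real" where
  "truncated_sq z = min 1 ((norm z)\<^sup>2)"

lemma truncated_sq_nonneg[simp]: "0 \<le> truncated_sq z" and truncated_sq_le_1[simp]: "truncated_sq z \<le> 1"
  by (auto simp: truncated_sq_def)

lemma measurable_truncated_sq[measurable]: "truncated_sq \<in> borel_measurable borel"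
  unfolding truncated_sq_def[abs_def] by measurable

text \<open>The bound 1 is the mass of the Gaussian, the bound M * t comes from its second
  moment.\<close>

lemma gauss_kernel_truncated_moment:
  obtains M where "0 \<le> M" "\<And>t. 0 < t \<Longrightarrow> integrable lborel (\<lambda>z::'a::euclidean_space. truncated_sq z * gauss_kernel t z)"
    "\<And>t. 0 < t \<Longrightarrow> (LINT z::'a|lborel. truncated_sq z * gauss_kernel t z) \<le> min 1 (M * t)"
proof
  define M where "M = 2 * 2 powr (DIM('a) / 2) / pi\<^sup>2"
  show "0 \<le> 2 * 2 powr (DIM('a) / 2) / pi\<^sup>2" by simp
  fix t :: real assume t: "0 < t"
  have le1: "truncated_sq z * gauss_kernel t z \<le> gauss_kernel t z" for z :: 'a
    by (rule mult_left_le_one_le) auto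
  show i: "integrable lborel (\<lambda>z::'a. truncated_sq z * gauss_kernel t z)"
    by (rule Bochner_Integration.integrable_bound[OF integrable_gauss_kernel[OF t]]) (use le1 in \<open>auto simp: abs_mult\<close>)
  have "(LINT z::'a|lborel. truncated_sq z * gauss_kernel t z) \<le> (LINT z::'a|lborel. gauss_kernel t z)"
    by (rule integral_mono[OF i integrable_gauss_kernel[OF t] le1])
  moreover have "(LINT z::'a|lborel. truncated_sq z * gauss_kernel t z) \<le> (LINT z::'a|lborel. (M * t) * gauss_kernel (2 * t) z)"
  proof (rule integral_mono[OF i])
    show "integrable lborel (\<lambda>z::'a. (M * t) * gauss_kernel (2 * t) z)"
      using t by (intro integrable_mult_right integrable_gauss_kernel) simp
    fix z :: 'a
    have "truncated_sq z * gauss_kernel t z \<le> (norm z)\<^sup>2 * gauss_kernel t z"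
      by (intro mult_right_mono) (auto simp: truncated_sq_def)
    also have "\<dots> \<le> (M * t) * gauss_kernel (2 * t) z"
      unfolding M_def by (rule gauss_kernel_second_moment_le[OF t])
    finally show "truncated_sq z * gauss_kernel t z \<le> (M * t) * gauss_kernel (2 * t) z" .
  qed
  ultimately show "(LINT z::'a|lborel. truncated_sq z * gauss_kernel t z) \<le> min 1 (2 * 2 powr (DIM('a) / 2) / pi\<^sup>2 * t)"
    using t by (simp add: integral_gauss_kernel M_def)
qed

section \<open>The fractional Laplacian as an integral of second differences\<close>

context
  fixes s :: real
begin

text \<open>Up to a constant this is \<open>|z| powr (- n - 2 s)\<close>; the integral form reduces all computations to Gaussians.\<close>

definition levy_density :: "'a::euclidean_space \<Rightarrow> real" where
  "levy_density z = (LINT t|lborel. indicator {0<..} t * (t powr (- 1 - s) * gauss_kernel t z))"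

lemma measurable_levy_density[measurable]: "levy_density \<in> borel_measurable (borel :: 'a::euclidean_space measure)"
proof -
  have "(\<lambda>z::'a. LINT t|lborel. indicator {0<..} t * (t powr (- 1 - s) * gauss_kernel t z)) \<in> borel_measurable lborel"
    by measurable
  then show ?thesis unfolding levy_density_def[abs_def] by simp
qed

lemma levy_density_nonneg[simp]: "0 \<le> levy_density z"
  unfolding levy_density_def by (rule Bochner_Integration.integral_nonneg) (auto split: split_indicator)

text \<open>For 0 < s < 1 its value is Gamma (1 - s) / s.\<close>

definition levy_const :: real where
  "levy_const = (LINT t|lborel. indicator {0<..} t * (t powr (- 1 - s) * (1 - exp (- t))))"

text \<open>The prefactor normalises the symbol to |\<xi>|^(2s): a second difference has the symbol
  2 - 2 cos (2 pi \<xi> \<bullet> z), and integrating 1 - cos against \<open>levy_density\<close>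
  produces the factor \<open>levy_const\<close>.\<close>

definition fractional_laplacian :: "('a::euclidean_space \<Rightarrow> real) \<Rightarrow> 'a \<Rightarrow> real" where
  "fractional_laplacian \<phi> x = 1 / (2 * levy_const) * (LINT z|lborel. (2 * \<phi> x - \<phi> (x + z) - \<phi> (x - z)) * levy_density z)"

context
  assumes s: "0 < s" "s < 1"
begin

text \<open>The integrand is of order t powr (- s) at 0, integrable since s < 1, and of order at
  most t powr (- 1 - s) at infinity, integrable since s > 0.\<close>

lemma integrable_min_powr:
  assumes "0 \<le> M"
  shows "integrable lborel (\<lambda>t. indicator {0<..} t * (t powr (- 1 - s) * min 1 (M * t)))"
proof (rule Bochner_Integration.integrable_bound)
  show "integrable lborel (\<lambda>t::real. M * (indicator {0<..1} t * t powr (- s)) + indicator {1<..} t * t powr (- 1 - s))"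
    by (intro Bochner_Integration.integrable_add integrable_mult_right integrable_powr_near_0 integrable_powr_near_infinity) (use s in auto)
  show "AE t in lborel. norm (indicator {0<..} t * (t powr (- 1 - s) * min 1 (M * t))) \<le> norm (M * (indicator {0<..1} t * t powr (- s)) + indicator {1<..} t * t powr (- 1 - s))"
  proof (rule AE_I2)
    fix t :: real
    consider "t \<le> 0" | "0 < t" "t \<le> 1" | "1 < t" by linarith
    then show "norm (indicator {0<..} t * (t powr (- 1 - s) * min 1 (M * t))) \<le> norm (M * (indicator {0<..1} t * t powr (- s)) + indicator {1<..} t * t powr (- 1 - s))"
    proof cases
      case 2
      have "t powr (- 1 - s) * min 1 (M * t) \<le> t powr (- 1 - s) * (M * t)" by (intro mult_left_mono) auto
      also have "\<dots> = M * t powr (- s)" using 2 powr_add[of t "- 1 - s" 1] by simp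
      finally have "t powr (- 1 - s) * min 1 (M * t) \<le> M * t powr (- s)" .
      moreover have "0 \<le> min 1 (M * t)" using 2 assms by simp
      ultimately show ?thesis using 2 assms by (simp add: abs_mult)
    next
      case 3
      have "0 \<le> min 1 (M * t)" using 3 assms by simp
      then have "t powr (- 1 - s) * min 1 (M * t) \<le> t powr (- 1 - s) * 1" by (intro mult_left_mono) auto
      then show ?thesis using 3 \<open>0 \<le> min 1 (M * t)\<close> by (simp add: abs_mult)
    qed simp
  qed
qed measurable

lemma nn_levy_density:
  fixes z :: "'a::euclidean_space"
  assumes "z \<noteq> 0"
  shows "ennreal (levy_density z) = (\<integral>\<^sup>+t. ennreal (indicator {0<..} t * (t powr (- 1 - s) * gauss_kernel t z)) \<partial>lborel)"
  unfolding levy_density_def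
proof (rule nn_integral_eq_integral[symmetric])
  have "integrable lborel (\<lambda>t. pi powr (DIM('a) / 2) * (indicator {0<..} t * (t powr (- (DIM('a) / 2 + s) - 1) * exp (- ((pi\<^sup>2 * (norm z)\<^sup>2) / t)))))"
    by (intro integrable_mult_right inverse_gamma_scaled) (use s assms in auto)
  moreover have "pi powr (DIM('a) / 2) * (indicator {0<..} t * (t powr (- (DIM('a) / 2 + s) - 1) * exp (- ((pi\<^sup>2 * (norm z)\<^sup>2) / t)))) =
    indicator {0<..} t * (t powr (- 1 - s) * gauss_kernel t z)" for t
  proof (cases "0 < t")
    case True
    have "- (DIM('a) / 2 + s) - 1 = (- 1 - s) + - (DIM('a) / 2)" by simp
    then have "t powr (- (DIM('a) / 2 + s) - 1) = t powr (- 1 - s) * t powr (- (DIM('a) / 2))" by (simp only: powr_add)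
    then show ?thesis using True by (simp add: gauss_kernel_def powr_divide powr_minus_divide)
  qed simp
  ultimately show "integrable lborel (\<lambda>t. indicator {0<..} t * (t powr (- 1 - s) * gauss_kernel t z))" by (simp only:)
qed (auto split: split_indicator)

lemma nn_integral_levy:
  fixes \<psi> :: "'a::euclidean_space \<Rightarrow> real"
  assumes [measurable]: "\<psi> \<in> borel_measurable borel" and \<psi>0: "\<And>z. 0 \<le> \<psi> z"
    and i: "\<And>t. 0 < t \<Longrightarrow> integrable lborel (\<lambda>z. \<psi> z * gauss_kernel t z)"
  shows "(\<integral>\<^sup>+z. ennreal (\<psi> z * levy_density z) \<partial>lborel) =
    (\<integral>\<^sup>+t. ennreal (indicator {0<..} t * (t powr (- 1 - s) * (LINT z|lborel. \<psi> z * gauss_kernel t z))) \<partial>lborel)"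
proof -
  have "(\<integral>\<^sup>+z. ennreal (\<psi> z * levy_density z) \<partial>lborel) =
    (\<integral>\<^sup>+z. (\<integral>\<^sup>+t. ennreal (\<psi> z * (indicator {0<..} t * (t powr (- 1 - s) * gauss_kernel t z))) \<partial>lborel) \<partial>lborel)"
  proof (rule nn_integral_cong_AE, rule AE_I[where N="{0}"])
    have "ennreal (\<psi> z * levy_density z) = (\<integral>\<^sup>+t. ennreal (\<psi> z * (indicator {0<..} t * (t powr (- 1 - s) * gauss_kernel t z))) \<partial>lborel)" if "z \<noteq> 0" for z
      using nn_levy_density[OF that] \<psi>0[of z] by (simp add: ennreal_mult' nn_integral_cmult)
    then show "{z \<in> space lborel. ennreal (\<psi> z * levy_density z) \<noteq> (\<integral>\<^sup>+t. ennreal (\<psi> z * (indicator {0<..} t * (t powr (- 1 - s) * gauss_kernel t z))) \<partial>lborel)} \<subseteq> {0}"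
      by blast
  qed auto
  also have "\<dots> = (\<integral>\<^sup>+t. (\<integral>\<^sup>+z. ennreal (\<psi> z * (indicator {0<..} t * (t powr (- 1 - s) * gauss_kernel t z))) \<partial>lborel) \<partial>lborel)"
    by (rule lborel_pair.Fubini') measurable
  also have "\<dots> = (\<integral>\<^sup>+t. ennreal (indicator {0<..} t * (t powr (- 1 - s) * (LINT z|lborel. \<psi> z * gauss_kernel t z))) \<partial>lborel)"
  proof (intro nn_integral_cong)
    fix t :: real
    show "(\<integral>\<^sup>+z. ennreal (\<psi> z * (indicator {0<..} t * (t powr (- 1 - s) * gauss_kernel t z))) \<partial>lborel) =
      ennreal (indicator {0<..} t * (t powr (- 1 - s) * (LINT z|lborel. \<psi> z * gauss_kernel t z)))"
    proof (cases "0 < t")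
      case True
      have h: "(\<integral>\<^sup>+z. ennreal (t powr (- 1 - s) * (\<psi> z * gauss_kernel t z)) \<partial>lborel) =
          ennreal (t powr (- 1 - s) * (LINT z|lborel. \<psi> z * gauss_kernel t z))"
        by (subst integral_mult_right_zero[symmetric], rule nn_integral_eq_integral) (use True \<psi>0 in \<open>auto intro!: integrable_mult_right i\<close>)
      have e: "\<psi> z * (indicator {0<..} t * (t powr (- 1 - s) * gauss_kernel t z)) = t powr (- 1 - s) * (\<psi> z * gauss_kernel t z)" for z
        using True by simp
      show ?thesis unfolding e h using True by simp
    qed simp
  qed
  finally show ?thesis .
qed

lemma integrable_levy_truncated:
  "integrable lborel (\<lambda>z::'a::euclidean_space. truncated_sq z * levy_density z)"
proof -
  obtain M where M: "0 \<le> M" "\<And>t. 0 < t \<Longrightarrow> integrable lborel (\<lambda>z::'a. truncated_sq z * gauss_kernel t z)"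
    "\<And>t. 0 < t \<Longrightarrow> (LINT z::'a|lborel. truncated_sq z * gauss_kernel t z) \<le> min 1 (M * t)"
    using gauss_kernel_truncated_moment by blast
  have "(\<integral>\<^sup>+z. ennreal (truncated_sq (z::'a) * levy_density z) \<partial>lborel) =
    (\<integral>\<^sup>+t. ennreal (indicator {0<..} t * (t powr (- 1 - s) * (LINT z::'a|lborel. truncated_sq z * gauss_kernel t z))) \<partial>lborel)"
    by (rule nn_integral_levy) (auto intro: M)
  also have "\<dots> \<le> (\<integral>\<^sup>+t. ennreal (indicator {0<..} t * (t powr (- 1 - s) * min 1 (M * t))) \<partial>lborel)"
    by (intro nn_integral_mono ennreal_leI) (auto intro!: mult_left_mono M(3)[THEN order_trans] split: split_indicator)
  also have "\<dots> < \<infinity>"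
    using integrable_min_powr[OF M(1)] M(1)
    by (subst nn_integral_eq_integral) (auto split: split_indicator)
  finally show ?thesis by (intro integrableI_nonneg) auto
qed

lemma integrable_levy_const: "integrable lborel (\<lambda>t. indicator {0<..} t * (t powr (- 1 - s) * (1 - exp (- t))))"
proof (rule Bochner_Integration.integrable_bound[OF integrable_min_powr[of 1]])
  have "1 - exp (- t) \<le> min 1 (1 * t)" if "0 < t" for t :: real
    using exp_ge_add_one_self[of "- t"] by simp
  then show "AE t in lborel. norm (indicator {0<..} t * (t powr (- 1 - s) * (1 - exp (- t)))) \<le> norm (indicator {0<..} t * (t powr (- 1 - s) * min 1 (1 * t)))"
    by (intro AE_I2) (auto simp: abs_mult intro!: mult_left_mono split: split_indicator)
qed auto

lemma levy_const_pos: "0 < levy_const"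
  unfolding levy_const_def
  by (rule integral_pos_of_pos_on[where A="{0<..<1}", OF integrable_levy_const]) (auto split: split_indicator)

lemma gauss_kernel_cos:
  fixes \<xi> :: "'a::euclidean_space"
  assumes t: "0 < t"
  shows "integrable lborel (\<lambda>z. (1 - cos (2 * pi * (\<xi> \<bullet> z))) * gauss_kernel t z)"
    and "(LINT z|lborel. (1 - cos (2 * pi * (\<xi> \<bullet> z))) * gauss_kernel t z) = 1 - exp (- (t * (norm \<xi>)\<^sup>2))"
proof -
  have i: "integrable lborel (gauss_kernel t :: 'a \<Rightarrow> real)" by (rule integrable_gauss_kernel[OF t])
  have ie: "integrable lborel (\<lambda>z. complex_of_real (gauss_kernel t z) * echar \<xi> z)" by (rule integrable_mult_echar[OF i])
  have re: "Re (complex_of_real (gauss_kernel t z) * echar \<xi> z) = cos (2 * pi * (\<xi> \<bullet> z)) * gauss_kernel t z" for z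
    by (simp add: echar_def Re_exp)
  have ic: "integrable lborel (\<lambda>z. cos (2 * pi * (\<xi> \<bullet> z)) * gauss_kernel t z)"
    using integrable_Re[OF ie] by (simp only: re)
  have "(LINT z|lborel. cos (2 * pi * (\<xi> \<bullet> z)) * gauss_kernel t z) = Re (LINT z|lborel. complex_of_real (gauss_kernel t z) * echar \<xi> z)"
    using integral_Re[OF ie] by (simp only: re)
  also have "\<dots> = exp (- (t * (norm \<xi>)\<^sup>2))" by (simp add: fourier_gauss_kernel[OF t])
  finally have "(LINT z|lborel. cos (2 * pi * (\<xi> \<bullet> z)) * gauss_kernel t z) = exp (- (t * (norm \<xi>)\<^sup>2))" .
  then show "(LINT z|lborel. (1 - cos (2 * pi * (\<xi> \<bullet> z))) * gauss_kernel t z) = 1 - exp (- (t * (norm \<xi>)\<^sup>2))"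
    using i ic by (simp add: left_diff_distrib integral_gauss_kernel[OF t])
  show "integrable lborel (\<lambda>z. (1 - cos (2 * pi * (\<xi> \<bullet> z))) * gauss_kernel t z)"
    using i ic by (simp add: left_diff_distrib)
qed

text \<open>The Gaussian average of 1 - cos (2 pi \<xi> \<bullet> z) is 1 - exp (- t |\<xi>|^2).
  This depends on t |\<xi>|^2 only, and rescaling t extracts |\<xi>|^(2s) from the weight t powr (-
  1 - s).\<close>

lemma levy_khintchine:
  fixes \<xi> :: "'a::euclidean_space"
  shows "(LINT z|lborel. (1 - cos (2 * pi * (\<xi> \<bullet> z))) * levy_density z) = levy_const * norm \<xi> powr (2 * s)"
proof (cases "\<xi> = 0")
  case False
  define r where "r = (norm \<xi>)\<^sup>2"
  have r: "0 < r" using False by (simp add: r_def)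
  define f where "f t = indicator {0<..} t * (t powr (- 1 - s) * (1 - exp (- t)))" for t :: real
  have f0: "0 \<le> f t" for t by (auto simp: f_def split: split_indicator)
  have fm[measurable]: "f \<in> borel_measurable borel" unfolding f_def by measurable
  have sc: "indicator {0<..} t * (t powr (- 1 - s) * (1 - exp (- (t * r)))) = r powr (1 + s) * f (0 + r * t)" for t
  proof (cases "0 < t")
    case True
    have "r powr (1 + s) * (r * t) powr (- 1 - s) = t powr (- 1 - s)"
      using True r powr_add[of r "1 + s" "- 1 - s"] by (simp add: powr_mult)
    then show ?thesis using True r by (simp add: f_def mult.commute)
  next
    case False
    then have "\<not> 0 < r * t" using r by (simp add: zero_less_mult_iff)
    then show ?thesis using False by (simp add: f_def)
  qed
  have "(\<integral>\<^sup>+z. ennreal ((1 - cos (2 * pi * (\<xi> \<bullet> z))) * levy_density z) \<partial>lborel) =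
    (\<integral>\<^sup>+t. ennreal (indicator {0<..} t * (t powr (- 1 - s) * (1 - exp (- (t * r))))) \<partial>lborel)"
    by (subst nn_integral_levy) (auto simp: gauss_kernel_cos r_def intro!: nn_integral_cong split: split_indicator)
  also have "\<dots> = ennreal (r powr (1 + s)) * (\<integral>\<^sup>+t. ennreal (f (0 + r * t)) \<partial>lborel)"
    unfolding sc by (subst nn_integral_cmult[symmetric]) (auto simp: ennreal_mult' f0)
  also have "(\<integral>\<^sup>+t. ennreal (f (0 + r * t)) \<partial>lborel) = ennreal (1 / r) * (\<integral>\<^sup>+t. ennreal (f t) \<partial>lborel)"
  proof -
    have "(\<integral>\<^sup>+t. ennreal (f t) \<partial>lborel) = ennreal r * (\<integral>\<^sup>+t. ennreal (f (0 + r * t)) \<partial>lborel)"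
      using nn_integral_real_affine[of "\<lambda>t. ennreal (f t)" r 0] r by simp
    then have "ennreal (1 / r) * (\<integral>\<^sup>+t. ennreal (f t) \<partial>lborel) = ennreal (1 / r * r) * (\<integral>\<^sup>+t. ennreal (f (0 + r * t)) \<partial>lborel)"
      using r by (simp only: ennreal_mult' mult.assoc less_imp_le divide_nonneg_pos zero_le_one)
    then show ?thesis using r by simp
  qed
  also have "(\<integral>\<^sup>+t. ennreal (f t) \<partial>lborel) = ennreal levy_const"
    unfolding levy_const_def f_def using integrable_levy_const f0
    by (intro nn_integral_eq_integral) (auto simp: f_def)
  also have "ennreal (r powr (1 + s)) * (ennreal (1 / r) * ennreal levy_const) = ennreal (r powr (1 + s) * (1 / r) * levy_const)"
    using r levy_const_pos by (simp add: ennreal_mult'[symmetric] mult.assoc)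
  also have "r powr (1 + s) * (1 / r) = norm \<xi> powr (2 * s)"
    using r powr_diff[of r "1 + s" 1] by (simp add: norm_sq_powr[symmetric] r_def)
  finally have "(\<integral>\<^sup>+z. ennreal ((1 - cos (2 * pi * (\<xi> \<bullet> z))) * levy_density z) \<partial>lborel) = ennreal (norm \<xi> powr (2 * s) * levy_const)" .
  then show ?thesis using levy_const_pos
    by (subst integral_eq_nn_integral) (auto intro!: AE_I2 mult_nonneg_nonneg simp: mult.commute)
qed simp

text \<open>The second differences are bounded by a multiple of \<open>truncated_sq z\<close> in two
  norms with respect to x. The supremum norm gives boundedness and, by dominated convergence,
  continuity; the L^1 norm gives integrability and lets Fubini compute the transform.\<close>

lemma fractional_laplacian_test_function:
  fixes \<phi> :: "'a::euclidean_space \<Rightarrow> real"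
  assumes \<phi>: "test_function \<phi>"
  shows "continuous_on UNIV (fractional_laplacian \<phi>)" and "integrable lborel (fractional_laplacian \<phi>)"
    and "\<exists>B. \<forall>x. \<bar>fractional_laplacian \<phi> x\<bar> \<le> B"
    and "fourier (fractional_laplacian \<phi>) \<xi> = of_real (norm \<xi> powr (2 * s)) * fourier \<phi> \<xi>"
proof -
  note [measurable] = test_function_measurable[OF \<phi>]
  obtain R where R: "0 < R" "\<And>x. R < norm x \<Longrightarrow> \<phi> x = 0" using test_function_support[OF \<phi>] by blast
  obtain B1 where B1: "0 \<le> B1" "\<And>x. \<bar>\<phi> x\<bar> \<le> B1" using test_function_bounded[OF \<phi>] by blast
  obtain B2 where B2: "0 \<le> B2" "\<And>x z. \<bar>2 * \<phi> x - \<phi> (x + z) - \<phi> (x - z)\<bar> \<le> B2 * (norm z)\<^sup>2"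
    using test_function_second_difference[OF \<phi>] by blast
  have int: "integrable lborel \<phi>" by (rule test_function_integrable[OF \<phi>])
  define d where "d z x = 2 * \<phi> x - \<phi> (x + z) - \<phi> (x - z)" for z x
  have [measurable]: "(\<lambda>p. d (fst p) (snd p)) \<in> borel_measurable (borel \<Otimes>\<^sub>M borel)" unfolding d_def by measurable
  have [measurable]: "d z \<in> borel_measurable borel" for z unfolding d_def by measurable
  have [measurable]: "(\<lambda>z. d z x) \<in> borel_measurable borel" for x unfolding d_def by measurable
  define B where "B = 4 * B1 + B2"
  have B: "0 \<le> B" using B1 B2 by (simp add: B_def)
  have db: "\<bar>d z x\<bar> \<le> B * truncated_sq z" for z x
  proof (cases "1 \<le> (norm z)\<^sup>2")
    case True
    have "\<bar>d z x\<bar> \<le> 4 * B1" unfolding d_def using B1(2)[of x] B1(2)[of "x + z"] B1(2)[of "x - z"] by linarith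
    then show ?thesis using True B2 by (simp add: truncated_sq_def B_def)
  next
    case False
    have "\<bar>d z x\<bar> \<le> B2 * (norm z)\<^sup>2" unfolding d_def by (rule B2)
    also have "\<dots> \<le> B * (norm z)\<^sup>2" using B1 by (intro mult_right_mono) (auto simp: B_def)
    finally show ?thesis using False by (simp add: truncated_sq_def)
  qed
  let ?J = "levy_density :: 'a \<Rightarrow> real"
  have Wi: "integrable lborel (\<lambda>z::'a. B * (truncated_sq z * ?J z))"
    by (intro integrable_mult_right integrable_levy_truncated)
  have dJ: "\<bar>d z x * ?J z\<bar> \<le> B * (truncated_sq z * ?J z)" for z x
    using mult_right_mono[OF db[of z x], of "?J z"] by (simp add: abs_mult mult.assoc)
  define g where "g x = (LINT z|lborel. d z x * ?J z)" for x
  have fg: "fractional_laplacian \<phi> = (\<lambda>x. 1 / (2 * levy_const) * g x)"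
    by (simp add: fun_eq_iff fractional_laplacian_def g_def d_def)
  have "continuous_on UNIV g"
    unfolding continuous_on_sequentially
  proof (clarsimp simp: o_def)
    fix X x assume X: "X \<longlonglongrightarrow> (x::'a)"
    have p: "(\<lambda>i. \<phi> (Y i)) \<longlonglongrightarrow> \<phi> y" if "Y \<longlonglongrightarrow> y" for Y y
      using test_function_continuous[OF \<phi>] that by (auto intro: continuous_on_tendsto_compose)
    show "(\<lambda>i. g (X i)) \<longlonglongrightarrow> g x"
      unfolding g_def
    proof (rule integral_dominated_convergence[OF _ _ Wi])
      show "AE z in lborel. (\<lambda>i. d z (X i) * ?J z) \<longlonglongrightarrow> d z x * ?J z"
        unfolding d_def by (intro AE_I2 tendsto_intros p X)
    qed (use dJ in auto)
  qed
  then show "continuous_on UNIV (fractional_laplacian \<phi>)"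
    unfolding fg by (intro continuous_intros)
  have "\<bar>g x\<bar> \<le> (LINT z::'a|lborel. B * (truncated_sq z * ?J z))" for x
  proof -
    have "norm (g x) \<le> (LINT z::'a|lborel. B * (truncated_sq z * ?J z))" unfolding g_def
    proof (rule Bochner_Integration.integral_norm_bound_integral[OF _ Wi])
      show "integrable lborel (\<lambda>z. d z x * ?J z)"
        by (rule Bochner_Integration.integrable_bound[OF Wi]) (use dJ order_trans[OF dJ abs_ge_self] in auto)
      show "norm (d z x * ?J z) \<le> B * (truncated_sq z * ?J z)" for z using dJ by simp
    qed
    then show ?thesis by simp
  qed
  then have "\<forall>x. \<bar>fractional_laplacian \<phi> x\<bar> \<le> \<bar>1 / (2 * levy_const)\<bar> * (LINT z::'a|lborel. B * (truncated_sq z * ?J z))"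
    unfolding fg abs_mult by (intro allI mult_left_mono) auto
  then show "\<exists>B. \<forall>x. \<bar>fractional_laplacian \<phi> x\<bar> \<le> B" by blast
  have i1: "integrable lborel (\<lambda>x. \<phi> (x + z))" for z by (rule integrable_translation[OF int])
  have i2: "integrable lborel (\<lambda>x. \<phi> (x - z))" for z using i1[of "- z"] by simp
  have di: "integrable lborel (d z)" for z
    unfolding d_def by (intro Bochner_Integration.integrable_diff integrable_mult_right int i1 i2)
  \<comment> \<open>For |z| \<le> 1 the second difference lives in the ball of radius R + 1 and is
    at most B2 |z|^2; for larger z its L^1 norm is at most four times that of \<phi>.\<close>
  define A where "A = B2 * measure lborel (cball (0::'a) (R + 1)) + 4 * (LINT x|lborel. \<bar>\<phi> x\<bar>)"
  have A0: "0 \<le> A" using B2 by (auto simp: A_def intro!: add_nonneg_nonneg mult_nonneg_nonneg Bochner_Integration.integral_nonneg)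
  have dx: "(LINT x|lborel. \<bar>d z x\<bar>) \<le> A * truncated_sq z" for z
  proof (cases "norm z \<le> 1")
    case True
    have sq: "(norm z)\<^sup>2 \<le> 1" using True by (simp add: power_le_one)
    have "(LINT x|lborel. \<bar>d z x\<bar>) \<le> (LINT x::'a|lborel. B2 * (norm z)\<^sup>2 * indicator (cball 0 (R + 1)) x)"
    proof (rule integral_mono)
      show "integrable lborel (\<lambda>x::'a. B2 * (norm z)\<^sup>2 * indicator (cball 0 (R + 1)) x)"
        by (intro integrable_mult_right integrable_indicator_cball)
      fix x :: 'a
      show "\<bar>d z x\<bar> \<le> B2 * (norm z)\<^sup>2 * indicator (cball 0 (R + 1)) x"
      proof (cases "norm x \<le> R + 1")
        case True then show ?thesis using B2(2)[of x z] by (simp add: d_def)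
      next
        case False
        then have "R < norm x" "R < norm (x + z)" "R < norm (x - z)"
          using True norm_diff_ineq[of x z] norm_triangle_ineq2[of x z] by linarith+
        then show ?thesis using False R by (simp add: d_def)
      qed
    qed (use di in auto)
    also have "\<dots> = B2 * measure lborel (cball (0::'a) (R + 1)) * (norm z)\<^sup>2" by simp
    also have "\<dots> \<le> A * (norm z)\<^sup>2"
      by (intro mult_right_mono) (auto simp: A_def intro!: Bochner_Integration.integral_nonneg)
    finally show ?thesis using sq by (simp add: truncated_sq_def)
  next
    case False
    then have "truncated_sq z = 1" by (simp add: truncated_sq_def min_def power_le_one_iff)
    have "(LINT x|lborel. \<bar>d z x\<bar>) \<le> (LINT x|lborel. 2 * \<bar>\<phi> x\<bar> + \<bar>\<phi> (x + z)\<bar> + \<bar>\<phi> (x - z)\<bar>)"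
    proof (rule integral_mono)
      show "integrable lborel (\<lambda>x. 2 * \<bar>\<phi> x\<bar> + \<bar>\<phi> (x + z)\<bar> + \<bar>\<phi> (x - z)\<bar>)"
        by (intro Bochner_Integration.integrable_add integrable_mult_right integrable_abs int i1 i2)
      show "\<bar>d z x\<bar> \<le> 2 * \<bar>\<phi> x\<bar> + \<bar>\<phi> (x + z)\<bar> + \<bar>\<phi> (x - z)\<bar>" for x unfolding d_def by linarith
    qed (use di in auto)
    also have "\<dots> = 2 * (LINT x|lborel. \<bar>\<phi> x\<bar>) + (LINT x|lborel. \<bar>\<phi> (x + z)\<bar>) + (LINT x|lborel. \<bar>\<phi> (x - z)\<bar>)"
      using int i1[of z] i2[of z] by simp
    also have "(LINT x|lborel. \<bar>\<phi> (x + z)\<bar>) = (LINT x|lborel. \<bar>\<phi> x\<bar>)"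
      by (rule integral_translation[where g="\<lambda>x. \<bar>\<phi> x\<bar>"]) measurable
    also have "(LINT x|lborel. \<bar>\<phi> (x - z)\<bar>) = (LINT x|lborel. \<bar>\<phi> x\<bar>)"
      using integral_translation[where g="\<lambda>x. \<bar>\<phi> x\<bar>" and h="- z"] by simp
    finally show ?thesis using B2 \<open>truncated_sq z = 1\<close> by (simp add: A_def add_increasing)
  qed
  have pi: "integrable (lborel \<Otimes>\<^sub>M lborel) (\<lambda>(z, x). d z x * ?J z)"
  proof (rule lborel_pair.Fubini_integrable)
    show "(\<lambda>(z, x). d z x * ?J z) \<in> borel_measurable (lborel \<Otimes>\<^sub>M lborel)" by measurable
    show "AE z in lborel. integrable lborel (\<lambda>x. case (z, x) of (z, x) \<Rightarrow> d z x * ?J z)" using di by auto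
    show "integrable lborel (\<lambda>z. LINT x|lborel. norm (case (z, x) of (z, x) \<Rightarrow> d z x * ?J z))"
    proof (rule Bochner_Integration.integrable_bound[OF integrable_mult_right[OF integrable_levy_truncated]])
      show "AE z in lborel. norm (LINT x|lborel. norm (case (z, x) of (z, x) \<Rightarrow> d z x * ?J z)) \<le> norm (A * (truncated_sq z * ?J z))"
      proof (rule AE_I2)
        fix z
        have "(LINT x|lborel. norm (case (z, x) of (z, x) \<Rightarrow> d z x * ?J z)) = (LINT x|lborel. \<bar>d z x\<bar>) * ?J z"
          by (simp add: abs_mult)
        also have "norm \<dots> \<le> A * truncated_sq z * ?J z"
          using mult_right_mono[OF dx[of z], of "?J z"] by (simp add: abs_mult Bochner_Integration.integral_nonneg)
        finally show "norm (LINT x|lborel. norm (case (z, x) of (z, x) \<Rightarrow> d z x * ?J z)) \<le> norm (A * (truncated_sq z * ?J z))"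
          using A0 by (simp add: mult.assoc)
      qed
    qed measurable
  qed
  have gi: "integrable lborel g"
    using lborel_pair.integrable_snd[OF pi] by (simp add: g_def[abs_def])
  then show fi: "integrable lborel (fractional_laplacian \<phi>)" unfolding fg by (rule integrable_mult_right)
  have [measurable]: "g \<in> borel_measurable borel" using gi by auto
  have pie: "integrable (lborel \<Otimes>\<^sub>M lborel) (\<lambda>(z, x). complex_of_real (d z x * ?J z) * echar (- \<xi>) x)"
    by (rule Bochner_Integration.integrable_bound[OF pi]) (auto simp: norm_mult abs_mult)
  have "fourier g \<xi> = (LINT x|lborel. LINT z|lborel. complex_of_real (d z x * ?J z) * echar (- \<xi>) x)"
    by (simp add: fourier_lborel g_def integral_mult_left_zero integral_complex_of_real del: of_real_mult)
  also have "\<dots> = (LINT z|lborel. LINT x|lborel. complex_of_real (d z x * ?J z) * echar (- \<xi>) x)"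
    by (rule lborel_pair.Fubini_integral[OF pie])
  also have "\<dots> = (LINT z|lborel. of_real (2 * ((1 - cos (2 * pi * (\<xi> \<bullet> z))) * ?J z)) * fourier \<phi> \<xi>)"
  proof (intro Bochner_Integration.integral_cong refl)
    fix z
    have e1: "integrable lborel (\<lambda>x. complex_of_real (\<phi> x) * echar (- \<xi>) x)"
      "integrable lborel (\<lambda>x. complex_of_real (\<phi> (x + z)) * echar (- \<xi>) x)"
      "integrable lborel (\<lambda>x. complex_of_real (\<phi> (x - z)) * echar (- \<xi>) x)"
      by (intro integrable_mult_echar int i1 i2)+
    have cs: "echar \<xi> z + echar \<xi> (- z) = of_real (2 * cos (2 * pi * (\<xi> \<bullet> z)))"
      by (simp add: echar_def complex_eq_iff Re_exp Im_exp)
    have "(LINT x|lborel. complex_of_real (d z x * ?J z) * echar (- \<xi>) x) =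
      (LINT x|lborel. of_real (?J z) * (2 * (complex_of_real (\<phi> x) * echar (- \<xi>) x) - complex_of_real (\<phi> (x + z)) * echar (- \<xi>) x - complex_of_real (\<phi> (x - z)) * echar (- \<xi>) x))"
      by (intro Bochner_Integration.integral_cong refl) (simp add: d_def algebra_simps)
    also have "\<dots> = of_real (?J z) * (2 * fourier \<phi> \<xi> - echar \<xi> z * fourier \<phi> \<xi> - echar \<xi> (- z) * fourier \<phi> \<xi>)"
      using e1 fourier_translation[OF int, of z \<xi>] fourier_translation[OF int, of "- z" \<xi>] by (simp add: fourier_lborel)
    also have "\<dots> = of_real (?J z) * (2 - (echar \<xi> z + echar \<xi> (- z))) * fourier \<phi> \<xi>" by (simp add: algebra_simps)
    finally show "(LINT x|lborel. complex_of_real (d z x * ?J z) * echar (- \<xi>) x) = of_real (2 * ((1 - cos (2 * pi * (\<xi> \<bullet> z))) * ?J z)) * fourier \<phi> \<xi>"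
      unfolding cs by (simp add: algebra_simps)
  qed
  also have "\<dots> = of_real (2 * (levy_const * norm \<xi> powr (2 * s))) * fourier \<phi> \<xi>"
    unfolding integral_mult_left_zero integral_complex_of_real integral_mult_right_zero levy_khintchine ..
  finally have fgx: "fourier g \<xi> = of_real (2 * (levy_const * norm \<xi> powr (2 * s))) * fourier \<phi> \<xi>" .
  have "fourier (fractional_laplacian \<phi>) \<xi> = of_real (1 / (2 * levy_const)) * fourier g \<xi>"
    unfolding fg by (simp add: fourier_lborel mult.assoc)
  then show "fourier (fractional_laplacian \<phi>) \<xi> = of_real (norm \<xi> powr (2 * s)) * fourier \<phi> \<xi>"
    unfolding fgx using levy_const_pos by simp
qed

end

end

subsection \<open>The fundamental solution\<close>

text \<open>The convolution of \<open>v\<close> with a Gaussian is an integral against the transform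
  of \<open>v\<close>, hence vanishes; as t tends to 0 these convolutions tend to \<open>v x\<close>
  by continuity. The transform may be left open at the origin, a single point, without changing the
  integral.\<close>

lemma fourier_eq_0_imp_eq_0:
  fixes v :: "'a::euclidean_space \<Rightarrow> real"
  assumes cont: "continuous_on UNIV v" and bdd: "\<And>x. \<bar>v x\<bar> \<le> M" and int: "integrable lborel v"
    and zero: "\<And>\<xi>. \<xi> \<noteq> 0 \<Longrightarrow> fourier v \<xi> = 0"
  shows "v x = 0"
proof -
  have [measurable]: "v \<in> borel_measurable borel" using int by auto
  have M: "0 \<le> M" using bdd[of x] abs_ge_zero order_trans by blast
  have smooth0: "(LINT z|lborel. gauss_kernel t z * v (x - z)) = 0" if t: "0 < t" for t
  proof -
    let ?F = "\<lambda>y \<xi>. complex_of_real (v y * exp (- (t * (norm \<xi>)\<^sup>2))) * echar (x - y) \<xi>"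
    have Fi: "integrable (lborel \<Otimes>\<^sub>M lborel) (case_prod ?F)"
      by (rule Bochner_Integration.integrable_bound[OF integrable_pair_mult[OF int integrable_gaussian[OF t]]])
        (auto simp: norm_mult abs_mult)
    have ee: "echar (x - y) \<xi> = echar x \<xi> * echar (- \<xi>) y" for y \<xi>
      by (simp add: echar_def inner_diff_left right_diff_distrib exp_diff exp_minus inner_commute[of y] divide_inverse)
    have "complex_of_real (LINT y|lborel. gauss_kernel t (x - y) * v y) = (LINT y|lborel. LINT \<xi>|lborel. ?F y \<xi>)"
    proof -
      have "(LINT \<xi>|lborel. ?F y \<xi>) = of_real (gauss_kernel t (x - y) * v y)" for y
      proof -
        have "(LINT \<xi>|lborel. ?F y \<xi>) = (LINT \<xi>|lborel. of_real (v y) * (of_real (exp (- (t * (norm \<xi>)\<^sup>2))) * echar (x - y) \<xi>))"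
          by (simp add: mult.assoc)
        also have "\<dots> = of_real (v y) * of_real (gauss_kernel t (x - y))"
          by (simp only: integral_mult_right_zero fourier_gaussian[OF t])
        finally show ?thesis by (simp add: mult.commute)
      qed
      then show ?thesis by (simp only: integral_complex_of_real)
    qed
    also have "\<dots> = (LINT \<xi>|lborel. LINT y|lborel. ?F y \<xi>)"
      by (rule lborel_pair.Fubini_integral[OF Fi, symmetric])
    also have "\<dots> = (LINT \<xi>|lborel. of_real (exp (- (t * (norm \<xi>)\<^sup>2))) * echar x \<xi> * fourier v \<xi>)"
    proof (intro Bochner_Integration.integral_cong refl)
      fix \<xi> :: 'a
      have "(LINT y|lborel. ?F y \<xi>) = (LINT y|lborel. (of_real (exp (- (t * (norm \<xi>)\<^sup>2))) * echar x \<xi>) * (of_real (v y) * echar (- \<xi>) y))"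
        unfolding ee by (simp add: mult_ac)
      then show "(LINT y|lborel. ?F y \<xi>) = of_real (exp (- (t * (norm \<xi>)\<^sup>2))) * echar x \<xi> * fourier v \<xi>"
        by (simp only: integral_mult_right_zero fourier_lborel[OF \<open>v \<in> borel_measurable borel\<close>])
    qed
    also have "\<dots> = 0"
    proof (rule integral_eq_zero_AE, rule AE_I[where N="{0}"])
      show "{\<xi> \<in> space lborel. of_real (exp (- (t * (norm \<xi>)\<^sup>2))) * echar x \<xi> * fourier v \<xi> \<noteq> 0} \<subseteq> {0}"
        using zero by auto
    qed auto
    finally have "(LINT y|lborel. gauss_kernel t (x - y) * v y) = 0" by simp
    then show ?thesis
      using integral_reflection[where g="\<lambda>z. gauss_kernel t z * v (x - z)" and a=x] by simp
  qed
  obtain C where C: "0 \<le> C" "\<And>t. 0 < t \<Longrightarrow> integrable lborel (\<lambda>z::'a. truncated_sq z * gauss_kernel t z)"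
    "\<And>t. 0 < t \<Longrightarrow> (LINT z::'a|lborel. truncated_sq z * gauss_kernel t z) \<le> min 1 (C * t)"
    using gauss_kernel_truncated_moment by blast
  have small: "\<bar>v x\<bar> \<le> \<epsilon>" if \<epsilon>: "0 < \<epsilon>" for \<epsilon>
  proof -
    have "isCont v x" using cont continuous_on_eq_continuous_at by blast
    then obtain \<delta>0 where \<delta>0: "0 < \<delta>0" "\<And>y. dist y x < \<delta>0 \<Longrightarrow> dist (v y) (v x) < \<epsilon>"
      using \<epsilon> unfolding continuous_at_eps_delta by metis
    define \<delta> where "\<delta> = min \<delta>0 1"
    have \<delta>: "0 < \<delta>" "\<delta> \<le> 1" "\<delta> \<le> \<delta>0" using \<delta>0 by (auto simp: \<delta>_def)
    \<comment> \<open>Chosen so that D * \<delta>^2 = 2 M, the largest possible oscillation of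
      \<open>v\<close>. For |z| \<ge> \<delta> the weight \<open>truncated_sq z\<close> is at least
      \<delta>^2, because \<delta> \<le> 1.\<close>
    define D where "D = 2 * M / \<delta>\<^sup>2"
    have D: "0 \<le> D" using M by (simp add: D_def)
    have pt: "\<bar>v x - v (x - z)\<bar> \<le> \<epsilon> + D * truncated_sq z" for z
    proof (cases "norm z < \<delta>")
      case True
      then have "dist (v (x - z)) (v x) < \<epsilon>" using \<delta>(3) by (intro \<delta>0(2)) (simp add: dist_norm)
      then have "\<bar>v x - v (x - z)\<bar> \<le> \<epsilon>" by (simp add: dist_real_def)
      then show ?thesis using D by (simp add: add_increasing2)
    next
      case False
      have "\<delta>\<^sup>2 \<le> truncated_sq z" using False \<delta> by (auto simp: truncated_sq_def power_mono power_le_one)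
      then have "D * \<delta>\<^sup>2 \<le> D * truncated_sq z" using D by (rule mult_left_mono)
      moreover have "D * \<delta>\<^sup>2 = 2 * M" using \<delta> by (simp add: D_def)
      moreover have "\<bar>v x - v (x - z)\<bar> \<le> 2 * M" using bdd[of x] bdd[of "x - z"] by linarith
      ultimately show ?thesis using \<epsilon> by linarith
    qed
    have le: "\<bar>v x\<bar> \<le> \<epsilon> + D * (C * t)" if t: "0 < t" for t
    proof -
      have gi: "integrable lborel (gauss_kernel t :: 'a \<Rightarrow> real)" by (rule integrable_gauss_kernel[OF t])
      have gv: "integrable lborel (\<lambda>z. gauss_kernel t z * v (x - z))"
        by (rule Bochner_Integration.integrable_bound[OF integrable_mult_left[OF gi, of M]])
          (use bdd M in \<open>auto simp: abs_mult intro!: mult_left_mono\<close>)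
      have bi: "integrable lborel (\<lambda>z::'a. \<epsilon> * gauss_kernel t z + D * (truncated_sq z * gauss_kernel t z))"
        by (intro Bochner_Integration.integrable_add integrable_mult_right gi C(2) t)
      have "v x = (LINT z::'a|lborel. gauss_kernel t z * v x) - (LINT z|lborel. gauss_kernel t z * v (x - z))"
        by (simp add: smooth0[OF t] integral_gauss_kernel[OF t])
      also have "\<dots> = (LINT z|lborel. gauss_kernel t z * v x - gauss_kernel t z * v (x - z))"
        by (rule Bochner_Integration.integral_diff[symmetric, OF integrable_mult_left[OF gi] gv])
      finally have "\<bar>v x\<bar> = norm (LINT z|lborel. gauss_kernel t z * v x - gauss_kernel t z * v (x - z))" by simp
      also have "\<dots> \<le> (LINT z::'a|lborel. \<epsilon> * gauss_kernel t z + D * (truncated_sq z * gauss_kernel t z))"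
      proof (rule Bochner_Integration.integral_norm_bound_integral[OF _ bi])
        show "integrable lborel (\<lambda>z. gauss_kernel t z * v x - gauss_kernel t z * v (x - z))"
          by (intro Bochner_Integration.integrable_diff integrable_mult_left gi gv)
        fix z :: 'a
        have "norm (gauss_kernel t z * v x - gauss_kernel t z * v (x - z)) = gauss_kernel t z * \<bar>v x - v (x - z)\<bar>"
          by (simp add: right_diff_distrib[symmetric] abs_mult)
        also have "\<dots> \<le> gauss_kernel t z * (\<epsilon> + D * truncated_sq z)" by (intro mult_left_mono pt) simp
        finally show "norm (gauss_kernel t z * v x - gauss_kernel t z * v (x - z)) \<le> \<epsilon> * gauss_kernel t z + D * (truncated_sq z * gauss_kernel t z)"
          by (simp add: algebra_simps)
      qed
      also have "\<dots> = \<epsilon> + D * (LINT z::'a|lborel. truncated_sq z * gauss_kernel t z)"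
        by (subst Bochner_Integration.integral_add[OF integrable_mult_right[OF gi] integrable_mult_right[OF C(2)[OF t]]])
          (simp add: integral_gauss_kernel[OF t])
      also have "\<dots> \<le> \<epsilon> + D * (C * t)" using C(3)[OF t] D by (intro add_left_mono mult_left_mono) auto
      finally show ?thesis .
    qed
    have "((\<lambda>t. \<epsilon> + D * (C * t)) \<longlongrightarrow> \<epsilon> + D * (C * 0)) (at_right 0)" by (intro tendsto_intros)
    moreover have "\<forall>\<^sub>F t in at_right 0. \<bar>v x\<bar> \<le> \<epsilon> + D * (C * t)"
      using le by (auto simp: eventually_at_right_less intro: eventually_mono[OF eventually_at_right_less])
    ultimately have "\<bar>v x\<bar> \<le> \<epsilon> + D * (C * 0)" by (intro tendsto_lowerbound) auto
    then show ?thesis by simp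
  qed
  show ?thesis
  proof (rule ccontr)
    assume "v x \<noteq> 0"
    then show False using small[of "\<bar>v x\<bar> / 2"] by simp
  qed
qed

lemma integrable_conv_pair:
  fixes k f :: "'a::euclidean_space \<Rightarrow> real"
  assumes k: "integrable lborel k" and f: "integrable lborel f"
  shows "integrable (lborel \<Otimes>\<^sub>M lborel) (\<lambda>(y, x). k (x - y) * f y)"
proof (rule lborel_pair.Fubini_integrable)
  have [measurable]: "k \<in> borel_measurable borel" "f \<in> borel_measurable borel" using k f by auto
  show "(\<lambda>(y, x). k (x - y) * f y) \<in> borel_measurable (lborel \<Otimes>\<^sub>M lborel)" by measurable
  have kt: "integrable lborel (\<lambda>x. k (x - y))" for y using integrable_translation[OF k, of "- y"] by simp
  have "(LINT x|lborel. \<bar>k (x - y)\<bar>) = (LINT x|lborel. \<bar>k x\<bar>)" for y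
    using integral_translation[where g="\<lambda>x. \<bar>k x\<bar>" and h="- y"] by simp
  then have "(LINT x|lborel. norm (case (y, x) of (y, x) \<Rightarrow> k (x - y) * f y)) = (LINT x|lborel. \<bar>k x\<bar>) * \<bar>f y\<bar>" for y
    by (simp add: abs_mult)
  then show "integrable lborel (\<lambda>y. LINT x|lborel. norm (case (y, x) of (y, x) \<Rightarrow> k (x - y) * f y))"
    using f by simp
  show "AE y in lborel. integrable lborel (\<lambda>x. case (y, x) of (y, x) \<Rightarrow> k (x - y) * f y)"
    using kt by simp
qed

lemma
  fixes k h :: "'a::euclidean_space \<Rightarrow> real"
  assumes k: "integrable lborel k" and h: "integrable lborel h"
  shows integrable_convolution: "integrable lborel (\<lambda>x. LINT z|lborel. h (x - z) * k z)"
    and fourier_convolution: "fourier (\<lambda>x. LINT z|lborel. h (x - z) * k z) \<xi> = fourier k \<xi> * fourier h \<xi>"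
proof -
  have km[measurable]: "k \<in> borel_measurable borel" and hm[measurable]: "h \<in> borel_measurable borel" using k h by auto
  note p = integrable_conv_pair[OF h k]
  show i: "integrable lborel (\<lambda>x. LINT z|lborel. h (x - z) * k z)"
    using lborel_pair.integrable_snd[OF p] by simp
  have [measurable]: "(\<lambda>x. LINT z|lborel. h (x - z) * k z) \<in> borel_measurable borel" using i by auto
  have pe: "integrable (lborel \<Otimes>\<^sub>M lborel) (\<lambda>(z, x). complex_of_real (h (x - z) * k z) * echar (- \<xi>) x)"
    by (rule Bochner_Integration.integrable_bound[OF p]) (auto simp: norm_mult abs_mult)
  have "fourier (\<lambda>x. LINT z|lborel. h (x - z) * k z) \<xi> = (LINT x|lborel. LINT z|lborel. complex_of_real (h (x - z) * k z) * echar (- \<xi>) x)"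
    by (simp add: fourier_lborel integral_mult_left_zero integral_complex_of_real del: of_real_mult)
  also have "\<dots> = (LINT z|lborel. LINT x|lborel. complex_of_real (h (x - z) * k z) * echar (- \<xi>) x)"
    by (rule lborel_pair.Fubini_integral[OF pe])
  also have "\<dots> = (LINT z|lborel. of_real (k z) * echar (- \<xi>) z * fourier h \<xi>)"
  proof (intro Bochner_Integration.integral_cong refl)
    fix z
    have "(LINT x|lborel. complex_of_real (h (x - z) * k z) * echar (- \<xi>) x) = (LINT x|lborel. of_real (k z) * (complex_of_real (h (x + - z)) * echar (- \<xi>) x))"
      by (simp add: mult_ac)
    also have "\<dots> = of_real (k z) * (echar \<xi> (- z) * fourier h \<xi>)"
      by (simp only: integral_mult_right_zero fourier_translation[OF h])
    also have "echar \<xi> (- z) = echar (- \<xi>) z" by (simp add: echar_def)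
    finally show "(LINT x|lborel. complex_of_real (h (x - z) * k z) * echar (- \<xi>) x) = of_real (k z) * echar (- \<xi>) z * fourier h \<xi>"
      by (simp add: mult.assoc)
  qed
  also have "\<dots> = fourier k \<xi> * fourier h \<xi>"
    by (simp add: fourier_lborel)
  finally show "fourier (\<lambda>x. LINT z|lborel. h (x - z) * k z) \<xi> = fourier k \<xi> * fourier h \<xi>" .
qed

section \<open>The kernel as inverse of the operator, and the weak formulation\<close>

context
  fixes s :: real
  assumes s: "0 < s" "s < 1"
begin

text \<open>By Fubini the transform is the mixture of the functions exp (- t |\<xi>|^2), that is,
  the Laplace transform of the density at |\<xi>|^2, which is known for nonzero
  \<open>\<xi>\<close>.\<close>

lemma fourier_subord_kernel:
  fixes \<xi> :: "'a::euclidean_space"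
  assumes \<xi>: "\<xi> \<noteq> 0"
  shows "fourier (subord_kernel s) \<xi> = of_real (1 / (1 + symbol s \<xi>))"
proof -
  define P where "P t = indicator {0<..} t * subord_density 1 1 s t" for t
  have P: "integrable lborel P" unfolding P_def using s by (intro integrable_subord_density_indicator) auto
  have [measurable]: "P \<in> borel_measurable borel" using P by auto
  have P0: "P t = 0" if "\<not> 0 < t" for t using that by (simp add: P_def)
  have gabs: "(LINT x::'a|lborel. \<bar>P t * gauss_kernel t x\<bar>) = \<bar>P t\<bar>" for t
    by (cases "0 < t") (simp_all add: abs_mult integral_gauss_kernel P0)
  have gi: "integrable lborel (\<lambda>x::'a. P t * gauss_kernel t x)" for t
    by (cases "0 < t") (auto simp: P0 intro!: integrable_mult_right integrable_gauss_kernel)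
  have pi: "integrable (lborel \<Otimes>\<^sub>M lborel) (\<lambda>(t, x::'a). P t * gauss_kernel t x)"
  proof (rule lborel_pair.Fubini_integrable)
    show "(\<lambda>(t, x::'a). P t * gauss_kernel t x) \<in> borel_measurable (lborel \<Otimes>\<^sub>M lborel)" by measurable
    show "integrable lborel (\<lambda>t. LINT x::'a|lborel. norm (case (t, x) of (t, x) \<Rightarrow> P t * gauss_kernel t x))"
      using P by (simp add: gabs)
    show "AE t in lborel. integrable lborel (\<lambda>x::'a. case (t, x) of (t, x) \<Rightarrow> P t * gauss_kernel t x)"
      using gi by simp
  qed
  have pe: "integrable (lborel \<Otimes>\<^sub>M lborel) (\<lambda>(t, x::'a). complex_of_real (P t * gauss_kernel t x) * echar (- \<xi>) x)"
    by (rule Bochner_Integration.integrable_bound[OF pi]) (auto simp: norm_mult abs_mult)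
  have k: "subord_kernel s x = (LINT t|lborel. P t * gauss_kernel t x)" for x :: 'a
    by (simp add: subord_kernel_def P_def mult.assoc)
  have "fourier (subord_kernel s) \<xi> = (LINT x|lborel. LINT t|lborel. complex_of_real (P t * gauss_kernel t x) * echar (- \<xi>) x)"
    by (simp add: fourier_lborel k integral_mult_left_zero integral_complex_of_real del: of_real_mult)
  also have "\<dots> = (LINT t|lborel. LINT x|lborel. complex_of_real (P t * gauss_kernel t x) * echar (- \<xi>) x)"
    by (rule lborel_pair.Fubini_integral[OF pe])
  also have "\<dots> = (LINT t|lborel. complex_of_real (P t * exp (- (t * (norm \<xi>)\<^sup>2))))"
  proof (intro Bochner_Integration.integral_cong refl)
    fix t
    show "(LINT x|lborel. complex_of_real (P t * gauss_kernel t x) * echar (- \<xi>) x) = complex_of_real (P t * exp (- (t * (norm \<xi>)\<^sup>2)))"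
      using fourier_gauss_kernel[of t "- \<xi>"] by (cases "0 < t") (simp_all add: P0 mult.assoc)
  qed
  also have "\<dots> = of_real (1 / (1 + symbol s \<xi>))"
    unfolding integral_complex_of_real
    using subord_laplace_integral[OF s, of 1 1 \<xi>] \<xi> by (simp add: P_def symbol_def add.assoc)
  finally show ?thesis .
qed

text \<open>Here \<open>h\<close> plays the part of the operator plus identity applied to \<phi>.
  Both sides are continuous, bounded and integrable, and their transforms agree off the origin,
  where 1 / (1 + symbol s \<xi>) cancels the symbol.\<close>

lemma subord_kernel_convolution_inverse:
  fixes h \<phi> :: "'a::euclidean_space \<Rightarrow> real"
  assumes h: "continuous_on UNIV h" "integrable lborel h" "\<And>x. \<bar>h x\<bar> \<le> H"
    and \<phi>: "continuous_on UNIV \<phi>" "integrable lborel \<phi>" "\<And>x. \<bar>\<phi> x\<bar> \<le> B"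
    and F: "\<And>\<xi>. fourier h \<xi> = of_real (1 + symbol s \<xi>) * fourier \<phi> \<xi>"
  shows "(LINT z|lborel. h (x - z) * subord_kernel s z) = \<phi> x"
proof -
  let ?k = "subord_kernel s :: 'a \<Rightarrow> real"
  have ki: "integrable lborel ?k" by (rule integrable_subord_kernel[OF s])
  have k0: "0 \<le> ?k z" for z by (rule subord_kernel_nonneg[OF s])
  have [measurable]: "h \<in> borel_measurable borel" "\<phi> \<in> borel_measurable borel" using h \<phi> by auto
  define w where "w x = (LINT z|lborel. h (x - z) * ?k z)" for x
  have wi: "integrable lborel w" unfolding w_def by (rule integrable_convolution[OF ki h(2)])
  have hk: "integrable lborel (\<lambda>z. H * ?k z)" by (rule integrable_mult_right[OF ki])
  have bd: "\<bar>h (x - z) * ?k z\<bar> \<le> H * ?k z" for x z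
    using mult_right_mono[OF h(3)[of "x - z"] k0[of z]] k0[of z] by (simp add: abs_mult)
  have wc: "continuous_on UNIV w"
    unfolding continuous_on_sequentially
  proof (clarsimp simp: o_def)
    fix X x assume X: "X \<longlonglongrightarrow> (x::'a)"
    show "(\<lambda>i. w (X i)) \<longlonglongrightarrow> w x"
      unfolding w_def
    proof (rule integral_dominated_convergence[OF _ _ hk])
      have "(\<lambda>i. h (X i - z)) \<longlonglongrightarrow> h (x - z)" for z
        by (rule continuous_on_tendsto_compose[OF h(1)]) (auto intro: tendsto_intros X)
      then show "AE z in lborel. (\<lambda>i. h (X i - z) * ?k z) \<longlonglongrightarrow> h (x - z) * ?k z"
        by (intro AE_I2 tendsto_intros)
    qed (use bd in auto)
  qed
  have wb: "\<bar>w x\<bar> \<le> (LINT z|lborel. H * ?k z)" for x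
  proof -
    have "norm (w x) \<le> (LINT z|lborel. H * ?k z)" unfolding w_def
    proof (rule Bochner_Integration.integral_norm_bound_integral[OF _ hk])
      show "integrable lborel (\<lambda>z. h (x - z) * ?k z)"
        by (rule Bochner_Integration.integrable_bound[OF hk]) (use order_trans[OF bd abs_ge_self] in auto)
      show "norm (h (x - z) * ?k z) \<le> H * ?k z" for z using bd by simp
    qed
    then show ?thesis by simp
  qed
  have fw: "fourier w \<xi> = fourier \<phi> \<xi>" if "\<xi> \<noteq> 0" for \<xi>
  proof -
    have "0 < 1 + symbol s \<xi>" by (simp add: symbol_def add_pos_nonneg)
    then have "complex_of_real (1 + symbol s \<xi>) \<noteq> 0" by (metis of_real_eq_0_iff less_irrefl)
    then show ?thesis unfolding w_def fourier_convolution[OF ki h(2)] fourier_subord_kernel[OF that] F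
      by (simp del: of_real_add)
  qed
  have "w x - \<phi> x = 0"
  proof (rule fourier_eq_0_imp_eq_0[where v="\<lambda>x. w x - \<phi> x" and M="(LINT z|lborel. H * ?k z) + B"])
    show "\<bar>w x - \<phi> x\<bar> \<le> (LINT z|lborel. H * ?k z) + B" for x
      using wb[of x] \<phi>(3)[of x] by linarith
    show "continuous_on UNIV (\<lambda>x. w x - \<phi> x)" by (intro continuous_intros wc \<phi>)
    show "integrable lborel (\<lambda>x. w x - \<phi> x)" by (intro Bochner_Integration.integrable_diff wi \<phi>)
    fix \<xi> :: 'a assume \<xi>: "\<xi> \<noteq> 0"
    have [measurable]: "w \<in> borel_measurable borel" using wi by auto
    have "fourier (\<lambda>x. w x - \<phi> x) \<xi> = fourier w \<xi> - fourier \<phi> \<xi>"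
      using integrable_mult_echar[OF wi, of "- \<xi>"] integrable_mult_echar[OF \<phi>(2), of "- \<xi>"]
      by (simp add: fourier_lborel left_diff_distrib)
    then show "fourier (\<lambda>x. w x - \<phi> x) \<xi> = 0" by (simp add: fw[OF \<xi>])
  qed
  then show ?thesis by (simp add: w_def)
qed

text \<open>The bound \<open>|f| \<le> |f|\<^sup>q + 1\<close> takes the place of the inequalities of Young and Hoelder.\<close>

lemma integrable_dual_pair:
  fixes f h :: "'a::euclidean_space \<Rightarrow> real"
  assumes [measurable]: "f \<in> borel_measurable borel" and f: "integrable lborel (\<lambda>x. \<bar>f x\<bar> powr q)" and q: "1 \<le> q"
    and h: "integrable lborel h" "\<And>x. \<bar>h x\<bar> \<le> H"
  shows "integrable (lborel \<Otimes>\<^sub>M lborel) (\<lambda>(y, x). subord_kernel s (x - y) * f y * h x)"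
proof (rule Bochner_Integration.integrable_bound)
  let ?k = "subord_kernel s :: 'a \<Rightarrow> real"
  have [measurable]: "h \<in> borel_measurable borel" using h by auto
  have ki: "integrable lborel ?k" by (rule integrable_subord_kernel[OF s])
  have k0: "0 \<le> ?k z" for z by (rule subord_kernel_nonneg[OF s])
  have H: "0 \<le> H" using h(2)[of 0] abs_ge_zero order_trans by blast
  have 1: "integrable (lborel \<Otimes>\<^sub>M lborel) (\<lambda>(y, x). ?k (x - y) * \<bar>f y\<bar> powr q)"
    by (rule integrable_conv_pair[OF ki f])
  have "integrable (lborel \<Otimes>\<^sub>M lborel) (\<lambda>(x, y). ?k (y - x) * \<bar>h x\<bar>)"
    by (rule integrable_conv_pair[OF ki integrable_abs[OF h(1)]])
  then have "integrable (lborel \<Otimes>\<^sub>M lborel) (\<lambda>(y, x). ?k (y - x) * \<bar>h x\<bar>)"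
    by (drule_tac lborel_pair.integrable_product_swap) (simp add: split_beta)
  then have 2: "integrable (lborel \<Otimes>\<^sub>M lborel) (\<lambda>(y, x). ?k (x - y) * \<bar>h x\<bar>)"
    using subord_kernel_minus[OF s, of "x - y" for x y :: 'a] by simp
  show "integrable (lborel \<Otimes>\<^sub>M lborel) (\<lambda>p. H * (case p of (y, x) \<Rightarrow> ?k (x - y) * \<bar>f y\<bar> powr q) + (case p of (y, x) \<Rightarrow> ?k (x - y) * \<bar>h x\<bar>))"
    by (intro Bochner_Integration.integrable_add integrable_mult_right 1 2)
  show "AE p in lborel \<Otimes>\<^sub>M lborel. norm (case p of (y, x) \<Rightarrow> ?k (x - y) * f y * h x) \<le> norm (H * (case p of (y, x) \<Rightarrow> ?k (x - y) * \<bar>f y\<bar> powr q) + (case p of (y, x) \<Rightarrow> ?k (x - y) * \<bar>h x\<bar>))"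
  proof (rule AE_I2, clarify)
    fix y x :: 'a
    have "\<bar>f y\<bar> \<le> \<bar>f y\<bar> powr q + 1"
    proof (cases "\<bar>f y\<bar> \<le> 1")
      case False
      then show ?thesis using powr_mono[of 1 q "\<bar>f y\<bar>"] q by simp
    qed (simp add: add_increasing)
    then have "\<bar>f y\<bar> * \<bar>h x\<bar> \<le> (\<bar>f y\<bar> powr q + 1) * \<bar>h x\<bar>" by (rule mult_right_mono) simp
    also have "\<dots> \<le> H * \<bar>f y\<bar> powr q + \<bar>h x\<bar>"
      using mult_right_mono[OF h(2)[of x], of "\<bar>f y\<bar> powr q"] by (simp add: algebra_simps)
    finally have "?k (x - y) * (\<bar>f y\<bar> * \<bar>h x\<bar>) \<le> ?k (x - y) * (H * \<bar>f y\<bar> powr q + \<bar>h x\<bar>)"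
      using k0 by (rule mult_left_mono)
    moreover have "0 \<le> ?k (x - y) * (H * \<bar>f y\<bar> powr q + \<bar>h x\<bar>)" using k0 H by simp
    ultimately show "norm (?k (x - y) * f y * h x) \<le> norm (H * (?k (x - y) * \<bar>f y\<bar> powr q) + ?k (x - y) * \<bar>h x\<bar>)"
      using k0[of "x - y"] by (simp add: abs_mult algebra_simps)
  qed
  show "(\<lambda>(y, x). ?k (x - y) * f y * h x) \<in> borel_measurable (lborel \<Otimes>\<^sub>M lborel)"
    unfolding split_beta'
    by (intro borel_measurable_times measurable_compose[OF _ measurable_subord_kernel] measurable_compose[OF _ \<open>f \<in> _\<close>]
      measurable_compose[OF _ \<open>h \<in> _\<close>]) measurable
qed

lemma mixed_laplacian_exists:
  fixes \<phi> :: "'a::euclidean_space \<Rightarrow> real"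
  assumes \<phi>: "test_function \<phi>"
  obtains g B where "is_mixed_laplacian s \<phi> g" "integrable lborel g" "\<And>x. \<bar>g x\<bar> \<le> B"
proof -
  note l = scaled_laplacian_test_function[OF \<phi>] and fl = fractional_laplacian_test_function[OF s \<phi>]
  let ?g = "\<lambda>x. scaled_laplacian \<phi> x + fractional_laplacian s \<phi> x"
  obtain B1 B2 where B: "\<And>x. \<bar>scaled_laplacian \<phi> x\<bar> \<le> B1" "\<And>x. \<bar>fractional_laplacian s \<phi> x\<bar> \<le> B2"
    using l(3) fl(3) by blast
  have gi: "integrable lborel ?g" by (intro Bochner_Integration.integrable_add l fl)
  have gc: "continuous_on UNIV ?g" by (intro continuous_intros l fl)
  have m[measurable]: "scaled_laplacian \<phi> \<in> borel_measurable borel" "fractional_laplacian s \<phi> \<in> borel_measurable borel"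
    using l(2) fl(2) by auto
  have "fourier ?g \<xi> = fourier (scaled_laplacian \<phi>) \<xi> + fourier (fractional_laplacian s \<phi>) \<xi>" for \<xi>
    using integrable_mult_echar[OF l(2), of "- \<xi>"] integrable_mult_echar[OF fl(2), of "- \<xi>"]
    by (simp add: fourier_lborel distrib_right)
  then have "fourier ?g \<xi> = of_real (symbol s \<xi>) * fourier \<phi> \<xi>" for \<xi>
    by (simp add: l(4) fl(4) symbol_def distrib_right)
  moreover have "integrable lebesgue ?g" using gi by (subst integrable_completion) auto
  ultimately have "is_mixed_laplacian s \<phi> ?g" using gc by (simp add: is_mixed_laplacian_def)
  moreover have "\<bar>?g x\<bar> \<le> B1 + B2" for x using B(1)[of x] B(2)[of x] by linarith
  ultimately show ?thesis using gi that by blast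
qed

lemma mixed_kernel_eq_subord: "x \<noteq> 0 \<Longrightarrow> mixed_kernel s x = subord_kernel s x"
  by (rule mixed_kernel_eq[OF s]) (simp add: kernel_dom_def)

lemma measurable_mixed_kernel[measurable]: "mixed_kernel s \<in> borel_measurable (borel :: 'a::euclidean_space measure)"
proof -
  have "mixed_kernel s = (\<lambda>x::'a. if x = 0 then mixed_kernel s (0::'a) else subord_kernel s x)"
    by (simp add: fun_eq_iff mixed_kernel_eq_subord)
  moreover have "(\<lambda>x::'a. if x = 0 then mixed_kernel s (0::'a) else subord_kernel s x) \<in> borel_measurable borel" by measurable
  ultimately show ?thesis by simp
qed

text \<open>Fubini and the evenness of the kernel move the convolution from \<open>f\<close> to the
  test side, where the kernel inverts the operator and only \<phi> remains.\<close>

lemma mixed_kernel_solution: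
  fixes f :: "'a::euclidean_space \<Rightarrow> real"
  assumes q: "1 \<le> q" and f: "in_Lq q f"
  shows "(AE x in lebesgue. integrable lebesgue (\<lambda>y. mixed_kernel s (x - y) * f y))"
    and "distributional_solution s (conv (mixed_kernel s) f) f"
proof -
  let ?k = "subord_kernel s :: 'a \<Rightarrow> real" and ?K = "mixed_kernel s :: 'a \<Rightarrow> real"
  have fm[measurable]: "f \<in> borel_measurable lebesgue" and fq: "integrable lebesgue (\<lambda>x. \<bar>f x\<bar> powr q)"
    using f by (auto simp: in_Lq_def)
  \<comment> \<open>\<open>f\<close> is merely Lebesgue measurable, whereas Fubini is run on the
    product of Borel measures; \<open>f'\<close> is a Borel representative.\<close>
  obtain f' where f'm[measurable]: "f' \<in> borel_measurable borel" and ff': "AE x in lborel. f x = f' x"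
    using completion_ex_borel_measurable_real[OF fm] by auto
  have f'q: "integrable lborel (\<lambda>x. \<bar>f' x\<bar> powr q)"
  proof -
    have "AE x in lebesgue. \<bar>f x\<bar> powr q = \<bar>f' x\<bar> powr q" using AE_completion[OF ff'] by eventually_elim simp
    then have "integrable lebesgue (\<lambda>x. \<bar>f' x\<bar> powr q)"
      using fq by (rule integrable_cong_AE_imp[rotated 2]) (auto intro: measurable_completion)
    then show ?thesis by (subst (asm) integrable_completion) auto
  qed
  \<comment> \<open>\<open>?K\<close> and \<open>?k\<close> are compared off the origin only; the
    argument x - y meets the origin at the single point y = x, a null set.\<close>
  have AEk: "AE y in lebesgue. ?K (x - y) * f y = ?k (x - y) * f' y" for x
  proof -
    have "AE y in lborel. y \<noteq> x" by (rule AE_I[where N="{x}"]) auto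
    then have "AE y in lborel. ?K (x - y) * f y = ?k (x - y) * f' y"
      using ff' by eventually_elim (simp add: mixed_kernel_eq_subord)
    then show ?thesis by (rule AE_completion)
  qed
  have Km: "(\<lambda>y. ?K (x - y)) \<in> borel_measurable lebesgue" for x by (rule measurable_completion) measurable
  have KLm: "(\<lambda>y. ?K (x - y) * f y) \<in> borel_measurable lebesgue" for x
    by (rule borel_measurable_times[OF Km fm])
  have kLm: "(\<lambda>y. ?k (x - y) * f' y) \<in> borel_measurable lebesgue" for x by (rule measurable_completion) measurable
  define u where "u x = (LINT y|lborel. ?k (x - y) * f' y)" for x
  have u: "conv ?K f x = u x" for x
  proof -
    have "conv ?K f x = (LINT y|lebesgue. ?k (x - y) * f' y)"
      unfolding conv_def by (rule integral_cong_AE[OF KLm kLm AEk])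
    also have "\<dots> = u x" unfolding u_def by (rule integral_completion) measurable
    finally show ?thesis .
  qed
  have um[measurable]: "u \<in> borel_measurable borel"
  proof -
    have "(\<lambda>x. LINT y|lborel. ?k (x - y) * f' y) \<in> borel_measurable lborel" by measurable
    then show ?thesis by (simp add: u_def[abs_def])
  qed
  note pair = integrable_dual_pair[OF f'm f'q q]
  show "AE x in lebesgue. integrable lebesgue (\<lambda>y. ?K (x - y) * f y)"
  proof -
    \<comment> \<open>A positive weight in \<open>x\<close> that is bounded and integrable does not affect integrability in \<open>y\<close>.\<close>
    have g: "integrable lborel (\<lambda>x::'a. exp (- (1 * (norm x)\<^sup>2)))" by (rule integrable_gaussian) simp
    have "integrable (lborel \<Otimes>\<^sub>M lborel) (\<lambda>(y, x). ?k (x - y) * f' y * exp (- (1 * (norm x)\<^sup>2)))"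
      by (rule pair[OF g, of 1]) simp
    then have "AE x in lborel. integrable lborel (\<lambda>y. ?k (x - y) * f' y * exp (- (1 * (norm x)\<^sup>2)))"
      by (rule lborel_pair.AE_integrable_snd)
    then have "AE x in lborel. integrable lebesgue (\<lambda>y. ?K (x - y) * f y)"
    proof eventually_elim
      case (elim x)
      then have "integrable lborel (\<lambda>y. ?k (x - y) * f' y)" by simp
      then have "integrable lebesgue (\<lambda>y. ?k (x - y) * f' y)" by (subst integrable_completion) auto
      then show ?case using AEk[of x] KLm[of x] kLm[of x] by (subst integrable_cong_AE) auto
    qed
    then show ?thesis by (rule AE_completion)
  qed
  show "distributional_solution s (conv ?K f) f"
    unfolding distributional_solution_def
  proof (intro allI impI)
    fix \<phi> :: "'a \<Rightarrow> real" assume \<phi>: "test_function \<phi>"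
    obtain g B where g: "is_mixed_laplacian s \<phi> g" "integrable lborel g" "\<And>x. \<bar>g x\<bar> \<le> B"
      using mixed_laplacian_exists[OF \<phi>] by blast
    obtain B' where B': "\<And>x. \<bar>\<phi> x\<bar> \<le> B'" using test_function_bounded[OF \<phi>] by blast
    have \<phi>i: "integrable lborel \<phi>" and \<phi>c: "continuous_on UNIV \<phi>" and [measurable]: "\<phi> \<in> borel_measurable borel"
      using test_function_integrable[OF \<phi>] test_function_continuous[OF \<phi>] test_function_measurable[OF \<phi>] by auto
    have [measurable]: "g \<in> borel_measurable borel" using g by auto
    have gc: "continuous_on UNIV g" and gF: "\<And>\<xi>. fourier g \<xi> = of_real (symbol s \<xi>) * fourier \<phi> \<xi>"
      using g(1) by (auto simp: is_mixed_laplacian_def)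
    define h where "h x = g x + \<phi> x" for x
    have hi: "integrable lborel h" unfolding h_def by (intro Bochner_Integration.integrable_add g \<phi>i)
    have hb: "\<bar>h x\<bar> \<le> B + B'" for x unfolding h_def using g(3)[of x] B'[of x] by linarith
    have hc: "continuous_on UNIV h" unfolding h_def by (intro continuous_intros gc \<phi>c)
    have [measurable]: "h \<in> borel_measurable borel" using hi by auto
    have hF: "fourier h \<xi> = of_real (1 + symbol s \<xi>) * fourier \<phi> \<xi>" for \<xi>
    proof -
      have "fourier h \<xi> = fourier g \<xi> + fourier \<phi> \<xi>"
        using integrable_mult_echar[OF g(2), of "- \<xi>"] integrable_mult_echar[OF \<phi>i, of "- \<xi>"]
        unfolding h_def by (simp add: fourier_lborel distrib_right)
      then show ?thesis by (simp add: gF distrib_right)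
    qed
    \<comment> \<open>Reflection at \<open>y\<close> together with evenness turns this into the
      convolution of the kernel with \<open>h\<close>.\<close>
    have inv: "(LINT x|lborel. ?k (x - y) * h x) = \<phi> y" for y
    proof -
      have "(LINT x|lborel. ?k (x - y) * h x) = (LINT x|lborel. h (y - (y - x)) * ?k (y - x))"
        using subord_kernel_minus[OF s, of "x - y" for x] by (simp add: mult.commute)
      also have "\<dots> = (LINT z|lborel. h (y - z) * ?k z)"
        by (rule integral_reflection[where g="\<lambda>z. h (y - z) * ?k z"]) measurable
      also have "\<dots> = \<phi> y"
        by (rule subord_kernel_convolution_inverse[OF hc hi hb \<phi>c \<phi>i B' hF])
      finally show ?thesis .
    qed
    have p: "integrable (lborel \<Otimes>\<^sub>M lborel) (\<lambda>(y, x). ?k (x - y) * f' y * h x)" by (rule pair[OF hi hb])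
    have e1: "(LINT y|lborel. ?k (x - y) * f' y * h x) = u x * h x" for x by (simp add: u_def)
    have e2: "(LINT x|lborel. ?k (x - y) * f' y * h x) = f' y * \<phi> y" for y
    proof -
      have "(LINT x|lborel. ?k (x - y) * f' y * h x) = (LINT x|lborel. f' y * (?k (x - y) * h x))" by (simp add: mult_ac)
      then show ?thesis by (simp add: inv)
    qed
    have uh: "integrable lborel (\<lambda>x. u x * h x)" using lborel_pair.integrable_snd[OF p] by (simp only: e1)
    have fp: "integrable lborel (\<lambda>y. f' y * \<phi> y)" using lborel_pair.integrable_fst[OF p] by (simp only: e2)
    have eq: "(LINT x|lborel. u x * h x) = (LINT y|lborel. f' y * \<phi> y)"
      using lborel_pair.Fubini_integral[OF p] by (simp only: e1 e2)
    have m1: "(\<lambda>x. f x * \<phi> x) \<in> borel_measurable lebesgue"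
      by (intro borel_measurable_times fm measurable_completion) measurable
    have m2: "(\<lambda>x. f' x * \<phi> x) \<in> borel_measurable lebesgue" by (rule measurable_completion) measurable
    have ae: "AE x in lebesgue. f x * \<phi> x = f' x * \<phi> x" using AE_completion[OF ff'] by eventually_elim simp
    have "integrable lebesgue (\<lambda>x. f' x * \<phi> x)" using fp by (subst integrable_completion) auto
    then have 1: "integrable lebesgue (\<lambda>x. f x * \<phi> x)" using ae m1 m2 by (subst integrable_cong_AE) auto
    have 2: "(LINT x|lebesgue. f x * \<phi> x) = (LINT x|lborel. f' x * \<phi> x)"
    proof -
      have "(LINT x|lebesgue. f x * \<phi> x) = (LINT x|lebesgue. f' x * \<phi> x)" by (rule integral_cong_AE[OF m1 m2 ae])
      also have "\<dots> = (LINT x|lborel. f' x * \<phi> x)" by (rule integral_completion) measurable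
      finally show ?thesis .
    qed
    have 3: "integrable lebesgue (\<lambda>x. conv ?K f x * (g x + \<phi> x))"
      unfolding u h_def[symmetric] using uh by (subst integrable_completion) auto
    have 4: "(LINT x|lebesgue. conv ?K f x * (g x + \<phi> x)) = (LINT x|lborel. u x * h x)"
      unfolding u h_def[symmetric] by (rule integral_completion) measurable
    show "\<exists>g. is_mixed_laplacian s \<phi> g \<and> integrable lebesgue (\<lambda>x. conv ?K f x * (g x + \<phi> x)) \<and>
            integrable lebesgue (\<lambda>x. f x * \<phi> x) \<and> (LINT x|lebesgue. conv ?K f x * (g x + \<phi> x)) = (LINT x|lebesgue. f x * \<phi> x)"
      using g(1) 1 3 2 4 eq by (intro exI[of _ g]) simp
  qed
qed

end

theorem theorem3p2:
  fixes s :: real and n :: nat and K :: "real ^ 'n \<Rightarrow> real"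
  assumes "0 < s" and "s < 1"
    and "n = CARD('n)"
    and "K = mixed_kernel s"
  shows
    "\<comment> \<open>(a)\<close>
     ((\<forall>x\<in>kernel_dom. set_integrable lebesgue {0<..} (kernel_integrand s x) \<and>
          complex_kernel s x = complex_of_real (K x) \<and> 0 < K x) \<and>
      (\<forall>x y. norm x = norm y \<longrightarrow> K x = K y) \<and>
      smooth_on K (UNIV - {0}) \<and>
      (\<forall>x\<in>kernel_dom. \<forall>y\<in>kernel_dom. norm x \<le> norm y \<longrightarrow> K y \<le> K x))
     \<and> \<comment> \<open>(b)\<close>
     (\<exists>C3>0. \<exists>C4>0.
        (\<forall>x. 1 \<le> norm x \<longrightarrow>
           C3 / norm x powr (real n + 2 * s) \<le> K x \<and>
           K x \<le> 1 / (C3 * norm x powr (real n + 2 * s))) \<and>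
        (\<forall>x. 0 < norm x \<and> norm x \<le> 1 \<longrightarrow>
           C4 / norm x powr (real n - 2) \<le> K x \<and>
           K x \<le> 1 / C4 *
             (if n \<ge> 3 then norm x powr (2 - real n)
              else if n = 2 then 1 + \<bar>ln (norm x)\<bar>
              else 1)))
     \<and> \<comment> \<open>(c)\<close>
     (\<exists>C5>0. \<forall>x. 1 \<le> norm x \<longrightarrow>
        norm (gradient K x) \<le> C5 / norm x powr (real n + 2 * s + 1) \<and>
        onorm (hessian K x) \<le> C5 / norm x powr (real n + 2 * s + 2))
     \<and> \<comment> \<open>(d)\<close>
     ((n \<ge> 3 \<longrightarrow> (\<forall>q. 1 \<le> q \<and> q < real n / (real n - 2) \<longrightarrow> in_Lq q K)) \<and>
      (n = 1 \<or> n = 2 \<longrightarrow> (\<forall>q\<ge>1. in_Lq q K)))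
     \<and> \<comment> \<open>(e)\<close>
     (\<forall>q f. 1 \<le> q \<and> in_Lq q f \<longrightarrow>
        (AE x in lebesgue. integrable lebesgue (\<lambda>y. K (x - y) * f y)) \<and>
        distributional_solution s (conv K f) f)"
proof (intro conjI)
  note s = assms(1,2)
  have n: "n = DIM(real ^ 'n)" using assms(3) by simp
  let ?k = "subord_kernel s :: real ^ 'n \<Rightarrow> real"
  have Kk: "K x = ?k x" if "x \<in> kernel_dom" for x using mixed_kernel_eq[OF s that] assms(4) by simp
  have dom: "x \<in> kernel_dom" if "x \<noteq> 0" for x :: "real ^ 'n" using that by (simp add: kernel_dom_def)
  have K0: "K x = ?k x" if "x \<noteq> 0" for x using Kk[OF dom[OF that]] .
  show "\<forall>x\<in>kernel_dom. set_integrable lebesgue {0<..} (kernel_integrand s x) \<and>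
          complex_kernel s x = complex_of_real (K x) \<and> 0 < K x"
    by (simp add: kernel_representation_dom[OF s] subord_kernel_pos[OF s] Kk)
  show mono: "\<forall>x\<in>kernel_dom. \<forall>y\<in>kernel_dom. norm x \<le> norm y \<longrightarrow> K y \<le> K x"
    by (simp add: subord_kernel_antimono[OF s] Kk)
  show "\<forall>x y. norm x = norm y \<longrightarrow> K x = K y"
  proof (intro allI impI)
    fix x y :: "real ^ 'n" assume xy: "norm x = norm y"
    show "K x = K y"
    proof (cases "x = 0")
      case True then show ?thesis using xy by simp
    next
      case False
      then have "y \<noteq> 0" using xy by auto
      then show ?thesis using mono dom[OF False] dom[of y] xy by (intro antisym) auto
    qed
  qed
  show "smooth_on K (UNIV - {0})"
    using smooth_subord_kernel[OF s] Ck_on_cong[of "UNIV - {0}" K ?k] K0 by (simp add: smooth_on_def open_delete)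
  show "\<exists>C3>0. \<exists>C4>0.
        (\<forall>x. 1 \<le> norm x \<longrightarrow>
           C3 / norm x powr (real n + 2 * s) \<le> K x \<and>
           K x \<le> 1 / (C3 * norm x powr (real n + 2 * s))) \<and>
        (\<forall>x. 0 < norm x \<and> norm x \<le> 1 \<longrightarrow>
           C4 / norm x powr (real n - 2) \<le> K x \<and>
           K x \<le> 1 / C4 *
             (if n \<ge> 3 then norm x powr (2 - real n)
              else if n = 2 then 1 + \<bar>ln (norm x)\<bar>
              else 1))"
  proof -
    obtain C where C: "0 < C" "\<And>x::real ^ 'n. x \<noteq> 0 \<Longrightarrow> ?k x \<le> C * norm x powr (- (n + 2 * s))"
      using subord_kernel_upper_far[OF s, where 'a="real ^ 'n"] unfolding n by blast
    obtain c where c: "0 < c" "\<And>x::real ^ 'n. x \<noteq> 0 \<Longrightarrow> norm x \<le> 1 \<Longrightarrow> c * norm x powr (2 - real n) \<le> ?k x"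
       "\<And>x::real ^ 'n. 1 \<le> norm x \<Longrightarrow> c * norm x powr (- (n + 2 * s)) \<le> ?k x"
      using subord_kernel_lower[OF s, where 'a="real ^ 'n"] unfolding n by blast
    obtain D where D: "0 < D" "\<And>x::real ^ 'n. 0 < norm x \<Longrightarrow> norm x \<le> 1 \<Longrightarrow> ?k x \<le> D *
        (if n \<ge> 3 then norm x powr (2 - real n) else if n = 2 then 1 + \<bar>ln (norm x)\<bar> else 1)"
      using subord_kernel_upper_near[OF s, where 'a="real ^ 'n"] unfolding n by blast
    \<comment> \<open>One constant has to serve as the factor of the lower bound and, through its
      reciprocal, of the upper bound; hence the minimum.\<close>
    define C3 C4 where "C3 = min c (1 / C)" and "C4 = min c (1 / D)"
    have C3: "0 < C3" "C3 \<le> c" "C \<le> 1 / C3" and C4: "0 < C4" "C4 \<le> c" "D \<le> 1 / C4"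
      using c C D by (auto simp: C3_def C4_def min_def field_simps)
    have far: "C3 / norm x powr (real n + 2 * s) \<le> K x \<and> K x \<le> 1 / (C3 * norm x powr (real n + 2 * s))" if x: "1 \<le> norm x" for x
    proof -
      have x0: "x \<noteq> 0" using x by auto
      have p: "norm x powr (- (n + 2 * s)) = 1 / norm x powr (real n + 2 * s)" by (rule powr_minus_divide)
      have "C3 * norm x powr (- (n + 2 * s)) \<le> c * norm x powr (- (n + 2 * s))" using C3 by (intro mult_right_mono) auto
      moreover have "C * norm x powr (- (n + 2 * s)) \<le> 1 / C3 * norm x powr (- (n + 2 * s))" using C3 by (intro mult_right_mono) auto
      ultimately have "C3 * norm x powr (- (n + 2 * s)) \<le> K x \<and> K x \<le> 1 / C3 * norm x powr (- (n + 2 * s))"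
        using c(3)[OF x] C(2)[OF x0] K0[OF x0] by linarith
      then show ?thesis unfolding p by simp
    qed
    have near: "C4 / norm x powr (real n - 2) \<le> K x \<and> K x \<le> 1 / C4 * (if n \<ge> 3 then norm x powr (2 - real n) else if n = 2 then 1 + \<bar>ln (norm x)\<bar> else 1)"
      if x: "0 < norm x" "norm x \<le> 1" for x
    proof -
      have x0: "x \<noteq> 0" using x by auto
      let ?b = "if n \<ge> 3 then norm x powr (2 - real n) else if n = 2 then 1 + \<bar>ln (norm x)\<bar> else 1"
      have p: "norm x powr (2 - real n) = 1 / norm x powr (real n - 2)" using powr_minus_divide[of "norm x" "real n - 2"] by simp
      have "C4 * norm x powr (2 - real n) \<le> c * norm x powr (2 - real n)" using C4 by (intro mult_right_mono) auto
      then have 1: "C4 * norm x powr (2 - real n) \<le> K x" using c(2)[OF x0 x(2)] K0[OF x0] by linarith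
      have "D * ?b \<le> 1 / C4 * ?b" using C4 by (intro mult_right_mono) auto
      then have 2: "K x \<le> 1 / C4 * ?b" using D(2)[OF x] K0[OF x0] by linarith
      have "C4 / norm x powr (real n - 2) \<le> K x" using 1 unfolding p by simp
      then show ?thesis using 2 by blast
    qed
    show ?thesis using C3(1) C4(1) far near by blast
  qed
  show "\<exists>C5>0. \<forall>x. 1 \<le> norm x \<longrightarrow>
        norm (gradient K x) \<le> C5 / norm x powr (real n + 2 * s + 1) \<and>
        onorm (hessian K x) \<le> C5 / norm x powr (real n + 2 * s + 2)"
  proof -
    obtain C where C: "0 < C"
    "\<And>K x::real ^ 'n. x \<noteq> 0 \<Longrightarrow> (\<And>y. y \<noteq> 0 \<Longrightarrow> K y = ?k y) \<Longrightarrow>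
      norm (gradient K x) \<le> C * norm x powr (- (n + 2 * s + 1)) \<and>
      onorm (hessian K x) \<le> C * norm x powr (- (n + 2 * s + 2))"
      using kernel_derivative_bounds[OF s, where 'a="real ^ 'n"] unfolding n by blast
    have "norm (gradient K x) \<le> C / norm x powr (real n + 2 * s + 1) \<and>
        onorm (hessian K x) \<le> C / norm x powr (real n + 2 * s + 2)" if "1 \<le> norm x" for x
    proof -
      have "x \<noteq> 0" using that by auto
      from C(2)[OF this K0] show ?thesis unfolding powr_minus_divide by simp
    qed
    then show ?thesis using C(1) by blast
  qed
  show "n \<ge> 3 \<longrightarrow> (\<forall>q. 1 \<le> q \<and> q < real n / (real n - 2) \<longrightarrow> in_Lq q K)"
    unfolding n assms(4) using mixed_kernel_in_Lq_high_dim[OF s] by blast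
  show "n = 1 \<or> n = 2 \<longrightarrow> (\<forall>q\<ge>1. in_Lq q K)"
    unfolding n assms(4) using mixed_kernel_in_Lq_low_dim[OF s] by blast
  show "\<forall>q f. 1 \<le> q \<and> in_Lq q f \<longrightarrow>
        (AE x in lebesgue. integrable lebesgue (\<lambda>y. K (x - y) * f y)) \<and>
        distributional_solution s (conv K f) f"
    unfolding assms(4) using mixed_kernel_solution[OF s] by blast
qed

end
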